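(* There is an efficient randomized algorithm that, given an $n$-vertex $k$-edge-connected graph $G$ of diameter at most $D$, such that $k>1000\ln n$, computes a collection $\{T_1,\ldots,T_r\}$ of $r=\Omega(k/\ln n)$ edge-disjoint spanning trees of $G$, such that, with probability $1-1/\mathrm{poly}(n)$, each resulting tree $T_i$ has diameter $O(k^{D(D+1)/2})$.
   Context: Graphs are finite, undirected, unweighted, without loops; parallel edges are allowed. "Efficient" means running time polynomial in the input size. A collection of trees in $G$ is edge-disjoint if every edge of $G$ belongs to at most one of the trees. A graph is $k$-edge-connected if it remains connected after deletion of any set of at most $k-1$ edges. *)

theory Defs
  imports
    "HOL-Probability.Probability"
    "HOL-Computational_Algebra.Polynomial"
    "HOL-Library.Extended_Nat"
begin

section \<open>Undirected multigraphs\<close>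

text \<open>
  Edges are abstract objects with a set of endpoints, so parallel edges are distinct edges with the
  same endpoints. The libraries only provide directed (multi)graphs, whose forests are defined by
  the absence of directed cycles.
\<close>

record ('v, 'e) mgraph =
  vertices :: "'v set"
  edges :: "'e set"
  ends :: "'e \<Rightarrow> 'v set"

definition multigraph :: "('v, 'e) mgraph \<Rightarrow> bool" where
  "multigraph G \<longleftrightarrow> finite (vertices G) \<and> finite (edges G) \<and>
     (\<forall>e\<in>edges G. ends G e \<subseteq> vertices G \<and> card (ends G e) = 2)"

definition with_edges :: "('v, 'e) mgraph \<Rightarrow> 'e set \<Rightarrow> ('v, 'e) mgraph" where
  "with_edges G F = \<lparr>vertices = vertices G, edges = F, ends = ends G\<rparr>"

fun walk :: "('v, 'e) mgraph \<Rightarrow> 'v \<Rightarrow> 'e list \<Rightarrow> 'v \<Rightarrow> bool" where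
  "walk G u [] v \<longleftrightarrow> u \<in> vertices G \<and> u = v"
| "walk G u (e # es) v \<longleftrightarrow> e \<in> edges G \<and> (\<exists>w. ends G e = {u, w} \<and> walk G w es v)"

definition connected_graph :: "('v, 'e) mgraph \<Rightarrow> bool" where
  "connected_graph G \<longleftrightarrow> vertices G \<noteq> {} \<and>
     (\<forall>u\<in>vertices G. \<forall>v\<in>vertices G. \<exists>p. walk G u p v)"

definition k_edge_connected :: "nat \<Rightarrow> ('v, 'e) mgraph \<Rightarrow> bool" where
  "k_edge_connected k G \<longleftrightarrow>
     (\<forall>X. X \<subseteq> edges G \<and> card X < k \<longrightarrow> connected_graph (with_edges G (edges G - X)))"

text \<open>Distances between different components, and diameters of disconnected graphs, are infinite.\<close>

definition graph_dist :: "('v, 'e) mgraph \<Rightarrow> 'v \<Rightarrow> 'v \<Rightarrow> enat" where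
  "graph_dist G u v = (INF p\<in>{p. walk G u p v}. enat (length p))"

definition graph_diameter :: "('v, 'e) mgraph \<Rightarrow> enat" where
  "graph_diameter G = (SUP u\<in>vertices G. SUP v\<in>vertices G. graph_dist G u v)"

text \<open>Two parallel edges form a cycle of length 2; distinctness of the edges matters only there.\<close>

definition is_cycle :: "('v, 'e) mgraph \<Rightarrow> 'v list \<Rightarrow> 'e list \<Rightarrow> bool" where
  "is_cycle G vs es \<longleftrightarrow> es \<noteq> [] \<and> length vs = length es \<and> distinct vs \<and> distinct es \<and>
     set vs \<subseteq> vertices G \<and> set es \<subseteq> edges G \<and>
     (\<forall>i<length es. ends G (es ! i) = {vs ! i, vs ! (Suc i mod length es)})"

definition tree_graph :: "('v, 'e) mgraph \<Rightarrow> bool" where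
  "tree_graph G \<longleftrightarrow> connected_graph G \<and> \<not> (\<exists>vs es. is_cycle G vs es)"

definition spanning_tree_edges :: "('v, 'e) mgraph \<Rightarrow> 'e set \<Rightarrow> bool" where
  "spanning_tree_edges G F \<longleftrightarrow> F \<subseteq> edges G \<and> tree_graph (with_edges G F)"


section \<open>Randomized random-access machine\<close>

text \<open>
  Structured programs over finitely many registers and an unbounded memory of natural numbers, with
  fair coin flips. One execution step has unit cost. The only arithmetic is addition and truncated
  subtraction (no multiplication or shift), so after \<open>t\<close> steps all numbers have \<open>O(t)\<close> bits more
  than the input numbers and unit cost is polynomially equivalent to Turing machine time.
\<close>

datatype aexp =
    Const nat
  | Reg string
  | Load aexp
  | Add aexp aexp
  | Sub aexp aexp

datatype bexp =
    Less aexp aexp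
  | BNot bexp
  | BAnd bexp bexp

datatype com =
    Skip
  | Assign string aexp
  | Store aexp aexp
  | Flip string
  | Seq com com
  | If bexp com com
  | While bexp com

record ram =
  reg :: "string \<Rightarrow> nat"
  mem :: "nat \<Rightarrow> nat"

primrec aval :: "aexp \<Rightarrow> ram \<Rightarrow> nat" where
  "aval (Const n) s = n"
| "aval (Reg x) s = reg s x"
| "aval (Load a) s = mem s (aval a s)"
| "aval (Add a b) s = aval a s + aval b s"
| "aval (Sub a b) s = aval a s - aval b s"

primrec bval :: "bexp \<Rightarrow> ram \<Rightarrow> bool" where
  "bval (Less a b) s \<longleftrightarrow> aval a s < aval b s"
| "bval (BNot b) s \<longleftrightarrow> \<not> bval b s"
| "bval (BAnd b c) s \<longleftrightarrow> bval b s \<and> bval c s"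

definition set_reg :: "string \<Rightarrow> nat \<Rightarrow> ram \<Rightarrow> ram" where
  "set_reg x n s = s\<lparr>reg := (reg s)(x := n)\<rparr>"

definition set_mem :: "nat \<Rightarrow> nat \<Rightarrow> ram \<Rightarrow> ram" where
  "set_mem i n s = s\<lparr>mem := (mem s)(i := n)\<rparr>"

text \<open>The program \<open>Skip\<close> is the halted one.\<close>

primrec step :: "com \<Rightarrow> ram \<Rightarrow> (com \<times> ram) pmf" where
  "step Skip s = return_pmf (Skip, s)"
| "step (Assign x a) s = return_pmf (Skip, set_reg x (aval a s) s)"
| "step (Store a b) s = return_pmf (Skip, set_mem (aval a s) (aval b s) s)"
| "step (Flip x) s = map_pmf (\<lambda>b. (Skip, set_reg x (if b then 1 else 0) s)) (bernoulli_pmf (1/2))"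
| "step (Seq c d) s =
     (if c = Skip then return_pmf (d, s) else map_pmf (\<lambda>(c', s'). (Seq c' d, s')) (step c s))"
| "step (If b c d) s = return_pmf (if bval b s then c else d, s)"
| "step (While b c) s = return_pmf (If b (Seq c (While b c)) Skip, s)"

primrec run :: "nat \<Rightarrow> com \<Rightarrow> ram \<Rightarrow> (com \<times> ram) pmf" where
  "run 0 c s = return_pmf (c, s)"
| "run (Suc t) c s = bind_pmf (step c s) (\<lambda>(c', s'). run t c' s')"

definition init_ram :: "nat list \<Rightarrow> ram" where
  "init_ram xs = \<lparr>reg = (\<lambda>_. 0), mem = (\<lambda>i. if i < length xs then xs ! i else 0)\<rparr>"

text \<open>Worst case over all coin flips.\<close>

definition halts_within :: "com \<Rightarrow> nat list \<Rightarrow> nat \<Rightarrow> bool" where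
  "halts_within P xs t \<longleftrightarrow> (\<forall>(c, s)\<in>set_pmf (run t P (init_ram xs)). c = Skip)"

text \<open>
  A list of lists of numbers is output at the start of the memory as its length, followed for each
  member by the length and the entries of that member.
\<close>

primrec read_blocks :: "(nat \<Rightarrow> nat) \<Rightarrow> nat \<Rightarrow> nat \<Rightarrow> nat list list" where
  "read_blocks m 0 a = []"
| "read_blocks m (Suc r) a = map m [Suc a..<Suc a + m a] # read_blocks m r (Suc a + m a)"

definition output_of :: "ram \<Rightarrow> nat list list" where
  "output_of s = read_blocks (mem s) (mem s 0) 1"

text \<open>The output distribution, provided that the program halts within \<open>t\<close> steps.\<close>

definition output_pmf :: "com \<Rightarrow> nat list \<Rightarrow> nat \<Rightarrow> nat list list pmf" where
  "output_pmf P xs t = map_pmf (\<lambda>(c, s). output_of s) (run t P (init_ram xs))"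


section \<open>Graphs as inputs\<close>

text \<open>
  An input graph has vertices \<open>0, ..., n - 1\<close> and is given by the list of the endpoint pairs of its
  edges; the edges are identified with the positions in this list.
\<close>

definition graph_of :: "nat \<Rightarrow> (nat \<times> nat) list \<Rightarrow> (nat, nat) mgraph" where
  "graph_of n es = \<lparr>vertices = {..<n}, edges = {..<length es},
     ends = (\<lambda>i. {fst (es ! i), snd (es ! i)})\<rparr>"

definition encode :: "nat \<Rightarrow> nat \<Rightarrow> (nat \<times> nat) list \<Rightarrow> nat list" where
  "encode n k es = n # length es # k # concat (map (\<lambda>(u, v). [u, v]) es)"

text \<open>An output tree is given by the list of its edges.\<close>

definition disjoint_spanning_trees :: "(nat, nat) mgraph \<Rightarrow> nat list list \<Rightarrow> bool" where
  "disjoint_spanning_trees G Ts \<longleftrightarrow>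
     (\<forall>T\<in>set Ts. spanning_tree_edges G (set T)) \<and>
     disjoint_family_on (\<lambda>i. set (Ts ! i)) {..<length Ts}"

end

theory Submission
  imports Defs
begin

text \<open>
  Colour every edge independently and uniformly with one of \<open>r = \<Theta>(k / ln n)\<close> colours. If all
  colour classes are connected, output a breadth-first search tree of each class; otherwise output
  the trees of a deterministic packing, computed with augmenting sequences for the union of graphic
  matroids. If a set \<open>X\<close> of coloured edges is closed under exchanges, then every forest has fewer than
  \<open>2 |X| / k\<close> edges in \<open>X\<close>, as every cut has at least \<open>k\<close> edges; so at most \<open>k / 2\<close> forests cannot cover \<open>X\<close>, and augmentation never gets stuck.

  A class \<open>H\<close> is connected with high probability: among \<open>t = k / 2\<close> disjoint spanning trees some tree
  \<open>T\<close> crosses a given cut in at most a \<open>1 / t\<close> fraction of its edges, and a cut is determined by its edges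
  in \<open>T\<close>, so that the failure probabilities of all cuts can be summed.

  For the diameter, let \<open>F\<close> consist of one edge from every vertex at distance \<open>j\<close> from the root to a vertex
  at distance \<open>j - 1\<close>. If every vertex reaches distance at most \<open>j\<close> within \<open>g\<close> steps of \<open>H\<close>, then a ball of
  radius about \<open>2 k g\<close> in \<open>H - F\<close> either leads to a smaller distance or contains \<open>k\<close> vertices at distance
  \<open>j\<close>. As \<open>F\<close> is coloured independently of \<open>H - F\<close>, one of their edges in \<open>F\<close> belongs to \<open>H\<close> with high
  probability. Hence the root is reached within \<open>(2 k + 1)^D\<close> steps, which is \<open>O(k^(D (D + 1) / 2))\<close>.
  If \<open>k \<ge> n\<close>, every spanning tree is good enough; this case is separate because the number of colours is
  not polynomial in \<open>n\<close> then.
\<close>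

section \<open>Connectivity in multigraphs\<close>

text \<open>The trees must be disjoint, spanning and numerous for every outcome of the coin flips,
  and the running time is a worst case over them; only the diameter may fail. This is why a
  deterministic packing stands behind the random colouring, and why \<open>r\<close> is a power of
  2: boundedly many fair flips yield exactly uniform colours only for such \<open>r\<close>. The
  same packing takes the place of a bound on the number of small cuts in the analysis of
  connectivity.

  The program does not know \<open>D\<close>. Levels and balls occur in the analysis alone, and the
  trees are rooted at vertex 0.

  With \<open>b\<close> the bit length of \<open>n\<close>, the choice of \<open>r\<close> ensures
  \<open>100 * b * r \<le> k < 200 * b * r\<close>. By the first inequality, \<open>k div 2\<close>
  fixed edges miss a given colour with probability at most \<open>1 / n ^ 10\<close>, which is small
  enough to be summed over fewer than \<open>n\<close> colours and at most \<open>n ^ 2\<close>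
  balls for each of them. By the second one and \<open>b \<le> 3 * ln n\<close>, there are at least
  \<open>k / (600 * ln n)\<close> trees.\<close>

locale multigraph_on =
  fixes V :: "'v set" and E :: "'e set" and en :: "'e \<Rightarrow> 'v set"
  assumes finite_V: "finite V" and finite_E: "finite E"
    and en_subset: "e \<in> E \<Longrightarrow> en e \<subseteq> V" and card_en: "e \<in> E \<Longrightarrow> card (en e) = 2"
begin

definition adj :: "'e set \<Rightarrow> 'v \<Rightarrow> 'v \<Rightarrow> bool" where
  "adj A u v \<longleftrightarrow> (\<exists>e\<in>A. en e = {u, v})"

primrec rch :: "'e set \<Rightarrow> nat \<Rightarrow> 'v \<Rightarrow> 'v \<Rightarrow> bool" where
  "rch A 0 u v \<longleftrightarrow> u = v"
| "rch A (Suc i) u v \<longleftrightarrow> rch A i u v \<or> (\<exists>w. rch A i u w \<and> adj A w v)"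

definition con :: "'e set \<Rightarrow> 'v \<Rightarrow> 'v \<Rightarrow> bool" where
  "con A u v \<longleftrightarrow> (\<exists>i. rch A i u v)"

lemma adj_sym: "adj A u v \<longleftrightarrow> adj A v u"
  unfolding adj_def by (simp add: insert_commute)

lemma adj_mono: "adj A u v \<Longrightarrow> A \<subseteq> B \<Longrightarrow> adj B u v"
  unfolding adj_def by blast

lemma adj_in_V: "adj A u v \<Longrightarrow> A \<subseteq> E \<Longrightarrow> u \<in> V \<and> v \<in> V"
  unfolding adj_def using en_subset by blast

lemma rch_refl [simp]: "rch A i u u"
  by (induction i) auto

lemma rch_le: "rch A i u v \<Longrightarrow> i \<le> j \<Longrightarrow> rch A j u v"
proof (induction j)
  case (Suc j) then show ?case by (cases "i = Suc j") auto
qed auto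

lemma rch_mono: "rch A i u v \<Longrightarrow> A \<subseteq> B \<Longrightarrow> rch B i u v"
  by (induction i arbitrary: v) (auto intro: adj_mono)

lemma rch_trans: "rch A i u v \<Longrightarrow> rch A j v w \<Longrightarrow> rch A (i + j) u w"
  by (induction j arbitrary: w) auto

lemma rch_1: "adj A u v \<Longrightarrow> rch A (Suc 0) u v"
  by auto

lemma rch_sym: "rch A i u v \<Longrightarrow> rch A i v u"
proof (induction i arbitrary: v)
  case (Suc i)
  then consider "rch A i u v" | w where "rch A i u w" "adj A w v" by auto
  then show ?case
  proof cases
    case 2
    then have "rch A (Suc 0) v w" using rch_1 adj_sym by blast
    then have "rch A (Suc 0 + i) v u" using 2 Suc.IH rch_trans by blast
    then show ?thesis by simp
  qed (use Suc.IH in auto)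
qed auto

lemma rch_in_V: "rch A i u v \<Longrightarrow> A \<subseteq> E \<Longrightarrow> u \<in> V \<Longrightarrow> v \<in> V"
  by (induction i arbitrary: v) (use adj_in_V in auto)

lemma con_refl [simp]: "con A u u"
  unfolding con_def using rch_refl by blast

lemma con_sym: "con A u v \<Longrightarrow> con A v u"
  unfolding con_def using rch_sym by blast

lemma con_trans: "con A u v \<Longrightarrow> con A v w \<Longrightarrow> con A u w"
  unfolding con_def using rch_trans by blast

lemma con_mono: "con A u v \<Longrightarrow> A \<subseteq> B \<Longrightarrow> con B u v"
  unfolding con_def using rch_mono by blast

lemma con_adj: "adj A u v \<Longrightarrow> con A u v"
  unfolding con_def using rch_1 by blast

lemma con_in_V: "con A u v \<Longrightarrow> A \<subseteq> E \<Longrightarrow> u \<in> V \<Longrightarrow> v \<in> V"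
  unfolding con_def using rch_in_V by blast

lemma con_induct [consumes 1, case_names refl step]:
  assumes "con A u v" "P u" "\<And>x y. con A u x \<Longrightarrow> P x \<Longrightarrow> adj A x y \<Longrightarrow> P y"
  shows "P v"
proof -
  obtain i where "rch A i u v" using assms(1) con_def by auto
  then show ?thesis
    by (induction i arbitrary: v) (use assms(2,3) con_def in auto)
qed

lemma con_subset_con:
  assumes "\<And>e u v. e \<in> A \<Longrightarrow> en e = {u, v} \<Longrightarrow> con B u v" and "con A u v"
  shows "con B u v"
  using assms(2)
proof (induction rule: con_induct)
  case (step x y)
  then show ?case using assms(1) con_trans unfolding adj_def by blast
qed auto

lemma con_insert:
  assumes "en e = {p, q}"
  shows "con (insert e A) u v \<longleftrightarrow> con A u v \<or> con A u p \<and> con A q v \<or> con A u q \<and> con A p v"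
    (is "?l \<longleftrightarrow> ?r")
proof
  assume ?l
  then show ?r
  proof (induction rule: con_induct)
    case (step x y)
    then consider "adj A x y" | "x = p" "y = q" | "x = q" "y = p"
      unfolding adj_def using assms by (metis doubleton_eq_iff insert_iff)
    then show ?case
    proof cases
      case 1 then show ?thesis using step.IH con_trans[OF _ con_adj[OF 1]] by metis
    next
      case 2 then show ?thesis using step.IH by (metis con_trans con_sym con_refl)
    next
      case 3 then show ?thesis using step.IH by (metis con_trans con_sym con_refl)
    qed
  qed auto
next
  have "adj (insert e A) p q" unfolding adj_def using assms by auto
  then have s: "con (insert e A) p q" by (rule con_adj)
  assume ?r
  then show ?l using con_mono[of A _ _ "insert e A"] by (metis con_trans s con_sym subset_insertI)
qed

section \<open>Components and cuts\<close>

definition conn_on :: "'e set \<Rightarrow> bool" where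
  "conn_on A \<longleftrightarrow> (\<forall>u\<in>V. \<forall>v\<in>V. con A u v)"

definition cls :: "'e set \<Rightarrow> 'v \<Rightarrow> 'v set" where
  "cls A v = {w \<in> V. con A v w}"

definition ncomp :: "'e set \<Rightarrow> nat" where
  "ncomp A = card (cls A ` V)"

lemma cls_eq_iff: "u \<in> V \<Longrightarrow> v \<in> V \<Longrightarrow> cls A u = cls A v \<longleftrightarrow> con A u v"
  unfolding cls_def using con_sym con_trans con_refl by blast

lemma ncomp_empty: "ncomp {} = card V"
proof -
  have "con {} u v \<longleftrightarrow> u = v" for u v
    using con_induct[of "{}" u v "\<lambda>x. x = u"] unfolding adj_def by auto
  then have "inj_on (cls {}) V" using cls_eq_iff by (auto intro!: inj_onI)
  then show ?thesis unfolding ncomp_def by (simp add: card_image)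
qed

lemma ncomp_cong: "(\<And>u v. con A u v \<longleftrightarrow> con B u v) \<Longrightarrow> ncomp A = ncomp B"
  unfolding ncomp_def cls_def by simp

lemma ncomp_le_1_iff: "ncomp A \<le> 1 \<longleftrightarrow> conn_on A"
proof
  assume "ncomp A \<le> 1"
  then have "card (cls A ` V) \<le> Suc 0" "finite (cls A ` V)" unfolding ncomp_def using finite_V by auto
  then show "conn_on A" unfolding conn_on_def using card_le_Suc0_iff_eq cls_eq_iff by (metis imageI)
next
  assume "conn_on A"
  then have "\<forall>x\<in>cls A ` V. \<forall>y\<in>cls A ` V. x = y" unfolding conn_on_def using cls_eq_iff by auto
  then have "card (cls A ` V) \<le> Suc 0" using card_le_Suc0_iff_eq finite_V by (metis finite_imageI)
  then show "ncomp A \<le> 1" unfolding ncomp_def by simp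
qed

lemma ncomp_insert_con:
  assumes "en e = {p, q}" "con A p q"
  shows "con (insert e A) u v \<longleftrightarrow> con A u v"
  unfolding con_insert[OF assms(1)] using assms(2) con_trans con_sym by blast

text \<open>Only the components of \<open>p\<close> and \<open>q\<close> change: they are replaced
  by their union, and exactly one component is lost.\<close>

lemma ncomp_insert_sep:
  assumes e: "en e = {p, q}" "p \<in> V" "q \<in> V" and sep: "\<not> con A p q"
  shows "ncomp A = Suc (ncomp (insert e A))"
proof -
  let ?B = "insert e A" and ?P = "cls A p" and ?Q = "cls A q"
  have PQ: "?P \<noteq> ?Q" using cls_eq_iff e sep by blast
  have p: "p \<in> ?P" "q \<in> ?Q" unfolding cls_def using e by auto
  have 1: "cls ?B v = (if con A v p \<or> con A v q then ?P \<union> ?Q else cls A v)" if "v \<in> V" for v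
  proof -
    have "con ?B v w \<longleftrightarrow> (if con A v p \<or> con A v q then con A p w \<or> con A q w else con A v w)" for w
      unfolding con_insert[OF e(1)] using con_sym con_trans by metis
    then show ?thesis unfolding cls_def by auto
  qed
  have "cls ?B ` V = insert (?P \<union> ?Q) (cls A ` V - {?P, ?Q})"
  proof
    show "cls ?B ` V \<subseteq> insert (?P \<union> ?Q) (cls A ` V - {?P, ?Q})"
      using 1 cls_eq_iff e by auto
    show "insert (?P \<union> ?Q) (cls A ` V - {?P, ?Q}) \<subseteq> cls ?B ` V"
    proof
      fix x assume "x \<in> insert (?P \<union> ?Q) (cls A ` V - {?P, ?Q})"
      then consider "x = ?P \<union> ?Q" | v where "v \<in> V" "x = cls A v" "x \<noteq> ?P" "x \<noteq> ?Q" by auto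
      then show "x \<in> cls ?B ` V"
      proof cases
        case 1 then show ?thesis using \<open>\<And>v. v \<in> V \<Longrightarrow> cls ?B v = _ v\<close> e con_refl by (metis imageI)
      next
        case 2 then have "\<not> con A v p" "\<not> con A v q" using cls_eq_iff e by auto
        then show ?thesis using 1 2 by (metis imageI)
      qed
    qed
  qed
  moreover have "?P \<union> ?Q \<notin> cls A ` V - {?P, ?Q}"
  proof
    assume "?P \<union> ?Q \<in> cls A ` V - {?P, ?Q}"
    then obtain v where "v \<in> V" "?P \<union> ?Q = cls A v" by auto
    then have "con A v p" "con A v q" using p unfolding cls_def by blast+
    then show False using sep con_sym con_trans by blast
  qed
  moreover have "finite (cls A ` V)" using finite_V by simp
  moreover have "card (cls A ` V - {?P, ?Q}) = card (cls A ` V) - 2"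
    using PQ e by (subst card_Diff_subset) auto
  moreover have "card (cls A ` V) \<ge> 2"
  proof -
    have "card {?P, ?Q} \<le> card (cls A ` V)" by (rule card_mono) (use e finite_V in auto)
    then show ?thesis using PQ by simp
  qed
  ultimately show ?thesis unfolding ncomp_def by simp
qed

lemma ends_E: assumes "e \<in> E" obtains p q where "en e = {p, q}" "p \<in> V" "q \<in> V" "p \<noteq> q"
proof -
  obtain p q where "en e = {p, q}" "p \<noteq> q" using card_en[OF assms] by (meson card_2_iff)
  then show ?thesis using en_subset[OF assms] that by auto
qed

lemma ncomp_insert_le: "e \<in> E \<Longrightarrow> ncomp A \<le> Suc (ncomp (insert e A))"
  using ends_E ncomp_insert_sep ncomp_insert_con ncomp_cong by (metis le_Suc_eq order_refl)

text \<open>Without edges there are \<open>card V\<close> components, and each inserted edge merges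
  at most two of them.\<close>

lemma ncomp_ge: "A \<subseteq> E \<Longrightarrow> card V \<le> ncomp A + card A"
proof -
  assume "A \<subseteq> E"
  then have "finite A" using finite_E finite_subset by blast
  then show ?thesis using \<open>A \<subseteq> E\<close>
  proof (induction A)
    case empty then show ?case using ncomp_empty by simp
  next
    case (insert e A) then show ?case using ncomp_insert_le[of e A] by simp
  qed
qed

lemma cls_disjoint: "X \<in> cls A ` V \<Longrightarrow> Y \<in> cls A ` V \<Longrightarrow> X \<noteq> Y \<Longrightarrow> X \<inter> Y = {}"
  unfolding cls_def using con_sym con_trans by blast

definition cut :: "'e set \<Rightarrow> 'v set \<Rightarrow> 'e set" where
  "cut A S = {e \<in> A. en e \<inter> S \<noteq> {} \<and> en e - S \<noteq> {}}"

text \<open>In the language of the graphic matroid, \<open>e\<close> lies outside the span of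
  \<open>A\<close>.\<close>

definition sep :: "'e set \<Rightarrow> 'e \<Rightarrow> bool" where
  "sep A e \<longleftrightarrow> (\<exists>p q. en e = {p, q} \<and> \<not> con A p q)"

lemma sep_iff: "en e = {p, q} \<Longrightarrow> sep A e \<longleftrightarrow> \<not> con A p q"
  unfolding sep_def using con_sym by (metis doubleton_eq_iff)

lemma sep_cong: "(\<And>u v. con A u v \<longleftrightarrow> con B u v) \<Longrightarrow> sep A e \<longleftrightarrow> sep B e"
  unfolding sep_def by simp

lemma cut_cls_sep: assumes "e \<in> cut E (cls A v)" shows "sep A e"
proof -
  have eE: "e \<in> E" and ne: "en e \<inter> cls A v \<noteq> {}" "en e - cls A v \<noteq> {}" using assms unfolding cut_def by auto
  obtain p q where pq: "en e = {p, q}" "p \<in> V" "q \<in> V" using ends_E[OF eE] by metis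
  have "\<not> con A p q"
  proof
    assume "con A p q"
    then have "p \<in> cls A v \<longleftrightarrow> q \<in> cls A v" unfolding cls_def using pq con_trans con_sym by blast
    then show False using ne pq by auto
  qed
  then show ?thesis using pq sep_def by blast
qed

lemma no_cut_con: assumes "cut A S = {}" "u \<in> S" "con A u v" shows "v \<in> S"
  using assms(3) 
proof (induction rule: con_induct)
  case refl then show ?case using assms by simp
next
  case (step x y) then show ?case using assms(1) unfolding cut_def adj_def by auto
qed

text \<open>Of two vertices in different components one is not connected to \<open>s\<close>, and
  its component serves as \<open>S\<close>. Keeping \<open>s\<close> outside makes every cut
  correspond to a single set \<open>S\<close>, as a union bound over cuts requires.\<close>

lemma cut_empty_conn:
  assumes "A \<subseteq> E" "\<not> conn_on A" "s \<in> V"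
  obtains S where "S \<subseteq> V" "s \<notin> S" "S \<noteq> {}" "cut A S = {}"
proof -
  obtain u v where uv: "u \<in> V" "v \<in> V" "\<not> con A u v" using assms conn_on_def by auto
  then obtain w where w: "w \<in> V" "\<not> con A w s" using con_sym con_trans by blast
  have "cut A (cls A w) = {}"
  proof -
    { fix e assume "e \<in> cut A (cls A w)"
      then have "e \<in> A" "sep A e" using cut_cls_sep assms(1) unfolding cut_def by auto
      then have False unfolding sep_def using con_adj adj_def by blast }
    then show ?thesis by blast
  qed
  then show ?thesis using that[of "cls A w"] w con_refl unfolding cls_def by blast
qed

lemma conn_cut_nonempty:
  assumes "conn_on A" "S \<subseteq> V" "S \<noteq> {}" "s \<in> V" "s \<notin> S"
  shows "cut A S \<noteq> {}"
  using assms no_cut_con unfolding conn_on_def by blast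

end


section \<open>Packing spanning trees\<close>

lemma card_exchange: "finite S \<Longrightarrow> f \<in> S \<Longrightarrow> e \<notin> S \<Longrightarrow> card (insert e (S - {f})) = card S"
  by (metis DiffD1 card.insert card.remove finite_Diff)

context multigraph_on
begin

text \<open>Double counting: an edge lies in the boundary of at most two components, those of its
  endpoints.\<close>

lemma sum_card_cut_cls:
  assumes "X \<subseteq> E"
  shows "(\<Sum>B\<in>cls A ` V. card (cut X B)) \<le> 2 * card X"
proof -
  let ?P = "cls A ` V"
  have fX: "finite X" using assms finite_E finite_subset by blast
  have fP: "finite ?P" using finite_V by simp
  have "(\<Sum>B\<in>?P. card (cut X B)) = (\<Sum>B\<in>?P. \<Sum>e\<in>X. if e \<in> cut X B then 1 else 0)"
  proof (rule sum.cong)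
    fix B
    have "X \<inter> {e. e \<in> cut X B} = cut X B" unfolding cut_def by auto
    then show "card (cut X B) = (\<Sum>e\<in>X. if e \<in> cut X B then 1 else 0)"
      using fX by (simp add: sum.If_cases)
  qed simp
  also have "\<dots> = (\<Sum>e\<in>X. \<Sum>B\<in>?P. if e \<in> cut X B then 1 else 0)" by (rule sum.swap)
  also have "\<dots> \<le> (\<Sum>e\<in>X. 2)"
  proof (rule sum_mono)
    fix e assume e: "e \<in> X"
    then obtain p q where pq: "en e = {p, q}" "p \<in> V" "q \<in> V" using ends_E assms by (metis subsetD)
    have "{B \<in> ?P. e \<in> cut X B} \<subseteq> {cls A p, cls A q}"
    proof
      fix B assume "B \<in> {B \<in> ?P. e \<in> cut X B}"
      then obtain v where v: "v \<in> V" "B = cls A v" "p \<in> B \<or> q \<in> B" unfolding cut_def using pq by auto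
      then have "con A v p \<or> con A v q" unfolding cls_def by auto
      then show "B \<in> {cls A p, cls A q}" using v cls_eq_iff pq by auto
    qed
    then have "card {B \<in> ?P. e \<in> cut X B} \<le> card {cls A p, cls A q}" by (intro card_mono) auto
    also have "\<dots> \<le> 2" by (simp add: card_insert_if)
    finally show "(\<Sum>B\<in>?P. if e \<in> cut X B then 1 else 0) \<le> (2::nat)"
      using fP by (simp add: sum.If_cases Int_def)
  qed
  finally show ?thesis by simp
qed

definition kcut :: "nat \<Rightarrow> bool" where
  "kcut k \<longleftrightarrow> (\<forall>S. S \<subseteq> V \<and> S \<noteq> {} \<and> S \<noteq> V \<longrightarrow> k \<le> card (cut E S))"

text \<open>As there are at least two components, each of them is a proper vertex set and has at
  least \<open>k\<close> boundary edges. All of these are separated by \<open>A\<close>, hence in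
  \<open>X\<close>, and each is counted at most twice.\<close>

lemma ncomp_mult_k_le:
  assumes k: "kcut k" and X: "X \<subseteq> E" and nc: "2 \<le> ncomp A" and sep: "\<And>e. e \<in> E \<Longrightarrow> sep A e \<Longrightarrow> e \<in> X"
  shows "ncomp A * k \<le> 2 * card X"
proof -
  have "k \<le> card (cut X B)" if "B \<in> cls A ` V" for B
  proof -
    have "cut E B \<subseteq> cut X B"
      using that sep cut_cls_sep unfolding cut_def by blast
    moreover have "cut X B \<subseteq> cut E B" unfolding cut_def using X by auto
    moreover have "B \<subseteq> V" "B \<noteq> {}" using that con_refl unfolding cls_def by blast+
    moreover have "B \<noteq> V"
    proof
      assume BV: "B = V"
      have "B' = B" if "B' \<in> cls A ` V" for B'
      proof (rule ccontr)
        assume "B' \<noteq> B"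
        then have "B' \<inter> B = {}" using cls_disjoint that \<open>B \<in> cls A ` V\<close> by blast
        moreover have "B' \<subseteq> V" "B' \<noteq> {}" using that con_refl unfolding cls_def by blast+
        ultimately show False using BV by blast
      qed
      then have "card (cls A ` V) \<le> card {B}" by (intro card_mono) auto
      then show False using nc unfolding ncomp_def by simp
    qed
    ultimately show ?thesis using k unfolding kcut_def by (metis subset_antisym)
  qed
  then have "(\<Sum>B\<in>cls A ` V. k) \<le> (\<Sum>B\<in>cls A ` V. card (cut X B))" by (intro sum_mono)
  then show ?thesis using sum_card_cut_cls[OF X, of A] unfolding ncomp_def by simp
qed

definition colc :: "('e \<Rightarrow> nat) \<Rightarrow> nat \<Rightarrow> 'e set" where
  "colc col c = {e \<in> E. col e = c}"

text \<open>Colour \<open>r\<close> marks the edges that belong to none of the \<open>r\<close> forests.\<close>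

definition forests :: "nat \<Rightarrow> ('e \<Rightarrow> nat) \<Rightarrow> bool" where
  "forests r col \<longleftrightarrow> (\<forall>c<r. ncomp (colc col c) + card (colc col c) = card V) \<and> (\<forall>e\<in>E. col e \<le> r)"

definition coloured :: "nat \<Rightarrow> ('e \<Rightarrow> nat) \<Rightarrow> nat" where
  "coloured r col = card {e \<in> E. col e < r}"

lemma colc_subset: "colc col c \<subseteq> E" unfolding colc_def by auto

lemma finite_colc: "finite (colc col c)" using colc_subset finite_E finite_subset by metis

text \<open>\<open>forests\<close> expresses acyclicity by counting: components plus edges equals
  vertices. So taking the edges of \<open>X\<close> away from a forest creates at least as many new
  components, while every edge between the resulting components is in \<open>X\<close> and
  \<open>ncomp_mult_k_le\<close> limits their number.\<close>

lemma forests_stuck: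
  assumes k: "kcut k" "2 * r \<le> k" and F: "forests r col" and X: "X \<subseteq> E" "\<And>e. e \<in> X \<Longrightarrow> col e < r"
    and closed: "\<And>e c. e \<in> E \<Longrightarrow> c < r \<Longrightarrow> sep (colc col c - X) e \<Longrightarrow> e \<in> X"
    and c0: "c0 < r"
  shows "conn_on (colc col c0)"
proof (rule ccontr)
  assume nconn: "\<not> conn_on (colc col c0)"
  have fX: "finite X" using X finite_E finite_subset by blast
  let ?a = "\<lambda>c. ncomp (colc col c - X)"
  have split: "card (colc col c) = card (colc col c - X) + card (colc col c \<inter> X)" for c
    using finite_colc by (metis add.commute card_Int_Diff)
  have a: "card (colc col c \<inter> X) + ncomp (colc col c) \<le> ?a c" if "c < r" for c
    using ncomp_ge[of "colc col c - X"] split[of c] F that colc_subset[of col c]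
    unfolding forests_def by (smt (verit) Diff_subset add.commute add.assoc add_le_cancel_left dual_order.trans add_left_mono nat_add_left_cancel_le)
  have pos: "1 \<le> ncomp (colc col c)" for c
  proof -
    have "V \<noteq> {}" using nconn unfolding conn_on_def by auto
    then show ?thesis unfolding ncomp_def using finite_V by (simp add: Suc_leI card_gt_0_iff)
  qed
  have ak: "?a c * k \<le> 2 * card X" if "c < r" "2 \<le> ?a c" for c
    by (rule ncomp_mult_k_le) (use k X closed that in auto)
  have "2 \<le> ncomp (colc col c0)" using nconn ncomp_le_1_iff[of "colc col c0"] by simp
  then have "2 \<le> ?a c0" using a[OF c0] by simp
  from ak[OF c0 this] have "2 * k \<le> 2 * card X" using \<open>2 \<le> ?a c0\<close> by (meson le_trans mult_le_mono1)
  then have Xk: "k \<le> card X" by simp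
  have kpos: "0 < k" using k c0 by linarith
  \<comment> \<open>The summand \<open>k\<close> is what makes the final count contradictory. A
    class that stays in one piece without \<open>X\<close> has no edge in \<open>X\<close> and only
    needs \<open>k \<le> 2 * card X\<close>, which the disconnected class \<open>c0\<close> has
    provided.\<close>
  have each: "card (colc col c \<inter> X) * k + k \<le> 2 * card X" if "c < r" for c
  proof (cases "2 \<le> ?a c")
    case True
    have "(card (colc col c \<inter> X) + 1) * k \<le> ?a c * k"
      using a[OF that] pos[of c] by (intro mult_le_mono1) linarith
    then show ?thesis using ak[OF that True] by simp
  next
    case False
    then have "card (colc col c \<inter> X) = 0" using a[OF that] pos[of c] by linarith
    then show ?thesis using Xk by simp
  qed
  have "X = (\<Union>c<r. colc col c \<inter> X)" using X unfolding colc_def by auto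
  moreover have "card (\<Union>c<r. colc col c \<inter> X) = (\<Sum>c<r. card (colc col c \<inter> X))"
    by (rule card_UN_disjoint) (use fX in \<open>auto simp: colc_def\<close>)
  ultimately have cX: "card X = (\<Sum>c<r. card (colc col c \<inter> X))" by simp
  have "card X * k + r * k = (\<Sum>c<r. card (colc col c \<inter> X) * k + k)"
    unfolding cX by (simp add: sum.distrib sum_distrib_right)
  also have "\<dots> \<le> (\<Sum>c<r. 2 * card X)" by (rule sum_mono) (use each in auto)
  also have "\<dots> = (2 * r) * card X" by simp
  also have "\<dots> \<le> k * card X" using k by (intro mult_le_mono1) auto
  finally have "r * k \<le> 0" by (simp add: mult.commute)
  then show False using c0 kpos by simp
qed

text \<open>Every path in \<open>A\<close> between the endpoints of \<open>e\<close> uses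
  \<open>f\<close>; the rest of such a path together with \<open>e\<close> is a detour around
  \<open>f\<close>. The detour also exists in each superset \<open>B\<close>, and this is essential
  because one exchange has to preserve the connectivity of many sets at once.\<close>

lemma con_exchange:
  assumes e: "e \<in> E" and f: "f \<in> A" "f \<in> E" and AB: "A \<subseteq> B"
    and nsep: "\<not> sep A e" and sep: "sep (A - {f}) e"
  shows "con (insert e (B - {f})) u v \<longleftrightarrow> con B u v"
proof -
  obtain p q where pq: "en e = {p, q}" using ends_E[OF e] by metis
  obtain x y where xy: "en f = {x, y}" using ends_E[OF f(2)] by metis
  let ?C = "insert e (B - {f})"
  have 1: "con A p q" "\<not> con (A - {f}) p q" using nsep sep sep_iff pq by auto
  have A: "A = insert f (A - {f})" using f by auto
  have "con (A - {f}) p x \<and> con (A - {f}) y q \<or> con (A - {f}) p y \<and> con (A - {f}) x q"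
    using 1 con_insert[OF xy, of "A - {f}" p q] A by auto
  moreover have "A - {f} \<subseteq> ?C" using AB by auto
  ultimately have "con ?C p x \<and> con ?C y q \<or> con ?C p y \<and> con ?C x q" using con_mono by metis
  moreover have "con ?C p q" using con_adj[of ?C p q] pq unfolding adj_def by blast
  ultimately have fxy: "con ?C x y" by (metis con_sym con_trans)
  have "con B p q" using 1 con_mono AB by metis
  show ?thesis
  proof
    assume "con ?C u v"
    then show "con B u v"
    proof (rule con_subset_con[rotated])
      fix g a b assume "g \<in> ?C" "en g = {a, b}"
      then show "con B a b" using \<open>con B p q\<close> pq con_sym con_adj[of B a b] unfolding adj_def
        by (metis DiffD1 doubleton_eq_iff insertE)
    qed
  next
    assume "con B u v"
    then show "con ?C u v"
    proof (rule con_subset_con[rotated])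
      fix g a b assume "g \<in> B" "en g = {a, b}"
      then show "con ?C a b" using fxy xy con_sym con_adj[of ?C a b] unfolding adj_def
        by (metis DiffI doubleton_eq_iff insertI2 singletonD)
    qed
  qed
qed

text \<open>
  The edges with positive \<open>Ord\<close> form an augmenting sequence: the edge at position \<open>i\<close> separates two
  components of the forest with colour \<open>Y e\<close> once the edges at positions \<open>1, ..., i - 1\<close> are removed.
\<close>

definition pre :: "('e \<Rightarrow> nat) \<Rightarrow> ('e \<Rightarrow> nat) \<Rightarrow> nat \<Rightarrow> nat \<Rightarrow> 'e set" where
  "pre col Ord c h = {f \<in> E. col f = c \<and> \<not> (0 < Ord f \<and> Ord f \<le> h)}"

text \<open>The bound \<open>b\<close> is there because an exchange guarantees the condition only
  for the positions up to that of the edge that gives up its colour. Injectivity ensures that a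
  single edge is removed from one position to the next.\<close>

definition valid :: "nat \<Rightarrow> ('e \<Rightarrow> nat) \<Rightarrow> ('e \<Rightarrow> nat) \<Rightarrow> ('e \<Rightarrow> nat) \<Rightarrow> nat \<Rightarrow> bool" where
  "valid r col Ord Y b \<longleftrightarrow> inj_on Ord {e \<in> E. 0 < Ord e} \<and>
     (\<forall>e\<in>E. 0 < Ord e \<and> Ord e \<le> b \<longrightarrow> Y e < r \<and> sep (pre col Ord (Y e) (Ord e - 1)) e)"

lemma valid_le: "valid r col Ord Y b \<Longrightarrow> b' \<le> b \<Longrightarrow> valid r col Ord Y b'"
  unfolding valid_def by auto

lemma pre_0: "pre col Ord c 0 = colc col c"
  unfolding pre_def colc_def by auto

lemma pre_antimono: "h \<le> h' \<Longrightarrow> pre col Ord c h' \<subseteq> pre col Ord c h"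
  unfolding pre_def by auto

lemma valid_extend:
  assumes v: "valid r col Ord Y b" and b: "\<And>f. f \<in> E \<Longrightarrow> Ord f \<le> b"
    and e: "e \<in> E" "Ord e = 0" "c < r" "sep (pre col Ord c b) e"
  shows "valid r col (Ord(e := Suc b)) (Y(e := c)) (Suc b)"
proof -
  let ?O = "Ord(e := Suc b)"
  have p: "pre col ?O c' h = pre col Ord c' h" if "h \<le> b" for c' h
    unfolding pre_def using e that by (intro Collect_cong) auto
  have "inj_on ?O {f \<in> E. 0 < ?O f}"
  proof (rule inj_onI)
    fix x y assume *: "x \<in> {f \<in> E. 0 < ?O f}" "y \<in> {f \<in> E. 0 < ?O f}" "?O x = ?O y"
    have "inj_on Ord {e \<in> E. 0 < Ord e}" using v unfolding valid_def by blast
    then show "x = y" using * b[of x] b[of y] unfolding inj_on_def by (auto split: if_splits)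
  qed
  moreover have "(Y(e := c)) g < r \<and> sep (pre col ?O ((Y(e := c)) g) (?O g - 1)) g"
    if g: "g \<in> E" "0 < ?O g" for g
  proof (cases "g = e")
    case True then show ?thesis using e p[of b] by auto
  next
    case False then show ?thesis using g v b[OF g(1)] p[of "Ord g - 1"] unfolding valid_def by auto
  qed
  ultimately show ?thesis unfolding valid_def by auto
qed

text \<open>At position 0 nothing has been removed from the forest, so the uncoloured edge joins two
  of its components and can simply be added.\<close>

lemma unwind_0:
  assumes F: "forests r col" and e: "e \<in> E" "col e = r" "c < r" "sep (pre col Ord c 0) e"
  shows "forests r (col(e := c))" "coloured r (col(e := c)) = Suc (coloured r col)"
proof -
  let ?col = "col(e := c)"
  obtain p q where pq: "en e = {p, q}" "p \<in> V" "q \<in> V" using ends_E e by metis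
  have 1: "colc ?col c = insert e (colc col c)" "e \<notin> colc col c" using e unfolding colc_def by auto
  have 2: "colc ?col c' = colc col c'" if "c' < r" "c' \<noteq> c" for c' using that e unfolding colc_def by auto
  have 3: "ncomp (colc col c) = Suc (ncomp (insert e (colc col c)))"
    using ncomp_insert_sep[OF pq] e sep_iff[OF pq(1)] pre_0 by metis
  have "ncomp (colc ?col c') + card (colc ?col c') = card V" if "c' < r" for c'
  proof -
    have "ncomp (colc col c') + card (colc col c') = card V" using F that unfolding forests_def by blast
    then show ?thesis using 1 2 3 finite_colc[of col c] that by (cases "c' = c") auto
  qed
  then show "forests r ?col" using F e unfolding forests_def by auto
  have "{f \<in> E. ?col f < r} = insert e {f \<in> E. col f < r}" using e by auto
  then show "coloured r ?col = Suc (coloured r col)" unfolding coloured_def using e finite_E by simp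
qed

text \<open>The edge \<open>f\<close> at position \<open>Suc h\<close> is the one whose removal
  separates \<open>e\<close>, so the two are exchanged: \<open>e\<close> takes the colour and
  \<open>f\<close> loses its own. For \<open>g \<le> h\<close>, \<open>pre\<close> at
  \<open>g\<close> contains \<open>pre\<close> at \<open>h\<close>, so \<open>con_exchange\<close>
  preserves its connectivity; this keeps the classes forests and the sequence valid up to
  \<open>f\<close>, which is now its uncoloured end.\<close>

lemma unwind_Suc:
  assumes F: "forests r col" and v: "valid r col Ord Y (Ord e)"
    and e: "e \<in> E" "col e = r" "0 < Ord e" and h: "Suc h < Ord e"
    and nsep: "\<not> sep (pre col Ord (Y e) h) e" and sep: "sep (pre col Ord (Y e) (Suc h)) e"
    and f: "f \<in> E" "Ord f = Suc h"
  shows "forests r (col(e := Y e, f := r))" "coloured r (col(e := Y e, f := r)) = coloured r col"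
    "valid r (col(e := Y e, f := r)) Ord Y (Suc h)" "(col(e := Y e, f := r)) f = r"
proof -
  let ?col = "col(e := Y e, f := r)" and ?c = "Y e"
  have c: "?c < r" using v e unfolding valid_def by auto
  have inj: "g = f" if "g \<in> E" "Ord g = Suc h" for g
    using v that f unfolding valid_def inj_on_def by auto
  have P: "pre col Ord ?c (Suc h) = pre col Ord ?c h - {f}"
  proof (rule set_eqI)
    fix x show "x \<in> pre col Ord ?c (Suc h) \<longleftrightarrow> x \<in> pre col Ord ?c h - {f}"
      using inj[of x] f by (cases "Ord x = Suc h") (auto simp: pre_def le_Suc_eq)
  qed
  have fc: "f \<in> pre col Ord ?c h"
  proof (rule ccontr)
    assume "f \<notin> pre col Ord ?c h"
    then show False using P nsep sep by simp
  qed
  then have colf: "col f = ?c" unfolding pre_def by auto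
  have ef: "e \<noteq> f" using e c colf by auto
  have preO: "pre ?col Ord c' g = (if c' = ?c then insert e (pre col Ord ?c g - {f}) else pre col Ord c' g)"
    if "c' < r" "g \<le> h" for c' g
    using that e f ef h c colf unfolding pre_def by auto
  have con: "con (pre ?col Ord c' g) u v \<longleftrightarrow> con (pre col Ord c' g) u v" if "c' < r" "g \<le> h" for c' g u v
  proof (cases "c' = ?c")
    case True
    show ?thesis unfolding preO[OF that] using True con_exchange[OF e(1) fc f(1) pre_antimono[OF that(2)] nsep] sep P
      by simp
  qed (simp add: preO[OF that])
  have card: "card (colc ?col c') = card (colc col c')" if "c' < r" for c'
  proof (cases "c' = ?c")
    case True
    have "colc ?col ?c = insert e (colc col ?c - {f})" "e \<notin> colc col ?c" "f \<in> colc col ?c"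
      using e f ef c colf unfolding colc_def by auto
    then show ?thesis using True card_exchange[OF finite_colc[of col ?c], of f e] by metis
  next
    case False
    then have "colc ?col c' = colc col c'" using that e c colf unfolding colc_def by auto
    then show ?thesis by simp
  qed
  have "ncomp (colc ?col c') = ncomp (colc col c')" if "c' < r" for c'
    using ncomp_cong con[OF that, of 0] pre_0 by (metis le0)
  then show "forests r ?col" using F card c unfolding forests_def by auto
  have "{g \<in> E. ?col g < r} = insert e ({g \<in> E. col g < r} - {f})" using e f ef c by auto
  moreover have "f \<in> {g \<in> E. col g < r}" "e \<notin> {g \<in> E. col g < r}" using e f colf c by auto
  ultimately show "coloured r ?col = coloured r col" unfolding coloured_def
    using card_exchange[of "{g \<in> E. col g < r}" f e] finite_E by auto
  show "valid r ?col Ord Y (Suc h)" unfolding valid_def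
  proof (intro conjI ballI impI)
    show "inj_on Ord {e \<in> E. 0 < Ord e}" using v unfolding valid_def by auto
    fix g assume g: "g \<in> E" "0 < Ord g \<and> Ord g \<le> Suc h"
    then have 1: "Y g < r" "sep (pre col Ord (Y g) (Ord g - 1)) g" using v h unfolding valid_def by auto
    then show "Y g < r" by simp
    have "Ord g - 1 \<le> h" using g by auto
    then show "sep (pre ?col Ord (Y g) (Ord g - 1)) g" using sep_cong con 1 by metis
  qed
  show "?col f = r" by simp
qed

lemma sep_drop_ex:
  assumes "\<not> sep (pre col Ord c h) e" "sep (pre col Ord c (Suc h)) e"
  obtains f where "f \<in> E" "Ord f = Suc h"
proof -
  have "pre col Ord c h \<noteq> pre col Ord c (Suc h)" using assms by metis
  then show ?thesis using that unfolding pre_def by (auto simp: le_Suc_eq)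
qed

text \<open>The least position at which \<open>e\<close> is separated is either 0, and
  \<open>e\<close> can be added, or the position of an edge to exchange with. That edge comes
  strictly earlier than \<open>e\<close>, so the recursion ends.\<close>

lemma unwind:
  assumes "forests r col" "valid r col Ord Y (Ord e)" "e \<in> E" "col e = r" "0 < Ord e"
  shows "\<exists>col'. forests r col' \<and> coloured r col' = Suc (coloured r col)"
  using assms
proof (induction "Ord e" arbitrary: e col rule: less_induct)
  case less
  let ?S = "\<lambda>h. sep (pre col Ord (Y e) h) e"
  have S: "?S (Ord e - 1)" "Y e < r" using less.prems unfolding valid_def by auto
  define h where "h = (LEAST h. ?S h)"
  have h: "?S h" "h \<le> Ord e - 1" unfolding h_def using S by (auto intro: LeastI Least_le)
  show ?case
  proof (cases h)
    case 0
    then show ?thesis using unwind_0[of r col e "Y e" Ord] less.prems S h by blast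
  next
    case (Suc h')
    then have ns: "\<not> ?S h'" unfolding h_def using not_less_Least lessI by metis
    obtain f where f: "f \<in> E" "Ord f = Suc h'" using sep_drop_ex ns h Suc by metis
    have hs: "Suc h' < Ord e" using h Suc less.prems by auto
    note * = unwind_Suc[OF less.prems(1-5) hs ns _ f]
    show ?thesis using less.hyps[of f "col(e := Y e, f := r)"] * f h Suc hs by auto
  qed
qed

text \<open>If there were no improvement, augmenting sequences of every length would exist: they
  never meet an uncoloured edge because it could be unwound, and a sequence that cannot be extended
  is closed in the sense of \<open>forests_stuck\<close>. But a sequence has at most
  \<open>card E\<close> edges.\<close>

lemma forests_augment:
  assumes k: "kcut k" "2 * r \<le> k" and F: "forests r col" and c: "c < r" "\<not> conn_on (colc col c)"
  shows "\<exists>col'. forests r col' \<and> coloured r col' = Suc (coloured r col)"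
proof (rule ccontr)
  assume no: "\<not> ?thesis"
  let ?X = "\<lambda>Ord. {e \<in> E. 0 < Ord e}"
  have "\<exists>Ord Y. valid r col Ord Y i \<and> (\<forall>f\<in>E. Ord f \<le> i) \<and> card (?X Ord) = i" for i
  proof (induction i)
    case 0
    show ?case by (rule exI[of _ "\<lambda>_. 0"]) (auto simp: valid_def)
  next
    case (Suc i)
    then obtain Ord Y where v: "valid r col Ord Y i" and O: "\<forall>f\<in>E. Ord f \<le> i" and card: "card (?X Ord) = i" by blast
    have free: "col e < r" if "e \<in> ?X Ord" for e
    proof (rule ccontr)
      assume "\<not> col e < r"
      then have "col e = r" using F that unfolding forests_def by (metis (mono_tags, lifting) le_neq_implies_less mem_Collect_eq)
      then show False using unwind[OF F valid_le[OF v]] that O no by blast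
    qed
    have "\<exists>e\<in>E. \<exists>c'<r. Ord e = 0 \<and> sep (pre col Ord c' i) e"
    proof (rule ccontr)
      assume n: "\<not> ?thesis"
      have "pre col Ord c' i = colc col c' - ?X Ord" for c' unfolding pre_def colc_def using O by auto
      have "conn_on (colc col c)"
      proof (rule forests_stuck[OF k F, of "?X Ord"])
        fix e d assume "e \<in> E" "d < r" "sep (colc col d - ?X Ord) e"
        moreover from this have "0 < Ord e \<or> \<not> sep (pre col Ord d i) e" using n by auto
        ultimately show "e \<in> ?X Ord" using \<open>\<And>c'. pre col Ord c' i = colc col c' - ?X Ord\<close>[of d] by simp
      qed (use free c in auto)
      then show False using c by simp
    qed
    then obtain e c' where e: "e \<in> E" "c' < r" "Ord e = 0" "sep (pre col Ord c' i) e" by blast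
    have "?X (Ord(e := Suc i)) = insert e (?X Ord)" using e by auto
    then have "card (?X (Ord(e := Suc i))) = Suc i" using e finite_E card by simp
    moreover have "\<forall>f\<in>E. (Ord(e := Suc i)) f \<le> Suc i" using O by auto
    ultimately show ?case using valid_extend[OF v _ e(1,3,2,4)] O by blast
  qed
  from this[of "Suc (card E)"] obtain Ord :: "'e \<Rightarrow> nat" where "card (?X Ord) = Suc (card E)" by blast
  moreover have "card (?X Ord) \<le> card E" by (intro card_mono) (use finite_E in auto)
  ultimately show False by simp
qed

lemma forests_init: "forests r (\<lambda>_. r)"
proof -
  have "colc (\<lambda>_. r) c = {}" if "c < r" for c using that unfolding colc_def by auto
  then show ?thesis unfolding forests_def using ncomp_empty by simp
qed

text \<open>The well-known consequence of the Nash-Williams-Tutte theorem, obtained from a family of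
  forests with the largest number of coloured edges.\<close>

lemma tree_packing:
  assumes k: "kcut k" "2 * r \<le> k"
  obtains col where "forests r col" "\<And>c. c < r \<Longrightarrow> conn_on (colc col c)"
proof -
  have bd: "coloured r col \<le> card E" for col unfolding coloured_def by (intro card_mono) (use finite_E in auto)
  define P where "P = (\<lambda>N. \<exists>col. forests r col \<and> coloured r col = N)"
  have "P (coloured r (\<lambda>_. r))" using forests_init P_def by blast
  then obtain N where N: "P N" "\<And>N'. P N' \<Longrightarrow> N' \<le> N"
    using ex_has_greatest_nat[of P _ "\<lambda>x. x" "Suc (card E)"] bd P_def by (metis (no_types, lifting) less_Suc_eq_le)
  then obtain col where "forests r col" "coloured r col = N" unfolding P_def by blast
  then show ?thesis using that forests_augment[OF k] N(2) unfolding P_def by (metis Suc_n_not_le_n)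
qed

end


section \<open>Distances in well-connected subgraphs\<close>

context multigraph_on
begin

text \<open>An explicit sequence of vertices is needed where points are placed at prescribed
  distances along a path.\<close>

lemma rch_path:
  "rch A i u v \<Longrightarrow> \<exists>x l. l \<le> i \<and> x 0 = u \<and> x l = v \<and> (\<forall>j<l. adj A (x j) (x (Suc j)))"
proof (induction i arbitrary: v)
  case 0
  then show ?case by (intro exI[of _ "\<lambda>_. u"] exI[of _ 0]) auto
next
  case (Suc i)
  then consider "rch A i u v" | w where "rch A i u w" "adj A w v" by auto
  then show ?case
  proof cases
    case 1
    from Suc.IH[OF 1] obtain x l where "l \<le> i" "x 0 = u" "x l = v" "\<forall>j<l. adj A (x j) (x (Suc j))" by (elim exE conjE) (rule that)
    then show ?thesis by (intro exI[of _ x] exI[of _ l]) auto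
  next
    case 2
    from Suc.IH[OF 2(1)] obtain x l where x: "l \<le> i" "x 0 = u" "x l = w" "\<forall>j<l. adj A (x j) (x (Suc j))" by (elim exE conjE) (rule that)
    have "\<forall>j<Suc l. adj A ((x(Suc l := v)) j) ((x(Suc l := v)) (Suc j))"
      using x 2 by (auto simp: less_Suc_eq)
    then show ?thesis using x by (intro exI[of _ "x(Suc l := v)"] exI[of _ "Suc l"]) auto
  qed
qed

lemma path_rch:
  assumes "\<forall>j<l. adj A (x j) (x (Suc j))" "i \<le> j" "j \<le> l"
  shows "rch A (j - i) (x i) (x j)"
  using assms(2,3)
proof (induction j)
  case (Suc j)
  show ?case
  proof (cases "i = Suc j")
    case False
    then have "rch A (j - i) (x i) (x j)" "adj A (x j) (x (Suc j))" using Suc assms(1) by auto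
    then have "rch A (Suc (j - i)) (x i) (x (Suc j))" by auto
    then show ?thesis using False Suc by (simp add: Suc_diff_le)
  qed simp
qed simp

text \<open>The ball around \<open>u\<close> gains a vertex with every step until it stops growing
  for good.\<close>

lemma con_rch_card:
  assumes A: "A \<subseteq> E" and u: "u \<in> V" and c: "con A u v"
  shows "rch A (card V - 1) u v"
proof -
  let ?S = "\<lambda>i. {v \<in> V. rch A i u v}"
  have "i + 1 \<le> card (?S i) \<or> (\<forall>j. ?S j \<subseteq> ?S i)" for i
  proof (induction i)
    case 0
    have "?S 0 = {u}" using u by auto
    then show ?case by simp
  next
    case (Suc i)
    have m: "?S i \<subseteq> ?S (Suc i)" by auto
    from Suc show ?case
    proof
      assume i: "i + 1 \<le> card (?S i)"
      show ?thesis
      proof (cases "?S (Suc i) = ?S i")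
        case True
        have "?S j \<subseteq> ?S (Suc i)" for j
        proof (induction j)
          case 0 then show ?case by auto
        next
          case (Suc j)
          show ?case
          proof
            fix y assume y: "y \<in> ?S (Suc j)"
            then consider "rch A j u y" | w where "rch A j u w" "adj A w y" by auto
            then show "y \<in> ?S (Suc i)"
            proof cases
              case 1 then show ?thesis using Suc y by auto
            next
              case 2
              then have "w \<in> ?S i" using Suc True rch_in_V[OF _ A u] by blast
              then show ?thesis using 2 y by auto
            qed
          qed
        qed
        then show ?thesis by blast
      next
        case False
        then have "card (?S i) < card (?S (Suc i))" using m finite_V by (intro psubset_card_mono) auto
        then show ?thesis using i by simp
      qed
    next
      assume "\<forall>j. ?S j \<subseteq> ?S i"
      then show ?thesis using m by blast
    qed
  qed
  from this[of "card V - 1"] show ?thesis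
  proof
    assume "card V - 1 + 1 \<le> card (?S (card V - 1))"
    then have "card V \<le> card (?S (card V - 1))" by simp
    then have "?S (card V - 1) = V" using card_seteq[OF finite_V, of "?S (card V - 1)"] by auto
    then show ?thesis using con_in_V[OF c A u] by auto
  next
    assume *: "\<forall>j. ?S j \<subseteq> ?S (card V - 1)"
    obtain j where "rch A j u v" using c con_def by auto
    then have "v \<in> ?S j" using rch_in_V[OF _ A u] by auto
    then show ?thesis using * by blast
  qed
qed

text \<open>
  \<open>lev\<close> is the distance from the root in the whole graph and \<open>par v\<close> an edge from \<open>v\<close> to the previous
  level.
\<close>

definition leveled :: "('v \<Rightarrow> nat) \<Rightarrow> ('v \<Rightarrow> 'e) \<Rightarrow> bool" where
  "leveled lev par \<longleftrightarrow> (\<forall>v\<in>V. 0 < lev v \<longrightarrow>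
     par v \<in> E \<and> (\<exists>w\<in>V. en (par v) = {v, w} \<and> Suc (lev w) = lev v))"

definition par_edges :: "('v \<Rightarrow> nat) \<Rightarrow> ('v \<Rightarrow> 'e) \<Rightarrow> nat \<Rightarrow> 'e set" where
  "par_edges lev par j = par ` {v \<in> V. lev v = j}"

text \<open>Without the parent edges of level \<open>j\<close> the ball is independent of their
  colours.\<close>

definition ball_level :: "('v \<Rightarrow> nat) \<Rightarrow> ('v \<Rightarrow> 'e) \<Rightarrow> 'e set \<Rightarrow> nat \<Rightarrow> nat \<Rightarrow> 'v \<Rightarrow> 'v set" where
  "ball_level lev par H j \<rho> u = {v \<in> V. lev v = j \<and> rch (H - par_edges lev par j) \<rho> u v}"

text \<open>If one edge served two vertices, each of them would be one level below the
  other.\<close>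

lemma par_inj:
  assumes L: "leveled lev par" and "u \<in> V" "v \<in> V" "0 < lev u" "0 < lev v" "par u = par v"
  shows "u = v"
proof -
  obtain w w' where "en (par u) = {u, w}" "Suc (lev w) = lev u" "en (par v) = {v, w'}" "Suc (lev w') = lev v"
    using assms unfolding leveled_def by meson
  then show ?thesis using assms(6) by (metis doubleton_eq_iff Suc_n_not_le_n nat_le_linear le_SucI)
qed

text \<open>
  A shortest path from \<open>u\<close> to the levels below \<open>j\<close> cannot be long: it would pass \<open>K\<close> points that are
  pairwise more than \<open>2 g\<close> apart, hence there would be \<open>K\<close> vertices of level \<open>j\<close> near the path, one of
  whose parent edges belongs to \<open>H\<close>.
\<close>

lemma level_descent:
  assumes H: "H \<subseteq> E" "conn_on H" and L: "leveled lev par" and s: "s \<in> V" "lev s = 0"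
    and g: "\<And>u. u \<in> V \<Longrightarrow> \<exists>v\<in>V. lev v \<le> Suc j \<and> rch H g u v"
    and rho: "\<rho> = (K - 1) * (2 * g + 1) + g" and u: "u \<in> V" and K: "0 < K"
    and good: "K \<le> card (ball_level lev par H (Suc j) \<rho> u) \<Longrightarrow>
      \<exists>v\<in>ball_level lev par H (Suc j) \<rho> u. par v \<in> H"
  shows "\<exists>v\<in>V. lev v \<le> j \<and> rch H (Suc \<rho>) u v"
proof (rule ccontr)
  assume no: "\<not> ?thesis"
  let ?B = "ball_level lev par H (Suc j) \<rho> u" and ?H = "H - par_edges lev par (Suc j)"
  let ?P = "\<lambda>l. \<exists>v\<in>V. lev v \<le> j \<and> rch H l u v"
  have "\<exists>l. ?P l" using H(2) s u unfolding conn_on_def con_def by (metis le0)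
  define l where "l = (LEAST l. ?P l)"
  have Pl: "?P l" unfolding l_def using \<open>\<exists>l. ?P l\<close> by (rule LeastI_ex)
  have min: "\<not> ?P l'" if "l' < l" for l' using that not_less_Least unfolding l_def by blast
  have lr: "Suc \<rho> < l"
  proof (rule ccontr)
    assume "\<not> ?thesis"
    then show False using Pl no rch_le by (metis not_less)
  qed
  have high: "Suc j \<le> lev v" if "rch H i u v" "i < l" for v i
    using min[OF that(2)] that(1) rch_in_V[OF _ H(1) u] by (meson not_less_eq_eq)
  \<comment> \<open>In fewer than \<open>l\<close> steps only levels above \<open>j\<close> are met,
    but a parent edge of level \<open>Suc j\<close> has an endpoint of level
    \<open>j\<close>.\<close>
  have H': "rch ?H i u v" if "rch H i u v" "i < l" for i v
    using that
  proof (induction i arbitrary: v)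
    case (Suc i)
    then consider "rch H i u v" | w where "rch H i u w" "adj H w v" by auto
    then show ?case
    proof cases
      case 1 then show ?thesis using Suc by simp
    next
      case 2
      then obtain e where e: "e \<in> H" "en e = {w, v}" unfolding adj_def by auto
      have "e \<notin> par_edges lev par (Suc j)"
      proof
        assume "e \<in> par_edges lev par (Suc j)"
        then obtain x where x: "x \<in> V" "lev x = Suc j" "e = par x" unfolding par_edges_def by auto
        then obtain y where "en e = {x, y}" "lev y = j" using L unfolding leveled_def by (metis zero_less_Suc old.nat.inject)
        then have "lev w = j \<or> lev v = j" using e by (metis doubleton_eq_iff)
        then show False using high[OF 2(1)] high[OF Suc.prems] Suc.prems by auto
      qed
      then have "adj ?H w v" using e unfolding adj_def by auto
      then show ?thesis using Suc 2 by auto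
    qed
  qed simp
  obtain t where t: "t \<in> V" "lev t \<le> j" "rch H l u t" using Pl by auto
  then obtain x l' where x: "l' \<le> l" "x 0 = u" "x l' = t" "\<forall>j<l'. adj H (x j) (x (Suc j))"
    using rch_path by blast
  have "l' = l" using x t min path_rch[OF x(4), of 0 l'] by (metis diff_zero le0 nat_less_le order_refl)
  note x = x[unfolded this]
  \<comment> \<open>The points are \<open>2 * g + 1\<close> apart, so that balls of radius
    \<open>g\<close> around them are disjoint on a shortest path. The last point is
    \<open>(K - 1) * a\<close> steps away from \<open>u\<close>, and \<open>g\<close> further steps
    lead to level \<open>Suc j\<close>; this is the origin of \<open>\<rho>\<close>.\<close>
  define a where "a = 2 * g + 1"
  have ia: "i * a + g \<le> \<rho>" if "i < K" for i
  proof -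
    have "i \<le> K - 1" using that by simp
    then have "i * (2 * g + 1) \<le> (K - 1) * (2 * g + 1)" by (intro mult_le_mono1)
    then show ?thesis unfolding rho a_def by simp
  qed
  have ial: "i * a + g < l" if "i < K" for i using ia[OF that] lr by simp
  have xi: "rch H (i * a) u (x (i * a))" if "i < K" for i
    using path_rch[OF x(4), of 0 "i * a"] ial[OF that] x by simp
  have "\<exists>y. rch H g (x (i * a)) y \<and> lev y \<le> Suc j" if "i < K" for i
    using g[OF rch_in_V[OF xi[OF that] H(1) u]] by blast
  then obtain y where y: "\<And>i. i < K \<Longrightarrow> rch H g (x (i * a)) (y i)" "\<And>i. i < K \<Longrightarrow> lev (y i) \<le> Suc j"
    by metis
  have uy: "rch H (i * a + g) u (y i)" if "i < K" for i using rch_trans xi y(1) that by blast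
  have inB: "y i \<in> ?B" if "i < K" for i
  proof -
    have "lev (y i) = Suc j" using high[OF uy ial] y(2) that by (simp add: le_antisym)
    moreover have "rch ?H \<rho> u (y i)" using H'[OF uy ial] ia rch_le that by blast
    ultimately show ?thesis unfolding ball_level_def using rch_in_V[OF uy[OF that] H(1) u] by simp
  qed
  \<comment> \<open>A common vertex would be a shortcut of length \<open>2 * g\<close> between
    points at distance at least \<open>2 * g + 1\<close>, against the minimality of
    \<open>l\<close>.\<close>
  have "y i \<noteq> y i'" if "i < i'" "i' < K" for i i'
  proof
    assume eq: "y i = y i'"
    have "rch H (l - i' * a) (x (i' * a)) t" using path_rch[OF x(4), of "i' * a" l] ial[OF that(2)] x by simp
    moreover have "rch H (g + g) (x (i * a)) (x (i' * a))"
      using y(1)[of i] rch_sym[OF y(1)[of i']] that eq by (intro rch_trans[of H g _ "y i"]) auto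
    ultimately have "rch H (i * a + (g + g + (l - i' * a))) u t"
      using rch_trans xi[of i] that by (meson less_trans)
    moreover have "i * a + (g + g + (l - i' * a)) < l"
    proof -
      have "Suc i * a \<le> i' * a" using that by (intro mult_le_mono1) simp
      then show ?thesis using ial[OF that(2)] unfolding a_def by simp
    qed
    ultimately show False using min t by blast
  qed
  then have "inj_on y {..<K}" by (intro inj_onI) (metis lessThan_iff linorder_neqE_nat)
  then have "card (y ` {..<K}) = K" by (simp add: card_image)
  moreover have "card (y ` {..<K}) \<le> card ?B"
    by (intro card_mono) (use inB finite_V in \<open>auto simp: ball_level_def\<close>)
  ultimately obtain v where v: "v \<in> ?B" "par v \<in> H" using good by auto
  then have "v \<in> V" "lev v = Suc j" unfolding ball_level_def by auto
  then obtain w where w: "w \<in> V" "en (par v) = {v, w}" "lev w = j"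
    using L unfolding leveled_def by (metis zero_less_Suc old.nat.inject)
  have "rch H \<rho> u v" using v rch_mono[of ?H \<rho> u v H] unfolding ball_level_def by auto
  moreover have "adj H v w" unfolding adj_def using v w by auto
  ultimately have "rch H (Suc \<rho>) u w" by auto
  then show False using no w by auto
qed

text \<open>The distance in which every vertex reaches a vertex \<open>i\<close> levels below the top level.\<close>

primrec desc :: "nat \<Rightarrow> nat \<Rightarrow> nat" where
  "desc K 0 = 0"
| "desc K (Suc i) = Suc ((K - 1) * (2 * desc K i + 1) + desc K i)"

text \<open>For \<open>x = 2 * desc K i + 1\<close> the recursion becomes
  \<open>(2 * K - 1) * x + 2\<close>, and \<open>2 \<le> 2 * x\<close>.\<close>

lemma desc_bound: assumes "0 < K" shows "2 * desc K i + 1 \<le> (2 * K + 1) ^ i"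
proof (induction i)
  case (Suc i)
  obtain K' where K': "K = Suc K'" using assms by (cases K) auto
  have "2 * desc K (Suc i) + 1 \<le> (2 * K + 1) * (2 * desc K i + 1)" unfolding K' by (simp add: algebra_simps)
  also have "\<dots> \<le> (2 * K + 1) * (2 * K + 1) ^ i" using Suc by (intro mult_le_mono2)
  finally show ?case by simp
qed simp

text \<open>The radius is the \<open>\<rho>\<close> of \<open>level_descent\<close> for
  \<open>g = desc K i\<close>; \<open>desc K (Suc i)\<close> is its successor. Small balls count as
  good because they already force a descent.\<close>

definition good_ball :: "('v \<Rightarrow> nat) \<Rightarrow> ('v \<Rightarrow> 'e) \<Rightarrow> nat \<Rightarrow> nat \<Rightarrow> 'e set \<Rightarrow> nat \<Rightarrow> 'v \<Rightarrow> bool" where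
  "good_ball lev par K D H i u \<longleftrightarrow>
     (let B = ball_level lev par H (D - i) (desc K (Suc i) - 1) u in K \<le> card B \<longrightarrow> (\<exists>v\<in>B. par v \<in> H))"

lemma descent:
  assumes H: "H \<subseteq> E" "conn_on H" and L: "leveled lev par" and s: "s \<in> V" "lev s = 0" "\<And>v. v \<in> V \<Longrightarrow> lev v = 0 \<Longrightarrow> v = s"
    and D: "\<And>v. v \<in> V \<Longrightarrow> lev v \<le> D" and K: "0 < K"
    and good: "\<And>u i. u \<in> V \<Longrightarrow> i < D \<Longrightarrow> good_ball lev par K D H i u"
    and u: "u \<in> V"
  shows "rch H (desc K D) u s"
proof -
  have "\<exists>v\<in>V. lev v \<le> D - i \<and> rch H (desc K i) u v" if "u \<in> V" "i \<le> D" for u i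
    using that
  proof (induction i arbitrary: u)
    case 0 then show ?case using D by auto
  next
    case (Suc i)
    have j: "Suc (D - Suc i) = D - i" using Suc by simp
    have "\<exists>v\<in>V. lev v \<le> D - Suc i \<and> rch H (Suc ((K - 1) * (2 * desc K i + 1) + desc K i)) u v"
    proof (rule level_descent[OF H L s(1,2)])
      show "\<exists>v\<in>V. lev v \<le> Suc (D - Suc i) \<and> rch H (desc K i) u v" if "u \<in> V" for u
        unfolding j using Suc that by auto
    qed (use good[of u i] Suc K in \<open>auto simp: j good_ball_def Let_def\<close>)
    then show ?case by simp
  qed
  from this[OF u, of D] s(3) show ?thesis by fastforce
qed

end

section \<open>Walks, diameter and cycles of graph records\<close>

locale mgraph_loc =
  fixes G :: "('v, 'e) mgraph"
  assumes multigraph: "multigraph G"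
begin

sublocale multigraph_on "vertices G" "edges G" "ends G"
  using multigraph unfolding multigraph_def by unfold_locales auto

lemma with_edges_simps [simp]:
  "vertices (with_edges G A) = vertices G" "edges (with_edges G A) = A" "ends (with_edges G A) = ends G"
  unfolding with_edges_def by auto

lemma walk_rch: "walk (with_edges G A) u p v \<Longrightarrow> rch A (length p) u v"
proof (induction p arbitrary: u)
  case (Cons e p)
  then obtain w where w: "e \<in> A" "ends G e = {u, w}" "walk (with_edges G A) w p v" by auto
  then have "rch A (Suc 0) u w" unfolding adj_def[symmetric] using rch_1 adj_def by blast
  then have "rch A (Suc 0 + length p) u v" using Cons.IH w(3) rch_trans by blast
  then show ?case by simp
qed simp

lemma walk_snoc: "walk G' u p w \<Longrightarrow> e \<in> edges G' \<Longrightarrow> ends G' e = {w, v} \<Longrightarrow> v \<in> vertices G' \<Longrightarrow> walk G' u (p @ [e]) v"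
  by (induction p arbitrary: u) auto

lemma rch_walk:
  assumes "A \<subseteq> edges G" "u \<in> vertices G" "rch A i u v"
  shows "\<exists>p. walk (with_edges G A) u p v \<and> length p \<le> i"
  using assms(3)
proof (induction i arbitrary: v)
  case 0 then show ?case using assms by (intro exI[of _ "[]"]) auto
next
  case (Suc i)
  then consider "rch A i u v" | w where "rch A i u w" "adj A w v" by auto
  then show ?case
  proof cases
    case 1 then show ?thesis using Suc.IH le_SucI by blast
  next
    case 2
    then obtain e where e: "e \<in> A" "ends G e = {w, v}" unfolding adj_def by auto
    obtain p where p: "walk (with_edges G A) u p w" "length p \<le> i" using Suc.IH 2 by blast
    have "walk (with_edges G A) u (p @ [e]) v"
      using walk_snoc[OF p(1)] e assms(1) adj_in_V[OF 2(2)] by simp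
    then show ?thesis using p by (intro exI[of _ "p @ [e]"]) auto
  qed
qed

lemma connected_graph_iff:
  assumes "A \<subseteq> edges G"
  shows "connected_graph (with_edges G A) \<longleftrightarrow> vertices G \<noteq> {} \<and> conn_on A"
proof -
  have "(\<exists>p. walk (with_edges G A) u p v) \<longleftrightarrow> con A u v" if "u \<in> vertices G" for u v
    unfolding con_def using walk_rch rch_walk[OF assms that] by metis
  then show ?thesis unfolding connected_graph_def conn_on_def by auto
qed

lemma k_edge_connected_kcut:
  assumes "k_edge_connected k G"
  shows "kcut k"
  unfolding kcut_def
proof (intro allI impI)
  fix S assume S: "S \<subseteq> vertices G \<and> S \<noteq> {} \<and> S \<noteq> vertices G"
  show "k \<le> card (cut (edges G) S)"
  proof (rule ccontr)
    assume "\<not> ?thesis"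
    then have "connected_graph (with_edges G (edges G - cut (edges G) S))"
      using assms unfolding k_edge_connected_def cut_def by auto
    then have c: "conn_on (edges G - cut (edges G) S)" using connected_graph_iff[OF Diff_subset] by blast
    obtain s where "s \<in> vertices G" "s \<notin> S" using S by auto
    then have "cut (edges G - cut (edges G) S) S \<noteq> {}" using conn_cut_nonempty[OF c] S by blast
    then show False unfolding cut_def by auto
  qed
qed

lemma with_edges_all: "with_edges G (edges G) = G"
  unfolding with_edges_def by simp

lemma graph_diameter_le:
  assumes "A \<subseteq> edges G" "\<And>u v. u \<in> vertices G \<Longrightarrow> v \<in> vertices G \<Longrightarrow> rch A N u v"
  shows "graph_diameter (with_edges G A) \<le> enat N"
  unfolding graph_diameter_def graph_dist_def
proof (intro SUP_least)
  fix u v assume "u \<in> vertices (with_edges G A)" "v \<in> vertices (with_edges G A)"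
  then obtain p where "walk (with_edges G A) u p v" "length p \<le> N" using rch_walk[OF assms(1)] assms(2) by (metis with_edges_simps(1))
  then show "(INF p\<in>{p. walk (with_edges G A) u p v}. enat (length p)) \<le> enat N"
    by (intro INF_lower2[of p]) auto
qed

lemma graph_diameter_rch:
  assumes D: "graph_diameter G \<le> enat D" and uv: "u \<in> vertices G" "v \<in> vertices G"
  shows "rch (edges G) D u v"
proof -
  have "graph_dist G u v \<le> graph_diameter G" unfolding graph_diameter_def using uv by (meson SUP_upper2 order_refl)
  then have le: "(INF p\<in>{p. walk G u p v}. enat (length p)) < enat (Suc D)"
    using D unfolding graph_dist_def by (meson enat_ord_simps(2) lessI order_le_less_trans)
  then obtain p where p: "walk G u p v" "enat (length p) < enat (Suc D)" unfolding INF_less_iff by auto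
  then have "rch (edges G) (length p) u v" using walk_rch[of "edges G" u p v] with_edges_all by simp
  then show ?thesis using p rch_le by (metis enat_ord_simps(2) less_Suc_eq_le)
qed

text \<open>A vertex of maximal rank on a cycle would have two cycle edges leading to lower ranks,
  but there is only one edge of that kind.\<close>

lemma acyclic_by_rank:
  fixes R :: "'v \<Rightarrow> nat"
  assumes T: "T \<subseteq> edges G"
    and rank: "\<And>e u v. e \<in> T \<Longrightarrow> ends G e = {u, v} \<Longrightarrow> R u \<noteq> R v"
    and uniq: "\<And>e e' v w w'. e \<in> T \<Longrightarrow> e' \<in> T \<Longrightarrow> ends G e = {v, w} \<Longrightarrow> ends G e' = {v, w'} \<Longrightarrow> R w < R v \<Longrightarrow> R w' < R v \<Longrightarrow> e = e'"
  shows "\<not> is_cycle (with_edges G T) vs es"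
proof
  assume c: "is_cycle (with_edges G T) vs es"
  let ?L = "length es"
  have L: "0 < ?L" "length vs = ?L" "distinct es" "set es \<subseteq> T"
    and E: "\<And>i. i < ?L \<Longrightarrow> ends G (es ! i) = {vs ! i, vs ! (Suc i mod ?L)}"
    using c unfolding is_cycle_def by auto
  have inT: "es ! i \<in> T" if "i < ?L" for i using L that nth_mem by blast
  define M where "M = Max ((\<lambda>i. R (vs ! i)) ` {..<?L})"
  have "M \<in> (\<lambda>i. R (vs ! i)) ` {..<?L}" unfolding M_def by (rule Max_in) (use L in auto)
  then obtain i where i: "i < ?L" "R (vs ! i) = M" by auto
  have le: "R (vs ! j) \<le> R (vs ! i)" if "j < ?L" for j unfolding i M_def using that by (intro Max_ge) auto
  \<comment> \<open>The cyclic predecessor of \<open>i\<close>.\<close>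
  define j where "j = (if i = 0 then ?L - 1 else i - 1)"
  have j: "j < ?L" "Suc j mod ?L = i" unfolding j_def using i L by auto
  have ei: "ends G (es ! i) = {vs ! i, vs ! (Suc i mod ?L)}" using E i by simp
  have ej: "ends G (es ! j) = {vs ! i, vs ! j}" using E[OF j(1)] j(2) by (simp add: insert_commute)
  have "R (vs ! (Suc i mod ?L)) < R (vs ! i)" "R (vs ! j) < R (vs ! i)"
    using rank[OF inT ei] rank[OF inT ej] le[of "Suc i mod ?L"] le[of j] i(1) j(1) L(1) by (metis mod_less_divisor order_less_le)+
  then have "es ! i = es ! j" using uniq[OF inT inT ei ej] i j by simp
  \<comment> \<open>The cycle would have length 1 and consist of a loop, whose ends have equal
    rank.\<close>
  then have "i = j" using L i j nth_eq_iff_index_eq by blast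
  then have "vs ! (Suc i mod ?L) = vs ! i" using j by simp
  then show False using \<open>R (vs ! (Suc i mod ?L)) < R (vs ! i)\<close> by simp
qed

end


section \<open>Random colourings\<close>

lemma prob_bind_le:
  assumes "\<And>x. x \<in> set_pmf M \<Longrightarrow> measure_pmf.prob (N x) X \<le> b" "0 \<le> b"
  shows "measure_pmf.prob (bind_pmf M N) X \<le> b"
proof -
  have "emeasure (bind_pmf M N) X = (\<integral>\<^sup>+x. emeasure (N x) X \<partial>M)" by simp
  also have "\<dots> \<le> (\<integral>\<^sup>+x. ennreal b \<partial>M)"
    by (rule nn_integral_mono_AE) (use assms in \<open>auto simp: AE_measure_pmf_iff measure_pmf.emeasure_eq_measure ennreal_leI\<close>)
  also have "\<dots> = ennreal b" by simp
  finally show ?thesis using assms(2) by (simp add: measure_pmf.emeasure_eq_measure)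
qed

lemma prob_avoid:
  fixes r c :: nat
  assumes "finite E" "A \<subseteq> E" "c < r"
  shows "measure_pmf.prob (Pi_pmf E d (\<lambda>_. pmf_of_set {..<r})) {\<omega>. \<forall>e\<in>A. \<omega> e \<noteq> c} = (1 - 1 / real r) ^ card A"
proof -
  have "{\<omega>. \<forall>e\<in>A. \<omega> e \<noteq> c} = Pi E (\<lambda>e. if e \<in> A then - {c} else UNIV)"
    using assms(2) by (auto simp: Pi_def split: if_splits)
  moreover have "measure_pmf.prob (pmf_of_set {..<r}) (- {c}) = 1 - 1 / real r"
  proof -
    have "measure_pmf.prob (pmf_of_set {..<r}) {c} = 1 / real r"
      using assms(3) by (subst measure_pmf_of_set) auto
    moreover have "measure_pmf.prob (pmf_of_set {..<r}) (- {c}) = 1 - measure_pmf.prob (pmf_of_set {..<r}) {c}"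
      using measure_pmf.prob_compl[of "{c}" "pmf_of_set {..<r}"] by (simp add: Compl_eq_Diff_UNIV)
    ultimately show ?thesis by simp
  qed
  ultimately have "measure_pmf.prob (Pi_pmf E d (\<lambda>_. pmf_of_set {..<r})) {\<omega>. \<forall>e\<in>A. \<omega> e \<noteq> c}
    = (\<Prod>e\<in>E. if e \<in> A then 1 - 1 / real r else 1)"
    using assms(1) by (simp add: measure_Pi_pmf_Pi) (rule prod.cong, auto)
  also have "\<dots> = (1 - 1 / real r) ^ card A"
    using assms by (simp add: prod.If_cases Int_absorb1)
  finally show ?thesis .
qed

text \<open>
  The set \<open>W \<omega>\<close> of edges in \<open>F\<close> is determined by the colours outside of \<open>F\<close>, which are independent
  of those in \<open>F\<close>.
\<close>

lemma prob_avoid_dependent: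
  fixes r c :: nat
  assumes E: "finite E" "F \<subseteq> E" and c: "c < r" and W: "\<And>\<omega>. W \<omega> \<subseteq> F"
    and dep: "\<And>\<omega> \<omega>'. (\<And>e. e \<in> E - F \<Longrightarrow> \<omega> e = \<omega>' e) \<Longrightarrow> W \<omega> = W \<omega>'"
  shows "measure_pmf.prob (Pi_pmf E d (\<lambda>_. pmf_of_set {..<r})) {\<omega>. K \<le> card (W \<omega>) \<and> (\<forall>e\<in>W \<omega>. \<omega> e \<noteq> c)}
    \<le> (1 - 1 / real r) ^ K" (is "measure_pmf.prob ?M ?X \<le> _")
proof -
  let ?p = "\<lambda>_. pmf_of_set {..<r}"
  have p01: "0 \<le> 1 - 1 / real r" "1 - 1 / real r \<le> 1" using c by auto
  \<comment> \<open>The colours outside of \<open>F\<close> are drawn first. Once they are fixed,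
    \<open>W\<close> is a fixed set and \<open>prob_avoid\<close> applies to the colours in
    \<open>F\<close>.\<close>
  have "?M = Pi_pmf ((E - F) \<union> F) d ?p" using E by (simp add: Un_absorb2)
  also have "\<dots> = map_pmf (\<lambda>(f, g) x. if x \<in> E - F then f x else g x) (pair_pmf (Pi_pmf (E - F) d ?p) (Pi_pmf F d ?p))"
    using E finite_subset by (intro Pi_pmf_union) auto
  also have "\<dots> = bind_pmf (Pi_pmf (E - F) d ?p) (\<lambda>f. map_pmf (\<lambda>g x. if x \<in> E - F then f x else g x) (Pi_pmf F d ?p))"
    unfolding pair_pmf_def by (simp add: map_bind_pmf map_pmf_def bind_assoc_pmf bind_return_pmf)
  finally have M: "?M = \<dots>" .
  show ?thesis unfolding M
  proof (rule prob_bind_le)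
    fix f :: "'a \<Rightarrow> nat"
    define h where "h = (\<lambda>g x. if x \<in> E - F then f x else g x)"
    define W0 where "W0 = W f"
    have W0: "W (h g) = W0" for g unfolding W0_def h_def by (rule dep) auto
    have WF: "W0 \<subseteq> F" unfolding W0_def by (rule W)
    have hF: "h g e = g e" if "e \<in> W0" for g e using that WF unfolding h_def by auto
    have X: "h -` ?X = {g. K \<le> card W0 \<and> (\<forall>e\<in>W0. g e \<noteq> c)}" using W0 hF by auto
    have "measure_pmf.prob (map_pmf h (Pi_pmf F d ?p)) ?X = measure_pmf.prob (Pi_pmf F d ?p) (h -` ?X)"
      by (rule measure_map_pmf)
    also have "\<dots> \<le> (1 - 1 / real r) ^ K"
    proof (cases "K \<le> card W0")
      case False
      then have e: "h -` ?X = {}" unfolding X by simp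
      show ?thesis unfolding e using p01 by simp
    next
      case True
      have "measure_pmf.prob (Pi_pmf F d ?p) (h -` ?X) = (1 - 1 / real r) ^ card W0"
        unfolding X using prob_avoid[OF finite_subset[OF E(2,1)] WF c, of d] True by simp
      also have "\<dots> \<le> (1 - 1 / real r) ^ K" by (rule power_decreasing[OF True p01])
      finally show ?thesis .
    qed
    finally show "measure_pmf.prob (map_pmf (\<lambda>g x. if x \<in> E - F then f x else g x) (Pi_pmf F d ?p)) ?X
      \<le> (1 - 1 / real r) ^ K" unfolding h_def .
  qed (use p01 in simp)
qed

text \<open>From \<open>1 + q \<le> exp q\<close> and the quadratic bound for \<open>exp\<close> on
  the unit interval.\<close>

lemma power_1_plus_le:
  fixes q :: real
  assumes "0 \<le> q" "real N * q \<le> 1"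
  shows "(1 + q) ^ N \<le> 1 + 2 * (real N * q)"
proof -
  have "(1 + q) ^ N \<le> exp q ^ N" using assms by (intro power_mono) (auto simp: exp_ge_add_one_self)
  also have "\<dots> = exp (real N * q)" by (simp add: exp_of_nat_mult)
  also have "\<dots> \<le> 1 + real N * q + (real N * q)\<^sup>2" using assms by (intro exp_bound) auto
  also have "(real N * q)\<^sup>2 \<le> real N * q" using assms by (simp add: power2_eq_square mult_left_le)
  finally show ?thesis by (simp add: mult.commute)
qed

section \<open>Failure probabilities of a random colouring\<close>

context multigraph_on
begin

lemma cut_subset: "cut A S \<subseteq> A" unfolding cut_def by auto

text \<open>The symmetric difference of two different sets is nonempty and avoids \<open>s\<close>,
  so some edge of \<open>T\<close> crosses it. That edge belongs to exactly one of the two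
  cuts.\<close>

lemma cut_inj:
  assumes T: "T \<subseteq> E" "conn_on T" and s: "s \<in> V"
  shows "inj_on (cut T) {S. S \<subseteq> V - {s}}"
proof (rule inj_onI, rule ccontr)
  fix S S' assume S: "S \<in> {S. S \<subseteq> V - {s}}" "S' \<in> {S. S \<subseteq> V - {s}}" and eq: "cut T S = cut T S'" and ne: "S \<noteq> S'"
  let ?X = "(S - S') \<union> (S' - S)"
  have "?X \<subseteq> V" "?X \<noteq> {}" "s \<notin> ?X" using S ne by auto
  then obtain e where e: "e \<in> T" "en e \<inter> ?X \<noteq> {}" "en e - ?X \<noteq> {}"
    using conn_cut_nonempty[OF T(2), of ?X s] s unfolding cut_def by blast
  obtain p q where pq: "en e = {p, q}" using ends_E e(1) T(1) by (metis subsetD)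
  have c: "e \<in> cut T Z \<longleftrightarrow> (p \<in> Z \<longleftrightarrow> q \<notin> Z)" for Z unfolding cut_def using e(1) pq by auto
  then have "(p \<in> S \<longleftrightarrow> q \<notin> S) \<longleftrightarrow> (p \<in> S' \<longleftrightarrow> q \<notin> S')" using eq by metis
  then show False using e(2,3) pq by auto
qed

text \<open>Different \<open>S\<close> leave different nonempty subsets of \<open>T\<close>, so the
  sum is at most that over all nonempty subsets, which is \<open>(1 + q) ^ card T - 1\<close> by the
  binomial theorem.\<close>

lemma sum_cut_le:
  fixes q :: real
  assumes T: "T \<subseteq> E" "conn_on T" and s: "s \<in> V" and q: "0 \<le> q" "real (card T) * q \<le> 1"
  shows "(\<Sum>S\<in>{S. S \<subseteq> V - {s} \<and> S \<noteq> {}}. q ^ card (cut T S)) \<le> 2 * (real (card T) * q)"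
proof -
  let ?I = "{S. S \<subseteq> V - {s} \<and> S \<noteq> {}}"
  have fT: "finite T" using T finite_E finite_subset by blast
  have "inj_on (cut T) ?I" by (rule inj_on_subset[OF cut_inj[OF T s]]) auto
  then have "(\<Sum>S\<in>?I. q ^ card (cut T S)) = (\<Sum>A\<in>cut T ` ?I. q ^ card A)" by (simp add: sum.reindex)
  also have "\<dots> \<le> (\<Sum>A\<in>Pow T - {{}}. q ^ card A)"
  proof (rule sum_mono2)
    show "cut T ` ?I \<subseteq> Pow T - {{}}"
    proof
      fix A assume "A \<in> cut T ` ?I"
      then obtain S where S: "S \<subseteq> V - {s}" "S \<noteq> {}" "A = cut T S" by auto
      then have "S \<subseteq> V" "s \<notin> S" by auto
      then show "A \<in> Pow T - {{}}" using conn_cut_nonempty[OF T(2) _ S(2) s] cut_subset S by auto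
    qed
  qed (use q fT in auto)
  also have "\<dots> = (\<Sum>A\<in>Pow T. q ^ card A) - 1" using fT by (simp add: sum_diff1)
  also have "(\<Sum>A\<in>Pow T. q ^ card A) = (1 + q) ^ card T"
    using prod_add[OF fT, of "\<lambda>_. q" "\<lambda>_. 1"] by (simp add: add.commute)
  also have "(1 + q) ^ card T - 1 \<le> 2 * (real (card T) * q)" using power_1_plus_le[OF q] by simp
  finally show ?thesis .
qed

abbreviation colouring :: "nat \<Rightarrow> ('e \<Rightarrow> nat) pmf" where
  "colouring r \<equiv> Pi_pmf E 0 (\<lambda>_. pmf_of_set {..<r})"

lemma cut_colc_empty_iff: "cut (colc \<omega> c) S = {} \<longleftrightarrow> (\<forall>e\<in>cut E S. \<omega> e \<noteq> c)"
  unfolding cut_def colc_def by auto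

lemma prob_disconnected:
  assumes k: "kcut k" "2 * t \<le> k" "0 < t" and c: "c < r" and s: "s \<in> V"
    and q: "real (card V) * (1 - 1 / real r) ^ t \<le> 1"
  shows "measure_pmf.prob (colouring r) {\<omega>. \<not> conn_on (colc \<omega> c)}
    \<le> real t * (2 * (real (card V) * (1 - 1 / real r) ^ t))"
proof -
  let ?p = "1 - 1 / real r" and ?I = "{S. S \<subseteq> V - {s} \<and> S \<noteq> {}}"
  let ?q = "?p ^ t"
  have p01: "0 \<le> ?p" "?p \<le> 1" using c by auto
  have q0: "0 \<le> ?q" using p01 by simp
  obtain col where F: "forests t col" and conn: "\<And>i. i < t \<Longrightarrow> conn_on (colc col i)" using tree_packing[OF k(1,2)] by metis
  have Vne: "V \<noteq> {}" using s by auto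
  have cT: "card (colc col i) \<le> card V" if "i < t" for i using F that unfolding forests_def by (metis le_add2)
  have fI: "finite ?I" using finite_V by auto
  have cut_sum: "(\<Sum>i<t. card (cut (colc col i) S)) \<le> card (cut E S)" for S
  proof -
    have "card (\<Union>i<t. cut (colc col i) S) = (\<Sum>i<t. card (cut (colc col i) S))"
      by (rule card_UN_disjoint) (use finite_E in \<open>auto simp: cut_def colc_def\<close>)
    moreover have "card (\<Union>i<t. cut (colc col i) S) \<le> card (cut E S)"
      by (rule card_mono) (use finite_E in \<open>auto simp: cut_def colc_def\<close>)
    ultimately show ?thesis by simp
  qed
  \<comment> \<open>The tree with few crossing edges depends on \<open>S\<close>. Summing over all
    \<open>t\<close> trees removes this dependence at the price of the factor \<open>t\<close> in
    the result.\<close>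
  have each: "?p ^ card (cut E S) \<le> (\<Sum>i<t. ?q ^ card (cut (colc col i) S))" for S
  proof -
    have "\<exists>i<t. t * card (cut (colc col i) S) \<le> card (cut E S)"
    proof (rule ccontr)
      assume "\<not> ?thesis"
      then have "(\<Sum>i<t. card (cut E S)) < (\<Sum>i<t. t * card (cut (colc col i) S))"
        using k(3) by (intro sum_strict_mono) (auto simp: not_le)
      also have "\<dots> \<le> t * card (cut E S)" using cut_sum[of S] by (simp add: sum_distrib_left[symmetric])
      finally show False by simp
    qed
    then obtain i where i: "i < t" "t * card (cut (colc col i) S) \<le> card (cut E S)" by blast
    have "?p ^ card (cut E S) \<le> ?p ^ (t * card (cut (colc col i) S))" by (rule power_decreasing[OF i(2) p01])
    also have "\<dots> = ?q ^ card (cut (colc col i) S)" by (simp add: power_mult)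
    also have "\<dots> \<le> (\<Sum>i<t. ?q ^ card (cut (colc col i) S))"
      by (rule member_le_sum[where f = "\<lambda>i. ?q ^ card (cut (colc col i) S)"]) (use i q0 in auto)
    finally show ?thesis .
  qed
  have "measure_pmf.prob (colouring r) {\<omega>. \<not> conn_on (colc \<omega> c)}
    \<le> measure_pmf.prob (colouring r) (\<Union>S\<in>?I. {\<omega>. \<forall>e\<in>cut E S. \<omega> e \<noteq> c})"
  proof (rule measure_pmf.finite_measure_mono)
    show "{\<omega>. \<not> conn_on (colc \<omega> c)} \<subseteq> (\<Union>S\<in>?I. {\<omega>. \<forall>e\<in>cut E S. \<omega> e \<noteq> c})"
    proof
      fix \<omega> assume "\<omega> \<in> {\<omega>. \<not> conn_on (colc \<omega> c)}"
      then obtain S where "S \<subseteq> V" "s \<notin> S" "S \<noteq> {}" "cut (colc \<omega> c) S = {}"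
        using cut_empty_conn[OF colc_subset _ s] by blast
      then show "\<omega> \<in> (\<Union>S\<in>?I. {\<omega>. \<forall>e\<in>cut E S. \<omega> e \<noteq> c})" unfolding cut_colc_empty_iff by blast
    qed
  qed simp
  also have "\<dots> \<le> (\<Sum>S\<in>?I. measure_pmf.prob (colouring r) {\<omega>. \<forall>e\<in>cut E S. \<omega> e \<noteq> c})"
    by (rule measure_pmf.finite_measure_subadditive_finite) (use fI in auto)
  also have "\<dots> = (\<Sum>S\<in>?I. ?p ^ card (cut E S))"
    by (rule sum.cong) (use prob_avoid[OF finite_E cut_subset c] in auto)
  also have "\<dots> \<le> (\<Sum>S\<in>?I. \<Sum>i<t. ?q ^ card (cut (colc col i) S))" by (intro sum_mono each)
  also have "\<dots> = (\<Sum>i<t. \<Sum>S\<in>?I. ?q ^ card (cut (colc col i) S))" by (rule sum.swap)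
  also have "\<dots> \<le> (\<Sum>i<t. 2 * (real (card V) * ?q))"
  proof (rule sum_mono)
    fix i assume "i \<in> {..<t}"
    then have i: "i < t" by simp
    have m: "real (card (colc col i)) * ?q \<le> real (card V) * ?q" using cT[OF i] q0 by (intro mult_right_mono) auto
    have "(\<Sum>S\<in>?I. ?q ^ card (cut (colc col i) S)) \<le> 2 * (real (card (colc col i)) * ?q)"
      by (rule sum_cut_le[OF colc_subset conn[OF i] s q0]) (use m q in linarith)
    then show "(\<Sum>S\<in>?I. ?q ^ card (cut (colc col i) S)) \<le> 2 * (real (card V) * ?q)" using m by linarith
  qed
  finally show ?thesis by simp
qed

text \<open>\<open>prob_avoid_dependent\<close> counts edges whereas the ball counts vertices; since
  \<open>par\<close> is injective on a level, both numbers agree.\<close>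

lemma prob_bad_ball:
  assumes L: "leveled lev par" and i: "i < D" and c: "c < r"
  shows "measure_pmf.prob (colouring r) {\<omega>. \<not> good_ball lev par K D (colc \<omega> c) i u} \<le> (1 - 1 / real r) ^ K"
proof -
  let ?j = "D - i"
  let ?F = "par_edges lev par ?j"
  define B where "B = (\<lambda>\<omega>. ball_level lev par (colc \<omega> c) ?j (desc K (Suc i) - 1) u)"
  have j: "0 < ?j" using i by simp
  have parE: "par v \<in> E" if "v \<in> V" "lev v = ?j" for v using L that j unfolding leveled_def by metis
  have BV: "B \<omega> \<subseteq> {v \<in> V. lev v = ?j}" for \<omega> unfolding B_def ball_level_def by auto
  have inj: "inj_on par (B \<omega>)" for \<omega>
  proof (rule inj_onI)
    fix x y assume "x \<in> B \<omega>" "y \<in> B \<omega>" "par x = par y"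
    moreover from this have "x \<in> V" "y \<in> V" "lev x = ?j" "lev y = ?j" using BV[of \<omega>] by auto
    ultimately show "x = y" using par_inj[OF L, of x y] j by simp
  qed
  have "{\<omega>. \<not> good_ball lev par K D (colc \<omega> c) i u} \<subseteq> {\<omega>. K \<le> card (par ` B \<omega>) \<and> (\<forall>e\<in>par ` B \<omega>. \<omega> e \<noteq> c)}"
  proof
    fix \<omega> assume "\<omega> \<in> {\<omega>. \<not> good_ball lev par K D (colc \<omega> c) i u}"
    then have "K \<le> card (B \<omega>)" "\<And>v. v \<in> B \<omega> \<Longrightarrow> par v \<notin> colc \<omega> c" unfolding good_ball_def B_def Let_def by auto
    then show "\<omega> \<in> {\<omega>. K \<le> card (par ` B \<omega>) \<and> (\<forall>e\<in>par ` B \<omega>. \<omega> e \<noteq> c)}"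
      using card_image[OF inj, of \<omega>] parE BV[of \<omega>] unfolding colc_def by auto
  qed
  then have "measure_pmf.prob (colouring r) {\<omega>. \<not> good_ball lev par K D (colc \<omega> c) i u}
    \<le> measure_pmf.prob (colouring r) {\<omega>. K \<le> card (par ` B \<omega>) \<and> (\<forall>e\<in>par ` B \<omega>. \<omega> e \<noteq> c)}"
    by (rule measure_pmf.finite_measure_mono) simp
  also have "\<dots> \<le> (1 - 1 / real r) ^ K"
  proof (rule prob_avoid_dependent[OF finite_E _ c])
    show "?F \<subseteq> E" unfolding par_edges_def using parE by auto
    show "par ` B \<omega> \<subseteq> ?F" for \<omega> unfolding par_edges_def using BV by blast
    fix \<omega> \<omega>' :: "'e \<Rightarrow> nat" assume eq: "\<And>e. e \<in> E - ?F \<Longrightarrow> \<omega> e = \<omega>' e"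
    then have "colc \<omega> c - ?F = colc \<omega>' c - ?F" unfolding colc_def by auto
    then show "par ` B \<omega> = par ` B \<omega>'" unfolding B_def ball_level_def by simp
  qed
  finally show ?thesis .
qed

text \<open>A union bound with \<open>K = k\<close>. For each colour, connectivity fails with
  probability at most \<open>2 * n ^ 2 * y\<close> and some ball is bad with probability at most
  \<open>n ^ 2 * y\<close>, where \<open>y = 1 / n ^ 10\<close>. There are fewer than
  \<open>n\<close> colours, which gives \<open>3 / n ^ 7\<close>. Both \<open>k < card V\<close> and
  \<open>D \<le> card V\<close> serve to express the number of events by \<open>n\<close>.\<close>

lemma random_colouring:
  assumes kc: "kcut k" and L: "leveled lev par" and s: "s \<in> V" "lev s = 0" "\<And>v. v \<in> V \<Longrightarrow> lev v = 0 \<Longrightarrow> v = s"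
    and D: "\<And>v. v \<in> V \<Longrightarrow> lev v \<le> D" "D \<le> card V" and k: "2 \<le> k" "k < card V" and r: "0 < r" "r \<le> k"
    and q: "(1 - 1 / real r) ^ (k div 2) \<le> 1 / real (card V) ^ 10"
  shows "measure_pmf.prob (colouring r) {\<omega>. \<forall>c<r. conn_on (colc \<omega> c) \<and> (\<forall>u\<in>V. rch (colc \<omega> c) (desc k D) u s)}
    \<ge> 1 - 1 / real (card V)" (is "measure_pmf.prob _ ?G \<ge> _")
proof -
  let ?n = "card V" and ?p = "1 - 1 / real r" and ?t = "k div 2" and ?M = "measure_pmf.prob (colouring r)"
  have n: "2 \<le> ?n" using k by simp
  have p01: "0 \<le> ?p" "?p \<le> 1" using r by auto
  define y where "y = 1 / real ?n ^ 10"
  have y0: "0 \<le> y" unfolding y_def by simp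
  have pk: "?p ^ k \<le> y"
  proof -
    have "?p ^ k \<le> ?p ^ ?t" by (rule power_decreasing) (use p01 in auto)
    then show ?thesis using q unfolding y_def by simp
  qed
  have ny: "real ?n * ?p ^ ?t \<le> 1"
  proof -
    have "real ?n * ?p ^ ?t \<le> real ?n * y" using q unfolding y_def by (intro mult_left_mono) auto
    also have "\<dots> = 1 / real ?n ^ 9" unfolding y_def using n by (simp add: field_simps eval_nat_numeral)
    also have "\<dots> \<le> 1" using n by simp
    finally show ?thesis .
  qed
  let ?A = "\<lambda>c. {\<omega>. \<not> conn_on (colc \<omega> c)}" and ?B = "\<lambda>c i u. {\<omega>. \<not> good_ball lev par k D (colc \<omega> c) i u}"
  have "UNIV - ?G \<subseteq> (\<Union>c\<in>{..<r}. ?A c \<union> (\<Union>i\<in>{..<D}. \<Union>u\<in>V. ?B c i u))"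
  proof
    fix \<omega> assume "\<omega> \<in> UNIV - ?G"
    then obtain c where c: "c < r" "\<not> (conn_on (colc \<omega> c) \<and> (\<forall>u\<in>V. rch (colc \<omega> c) (desc k D) u s))" by blast
    show "\<omega> \<in> (\<Union>c\<in>{..<r}. ?A c \<union> (\<Union>i\<in>{..<D}. \<Union>u\<in>V. ?B c i u))"
    proof (rule ccontr)
      assume no: "\<not> ?thesis"
      then have conn: "conn_on (colc \<omega> c)" and good: "\<And>u i. u \<in> V \<Longrightarrow> i < D \<Longrightarrow> good_ball lev par k D (colc \<omega> c) i u"
        using c(1) by auto
      have "rch (colc \<omega> c) (desc k D) u s" if "u \<in> V" for u
        by (rule descent[OF colc_subset conn L s D(1)]) (use good k that in auto)
      then show False using c conn by blast
    qed
  qed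
  then have "?M (UNIV - ?G) \<le> ?M (\<Union>c\<in>{..<r}. ?A c \<union> (\<Union>i\<in>{..<D}. \<Union>u\<in>V. ?B c i u))"
    by (rule measure_pmf.finite_measure_mono) simp
  also have "\<dots> \<le> (\<Sum>c\<in>{..<r}. ?M (?A c \<union> (\<Union>i\<in>{..<D}. \<Union>u\<in>V. ?B c i u)))"
    by (rule measure_pmf.finite_measure_subadditive_finite) auto
  also have "\<dots> \<le> (\<Sum>c\<in>{..<r}. 3 * (real ?n)^2 * y)"
  proof (rule sum_mono)
    fix c assume "c \<in> {..<r}"
    then have c: "c < r" by simp
    have "?M (?A c) \<le> real ?t * (2 * (real ?n * ?p ^ ?t))"
      by (rule prob_disconnected[OF kc _ _ c s(1) ny]) (use k in auto)
    also have "\<dots> \<le> real ?n * (2 * (real ?n * y))"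
      using k q p01 unfolding y_def[symmetric] by (intro mult_mono mult_left_mono) (auto simp: y0)
    finally have A: "?M (?A c) \<le> 2 * (real ?n)^2 * y" by (simp add: power2_eq_square)
    have "?M (\<Union>i\<in>{..<D}. \<Union>u\<in>V. ?B c i u) \<le> (\<Sum>i\<in>{..<D}. ?M (\<Union>u\<in>V. ?B c i u))"
      by (rule measure_pmf.finite_measure_subadditive_finite) auto
    also have "\<dots> \<le> (\<Sum>i\<in>{..<D}. \<Sum>u\<in>V. ?M (?B c i u))"
      by (intro sum_mono measure_pmf.finite_measure_subadditive_finite) (use finite_V in auto)
    also have "\<dots> \<le> (\<Sum>i\<in>{..<D}. \<Sum>u\<in>V. y)"
    proof (intro sum_mono)
      fix i u assume "i \<in> {..<D}"
      then have "?M (?B c i u) \<le> ?p ^ k" by (intro prob_bad_ball[OF L _ c]) simp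
      then show "?M (?B c i u) \<le> y" using pk by simp
    qed
    also have "\<dots> = real D * real ?n * y" by simp
    also have "\<dots> \<le> real ?n * real ?n * y" using D(2) y0 by (intro mult_right_mono) auto
    finally have B: "?M (\<Union>i\<in>{..<D}. \<Union>u\<in>V. ?B c i u) \<le> (real ?n)^2 * y" by (simp add: power2_eq_square)
    have "?M (?A c \<union> (\<Union>i\<in>{..<D}. \<Union>u\<in>V. ?B c i u)) \<le> ?M (?A c) + ?M (\<Union>i\<in>{..<D}. \<Union>u\<in>V. ?B c i u)"
      by (rule measure_Un_le) auto
    then show "?M (?A c \<union> (\<Union>i\<in>{..<D}. \<Union>u\<in>V. ?B c i u)) \<le> 3 * (real ?n)^2 * y" using A B by simp
  qed
  also have "\<dots> = real r * (3 * (real ?n)^2 * y)" by simp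
  also have "\<dots> \<le> real ?n * (3 * (real ?n)^2 * y)" using r k y0 by (intro mult_right_mono) auto
  also have "\<dots> = 3 / real ?n ^ 7" unfolding y_def using n by (simp add: field_simps eval_nat_numeral)
  also have "\<dots> \<le> 1 / real ?n"
  proof -
    have "(2::real) ^ 6 \<le> real ?n ^ 6" using n by (intro power_mono) auto
    then have "3 \<le> real ?n ^ 6" by simp
    then have "3 * real ?n \<le> real ?n ^ 6 * real ?n" by (intro mult_right_mono) auto
    also have "\<dots> = real ?n ^ 7" by (simp add: eval_nat_numeral)
    finally show ?thesis using n by (simp add: field_simps)
  qed
  finally have "?M (UNIV - ?G) \<le> 1 / real ?n" .
  moreover have "?M (UNIV - ?G) = 1 - ?M ?G" using measure_pmf.prob_compl[of ?G "colouring r"] by simp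
  ultimately show ?thesis by simp
qed

end


section \<open>For-programs with coin flips\<close>

lemma run_Skip [simp]: "run t Skip s = return_pmf (Skip, s)"
  by (induction t) (auto simp: bind_return_pmf)

lemma run_add: "run (t + u) c s = bind_pmf (run t c s) (\<lambda>(c', s'). run u c' s')"
proof (induction t arbitrary: c s)
  case 0 then show ?case by (simp add: bind_return_pmf)
next
  case (Suc t)
  then show ?case by (simp add: bind_assoc_pmf case_prod_unfold)
qed

text \<open>The equation carries two facts at once: all coin flips lead to termination within
  \<open>t\<close> steps, and the final state has distribution \<open>\<mu>\<close>.\<close>

definition runs :: "com \<Rightarrow> ram \<Rightarrow> nat \<Rightarrow> ram pmf \<Rightarrow> bool" where
  "runs c s t \<mu> \<longleftrightarrow> run t c s = map_pmf (Pair Skip) \<mu>"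

lemma runs_le:
  assumes "runs c s t \<mu>" "t \<le> t'"
  shows "runs c s t' \<mu>"
proof -
  have "run t' c s = bind_pmf (run t c s) (\<lambda>(c', s'). run (t' - t) c' s')"
    using run_add[of t "t' - t"] assms(2) by simp
  then have "run t' c s = bind_pmf \<mu> (\<lambda>s'. return_pmf (Skip, s'))"
    using assms(1) unfolding runs_def by (simp add: bind_map_pmf)
  then show ?thesis unfolding runs_def map_pmf_def .
qed

lemma runs_Skip: "runs Skip s 0 (return_pmf s)"
  unfolding runs_def by simp

lemma runs_atomic: "step c s = map_pmf (Pair Skip) \<mu> \<Longrightarrow> runs c s 1 \<mu>"
  unfolding runs_def by (simp add: bind_return_pmf')

lemma runs_step: "step c s = return_pmf (c', s') \<Longrightarrow> runs c' s' t \<mu> \<Longrightarrow> runs c s (Suc t) \<mu>"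
  unfolding runs_def by (simp add: bind_return_pmf)

lemma runs_intro:
  assumes "\<And>c' s'. (c', s') \<in> set_pmf (run t c s) \<Longrightarrow> c' = Skip"
  shows "runs c s t (map_pmf snd (run t c s))"
proof -
  have "map_pmf (\<lambda>x. (Skip, snd x)) (run t c s) = map_pmf (\<lambda>x. x) (run t c s)"
    by (rule map_pmf_cong) (use assms in \<open>force simp: prod_eq_iff\<close>)+
  then show ?thesis unfolding runs_def by (simp add: pmf.map_comp comp_def)
qed

text \<open>The additional step is the one that discards the finished first program.\<close>

lemma runs_Seq:
  assumes "runs c s t1 \<mu>" "\<And>s'. s' \<in> set_pmf \<mu> \<Longrightarrow> runs d s' t2 (\<nu> s')"
  shows "runs (Seq c d) s (Suc (t1 + t2)) (bind_pmf \<mu> \<nu>)"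
  using assms
proof (induction t1 arbitrary: c s \<mu>)
  case 0
  then have "return_pmf (c, s) = map_pmf (Pair Skip) \<mu>" unfolding runs_def by simp
  then have "map_pmf snd (return_pmf (c, s)) = \<mu>" "set_pmf (return_pmf (c, s)) = Pair Skip ` set_pmf \<mu>"
    by (simp_all add: pmf.map_comp comp_def)
  then have "\<mu> = return_pmf s" "c = Skip" by auto
  then show ?case using 0 by (intro runs_step[of _ _ d s]) (auto simp: bind_return_pmf)
next
  case (Suc t)
  show ?case
  proof (cases "c = Skip")
    case True
    then have "map_pmf (Pair Skip) \<mu> = return_pmf (Skip, s)" using Suc.prems unfolding runs_def by simp
    then have "map_pmf snd (map_pmf (Pair Skip) \<mu>) = return_pmf s" by simp
    then have "\<mu> = return_pmf s" by (simp add: pmf.map_comp comp_def)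
    then have "runs (Seq c d) s (Suc t2) (bind_pmf \<mu> \<nu>)"
      using Suc.prems True by (intro runs_step[of _ _ d s]) (auto simp: bind_return_pmf)
    then show ?thesis by (rule runs_le) simp
  next
    case False
    let ?m = "\<lambda>(c', s'). map_pmf snd (run t c' s')"
    have R: "bind_pmf (step c s) (\<lambda>(c', s'). run t c' s') = map_pmf (Pair Skip) \<mu>"
      using Suc.prems unfolding runs_def by simp
    \<comment> \<open>All continuations of the first step end in \<open>Skip\<close> as well, so
      \<open>\<mu>\<close> is a mixture of their final distributions and the induction hypothesis
      applies to each of them.\<close>
    have mu: "\<mu> = bind_pmf (step c s) ?m"
    proof -
      have "\<mu> = map_pmf snd (map_pmf (Pair Skip) \<mu>)" by (simp add: pmf.map_comp comp_def)
      also have "\<dots> = bind_pmf (step c s) ?m" unfolding R[symmetric] by (simp add: map_bind_pmf case_prod_unfold)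
      finally show ?thesis .
    qed
    have *: "runs (Seq c' d) s' (Suc (t + t2)) (bind_pmf (?m (c', s')) \<nu>)" if cs: "(c', s') \<in> set_pmf (step c s)" for c' s'
    proof (rule Suc.IH)
      have "c'' = Skip" if "(c'', s'') \<in> set_pmf (run t c' s')" for c'' s''
      proof -
        have "(c'', s'') \<in> set_pmf (bind_pmf (step c s) (\<lambda>(c', s'). run t c' s'))" using cs that by force
        then show ?thesis unfolding R by auto
      qed
      then show "runs c' s' t (?m (c', s'))" using runs_intro by auto
      show "runs d s'' t2 (\<nu> s'')" if "s'' \<in> set_pmf (?m (c', s'))" for s''
        using Suc.prems(2) that cs unfolding mu by force
    qed
    have "run (Suc (Suc t + t2)) (Seq c d) s
      = bind_pmf (step c s) (\<lambda>(c', s'). run (Suc (t + t2)) (Seq c' d) s')"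
      using False by (simp add: bind_map_pmf case_prod_unfold)
    also have "\<dots> = bind_pmf (step c s) (\<lambda>x. map_pmf (Pair Skip) (bind_pmf (?m x) \<nu>))"
      by (rule bind_pmf_cong) (use * in \<open>auto simp: runs_def simp del: run.simps\<close>)
    also have "\<dots> = map_pmf (Pair Skip) (bind_pmf \<mu> \<nu>)"
      unfolding mu by (simp add: map_bind_pmf bind_assoc_pmf)
    finally show ?thesis unfolding runs_def .
  qed
qed

lemma runs_If: "runs (if bval b s then c else d) s t \<mu> \<Longrightarrow> runs (If b c d) s (Suc t) \<mu>"
  by (rule runs_step) auto

lemma runs_While_False: "\<not> bval b s \<Longrightarrow> runs (While b c) s 2 (return_pmf s)"
proof -
  assume "\<not> bval b s"
  then have "runs (If b (Seq c (While b c)) Skip) s (Suc 0) (return_pmf s)"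
    by (intro runs_If) (simp add: runs_Skip)
  then have "runs (While b c) s (Suc (Suc 0)) (return_pmf s)" by (rule runs_step[rotated]) simp
  then show ?thesis by (simp add: numeral_2_eq_2)
qed

text \<open>Three steps are overhead: unfolding the loop, testing the condition and discarding the
  finished body.\<close>

lemma runs_While_True:
  assumes "bval b s" "runs c s t1 \<mu>" "\<And>s'. s' \<in> set_pmf \<mu> \<Longrightarrow> runs (While b c) s' t2 (\<nu> s')"
  shows "runs (While b c) s (t1 + t2 + 3) (bind_pmf \<mu> \<nu>)"
proof -
  have "runs (Seq c (While b c)) s (Suc (t1 + t2)) (bind_pmf \<mu> \<nu>)" by (rule runs_Seq[OF assms(2,3)])
  then have "runs (If b (Seq c (While b c)) Skip) s (Suc (Suc (t1 + t2))) (bind_pmf \<mu> \<nu>)"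
    using assms(1) by (intro runs_If) simp
  then have "runs (While b c) s (Suc (Suc (Suc (t1 + t2)))) (bind_pmf \<mu> \<nu>)"
    by (rule runs_step[rotated]) simp
  then show ?thesis by (simp add: numeral_3_eq_3)
qed

section \<open>Memory layout\<close>

lemma set_reg_simps [simp]:
  "reg (set_reg x v s) y = (if x = y then v else reg s y)" "mem (set_reg x v s) = mem s"
  unfolding set_reg_def by auto

lemma set_mem_simps [simp]:
  "reg (set_mem i v s) = reg s" "mem (set_mem i v s) j = (if i = j then v else mem s j)"
  unfolding set_mem_def by auto

text \<open>
  Beyond the input, the memory is divided into eight interleaved unbounded arrays; the register
  \<open>B\<close> holds the end of the input.
\<close>

definition addr :: "nat \<Rightarrow> aexp \<Rightarrow> aexp" where
  "addr a i = (let d = Add i i; q = Add d d in Add (Reg ''B'') (Add (Const a) (Add q q)))"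

definition Arr :: "nat \<Rightarrow> aexp \<Rightarrow> aexp" where
  "Arr a i = Load (addr a i)"

definition arr :: "ram \<Rightarrow> nat \<Rightarrow> nat \<Rightarrow> nat" where
  "arr s a i = mem s (reg s ''B'' + (a + 8 * i))"

definition set_arr :: "nat \<Rightarrow> nat \<Rightarrow> nat \<Rightarrow> ram \<Rightarrow> ram" where
  "set_arr a i v s = set_mem (reg s ''B'' + (a + 8 * i)) v s"

lemma aval_addr: "aval (addr a i) s = reg s ''B'' + (a + 8 * aval i s)"
  unfolding addr_def by (simp add: Let_def)

lemma aval_Arr [simp]: "aval (Arr a i) s = arr s a (aval i s)"
  unfolding Arr_def arr_def by (simp add: aval_addr)

lemma arr_set_reg [simp]: "x \<noteq> ''B'' \<Longrightarrow> arr (set_reg x v s) = arr s"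
  by (intro ext) (simp add: arr_def)

lemma reg_set_arr [simp]: "reg (set_arr a i v s) = reg s"
  unfolding set_arr_def by simp

lemma mod8_unique:
  assumes "a < 8" "a' < 8"
  shows "a + 8 * i = a' + 8 * (i' :: nat) \<longleftrightarrow> a = a' \<and> i = i'"
proof
  assume eq: "a + 8 * i = a' + 8 * i'"
  then have "(a + 8 * i) mod 8 = (a' + 8 * i') mod 8" by simp
  then have "a = a'" using assms by simp
  then show "a = a' \<and> i = i'" using eq by simp
qed simp

lemma arr_set_arr [simp]:
  "a < 8 \<Longrightarrow> a' < 8 \<Longrightarrow> arr (set_arr a i v s) a' i' = (if a = a' \<and> i = i' then v else arr s a' i')"
  unfolding arr_def set_arr_def using mod8_unique[of a a' i i'] by simp

lemma mem_set_arr [simp]: "j < reg s ''B'' \<Longrightarrow> mem (set_arr a i v s) j = mem s j"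
  unfolding set_arr_def by simp

text \<open>All loops are counted loops, so that a polynomial time bound can be read off from the
  program text and correctness proofs are inductions on the counters.\<close>

datatype prog =
    PSkip
  | PAssign string aexp
  | PStore aexp aexp
  | PArr nat aexp aexp
  | PFlip string
  | PSeq prog prog
  | PIf bexp prog prog
  | PFor string string prog

primrec compile :: "prog \<Rightarrow> com" where
  "compile PSkip = Skip"
| "compile (PAssign x a) = Assign x a"
| "compile (PStore i a) = Store i a"
| "compile (PArr a i v) = Store (addr a i) v"
| "compile (PFlip x) = Flip x"
| "compile (PSeq p q) = Seq (compile p) (compile q)"
| "compile (PIf b p q) = If b (compile p) (compile q)"
| "compile (PFor x l p) = Seq (Assign x (Const 0))
     (While (Less (Reg x) (Reg l)) (Seq (compile p) (Assign x (Add (Reg x) (Const 1)))))"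

primrec assigned :: "prog \<Rightarrow> string set" where
  "assigned PSkip = {}"
| "assigned (PAssign x a) = {x}"
| "assigned (PStore i a) = {}"
| "assigned (PArr a i v) = {}"
| "assigned (PFlip x) = {x}"
| "assigned (PSeq p q) = assigned p \<union> assigned q"
| "assigned (PIf b p q) = assigned p \<union> assigned q"
| "assigned (PFor x l p) = insert x (assigned p)"

text \<open>Programs must not assign to these registers. A bound on their initial values then bounds
  the number of iterations of every loop.\<close>

primrec limits :: "prog \<Rightarrow> string set" where
  "limits PSkip = {}"
| "limits (PAssign x a) = {}"
| "limits (PStore i a) = {}"
| "limits (PArr a i v) = {}"
| "limits (PFlip x) = {}"
| "limits (PSeq p q) = limits p \<union> limits q"
| "limits (PIf b p q) = limits p \<union> limits q"
| "limits (PFor x l p) = insert l (limits p)"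

text \<open>The number 8 stands for the memory outside of the arrays.\<close>

primrec arrs :: "prog \<Rightarrow> nat set" where
  "arrs PSkip = {}"
| "arrs (PAssign x a) = {}"
| "arrs (PStore i a) = {..8}"
| "arrs (PArr a i v) = {a}"
| "arrs (PFlip x) = {}"
| "arrs (PSeq p q) = arrs p \<union> arrs q"
| "arrs (PIf b p q) = arrs p \<union> arrs q"
| "arrs (PFor x l p) = arrs p"

primrec wfp :: "prog \<Rightarrow> bool" where
  "wfp PSkip \<longleftrightarrow> True"
| "wfp (PAssign x a) \<longleftrightarrow> True"
| "wfp (PStore i a) \<longleftrightarrow> True"
| "wfp (PArr a i v) \<longleftrightarrow> a < 8"
| "wfp (PFlip x) \<longleftrightarrow> True"
| "wfp (PSeq p q) \<longleftrightarrow> wfp p \<and> wfp q"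
| "wfp (PIf b p q) \<longleftrightarrow> wfp p \<and> wfp q"
| "wfp (PFor x l p) \<longleftrightarrow> x \<notin> assigned p \<and> x \<noteq> l \<and> wfp p"

primrec flipless :: "prog \<Rightarrow> bool" where
  "flipless PSkip \<longleftrightarrow> True"
| "flipless (PAssign x a) \<longleftrightarrow> True"
| "flipless (PStore i a) \<longleftrightarrow> True"
| "flipless (PArr a i v) \<longleftrightarrow> True"
| "flipless (PFlip x) \<longleftrightarrow> False"
| "flipless (PSeq p q) \<longleftrightarrow> flipless p \<and> flipless q"
| "flipless (PIf b p q) \<longleftrightarrow> flipless p \<and> flipless q"
| "flipless (PFor x l p) \<longleftrightarrow> flipless p"

primrec psem :: "prog \<Rightarrow> ram \<Rightarrow> ram pmf" where
  "psem PSkip s = return_pmf s"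
| "psem (PAssign x a) s = return_pmf (set_reg x (aval a s) s)"
| "psem (PStore i a) s = return_pmf (set_mem (aval i s) (aval a s) s)"
| "psem (PArr a i v) s = return_pmf (set_arr a (aval i s) (aval v s) s)"
| "psem (PFlip x) s = map_pmf (\<lambda>b. set_reg x (if b then 1 else 0) s) (bernoulli_pmf (1/2))"
| "psem (PSeq p q) s = bind_pmf (psem p s) (psem q)"
| "psem (PIf b p q) s = (if bval b s then psem p s else psem q s)"
| "psem (PFor x l p) s = rec_nat (return_pmf (set_reg x 0 s))
     (\<lambda>i \<mu>. bind_pmf \<mu> (\<lambda>s'. map_pmf (set_reg x (Suc i)) (psem p s'))) (reg s l)"

text \<open>This keeps probability out of the correctness proofs for programs without coin flips.
  The value for \<open>PFlip\<close> is a dummy: agreement with \<open>psem\<close> is claimed for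
  flip-free programs.\<close>

primrec sem :: "prog \<Rightarrow> ram \<Rightarrow> ram" where
  "sem PSkip s = s"
| "sem (PAssign x a) s = set_reg x (aval a s) s"
| "sem (PStore i a) s = set_mem (aval i s) (aval a s) s"
| "sem (PArr a i v) s = set_arr a (aval i s) (aval v s) s"
| "sem (PFlip x) s = s"
| "sem (PSeq p q) s = sem q (sem p s)"
| "sem (PIf b p q) s = (if bval b s then sem p s else sem q s)"
| "sem (PFor x l p) s = rec_nat (set_reg x 0 s) (\<lambda>i s'. set_reg x (Suc i) (sem p s')) (reg s l)"

text \<open>The variable stands for a bound on all loop limits. The branches of a conditional are
  added because a maximum would not be a polynomial.\<close>

primrec pcost :: "prog \<Rightarrow> nat poly" where
  "pcost PSkip = [:0:]"
| "pcost (PAssign x a) = [:1:]"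
| "pcost (PStore i a) = [:1:]"
| "pcost (PArr a i v) = [:1:]"
| "pcost (PFlip x) = [:1:]"
| "pcost (PSeq p q) = [:1:] + pcost p + pcost q"
| "pcost (PIf b p q) = [:1:] + pcost p + pcost q"
| "pcost (PFor x l p) = [:4:] + [:0, 1:] * ([:5:] + pcost p)"

lemma psem_flipless: "flipless p \<Longrightarrow> psem p s = return_pmf (sem p s)"
proof (induction p arbitrary: s)
  case (PFor x l p)
  then have IH: "psem p = (\<lambda>s. return_pmf (sem p s))" by auto
  have "rec_nat (return_pmf (set_reg x 0 s)) (\<lambda>i \<mu>. bind_pmf \<mu> (\<lambda>s'. map_pmf (set_reg x (Suc i)) (psem p s'))) k
    = return_pmf (rec_nat (set_reg x 0 s) (\<lambda>i s'. set_reg x (Suc i) (sem p s')) k)" for k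
    by (induction k) (auto simp: IH bind_return_pmf)
  then show ?case by simp
qed (auto simp: bind_return_pmf)

lemma reg_psem: "s' \<in> set_pmf (psem p s) \<Longrightarrow> y \<notin> assigned p \<Longrightarrow> reg s' y = reg s y"
proof (induction p arbitrary: s s')
  case (PFor x l p)
  have "s' \<in> set_pmf (rec_nat (return_pmf (set_reg x 0 s))
     (\<lambda>i \<mu>. bind_pmf \<mu> (\<lambda>s'. map_pmf (set_reg x (Suc i)) (psem p s'))) k) \<Longrightarrow> reg s' y = reg s y" for k s'
  proof (induction k arbitrary: s')
    case 0 then show ?case using PFor.prems by auto
  next
    case (Suc k) then show ?case using PFor.IH PFor.prems by auto
  qed
  then show ?case using PFor.prems by auto
next
  case (PSeq p q)
  from PSeq.prems(1) obtain s1 where s1: "s1 \<in> set_pmf (psem p s)" "s' \<in> set_pmf (psem q s1)" by auto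
  then show ?case using PSeq.IH(1)[OF s1(1)] PSeq.IH(2)[OF s1(2)] PSeq.prems(2) by simp
next
  case (PIf b p q)
  then show ?case by (cases "bval b s") simp_all
qed auto

text \<open>Beyond the body, an iteration costs 3 steps for the loop, 1 for discarding the body and
  1 for the increment. The remaining 4 are the initial assignment, its removal and the 2 steps of
  the failing test.\<close>

lemma runs_For:
  fixes x l :: string
  assumes body: "\<And>s'. s' \<in> I \<Longrightarrow> runs c s' T (f s')"
    and fI: "\<And>s' s''. s' \<in> I \<Longrightarrow> s'' \<in> set_pmf (f s') \<Longrightarrow> reg s'' x = reg s' x \<and> reg s'' l = reg s' l \<and>
      (\<forall>v. set_reg x v s'' \<in> I)"
    and xl: "x \<noteq> l" and s: "set_reg x 0 s \<in> I"
  shows "runs (Seq (Assign x (Const 0)) (While (Less (Reg x) (Reg l)) (Seq c (Assign x (Add (Reg x) (Const 1))))))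
     s (4 + reg s l * (T + 5)) (rec_nat (return_pmf (set_reg x 0 s))
     (\<lambda>i \<mu>. bind_pmf \<mu> (\<lambda>s'. map_pmf (set_reg x (Suc i)) (f s'))) (reg s l))"
proof -
  let ?W = "While (Less (Reg x) (Reg l)) (Seq c (Assign x (Add (Reg x) (Const 1))))"
  define F where "F = (\<lambda>i s'. map_pmf (set_reg x (Suc i)) (f s'))"
  have B: "runs (Seq c (Assign x (Add (Reg x) (Const 1)))) s' (T + 2) (F (reg s' x) s')" if "s' \<in> I" for s'
  proof -
    have "runs (Seq c (Assign x (Add (Reg x) (Const 1)))) s' (Suc (T + 1))
      (bind_pmf (f s') (\<lambda>s''. return_pmf (set_reg x (Suc (reg s' x)) s'')))"
    proof (rule runs_Seq[OF body[OF that]])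
      fix s'' assume "s'' \<in> set_pmf (f s')"
      then show "runs (Assign x (Add (Reg x) (Const 1))) s'' 1 (return_pmf (set_reg x (Suc (reg s' x)) s''))"
        using fI[OF that] by (intro runs_atomic) auto
    qed
    then show ?thesis unfolding F_def map_pmf_def by simp
  qed
  have W: "runs ?W s' (2 + k * (T + 5)) (rec_nat (\<lambda>_. return_pmf) (\<lambda>_ g i s'. bind_pmf (F i s') (g (Suc i))) k (reg s' x) s')"
    if "s' \<in> I" "reg s' x + k = reg s' l" for s' k
    using that
  proof (induction k arbitrary: s')
    case 0
    then show ?case using runs_While_False[of "Less (Reg x) (Reg l)" s'] by simp
  next
    case (Suc k)
    let ?g = "rec_nat (\<lambda>_. return_pmf) (\<lambda>_ g i s'. bind_pmf (F i s') (g (Suc i))) k"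
    have "runs ?W s' (T + 2 + (2 + k * (T + 5)) + 3) (bind_pmf (F (reg s' x) s') (?g (Suc (reg s' x))))"
    proof (rule runs_While_True[OF _ B])
      show "bval (Less (Reg x) (Reg l)) s'" using Suc.prems by simp
      fix s'' assume "s'' \<in> set_pmf (F (reg s' x) s')"
      then have s'': "s'' \<in> I" "reg s'' x = Suc (reg s' x)" "reg s'' l = reg s' l"
        using fI[OF Suc.prems(1)] xl unfolding F_def by auto
      have "runs ?W s'' (2 + k * (T + 5)) (?g (reg s'' x) s'')" by (rule Suc.IH) (use s'' Suc.prems in auto)
      then show "runs ?W s'' (2 + k * (T + 5)) (?g (Suc (reg s' x)) s'')" using s'' by simp
    qed (use Suc.prems in auto)
    then show ?case by (simp add: algebra_simps)
  qed
  \<comment> \<open>The loop unfolds from its first iteration, whereas \<open>rec_nat\<close> in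
    \<open>psem\<close> appends the last one. This identity converts one form into the
    other.\<close>
  have shift: "bind_pmf (rec_nat (return_pmf s0) (\<lambda>i \<mu>. bind_pmf \<mu> (F i)) j)
      (rec_nat (\<lambda>_. return_pmf) (\<lambda>_ g i s'. bind_pmf (F i s') (g (Suc i))) k j)
    = rec_nat (return_pmf s0) (\<lambda>i \<mu>. bind_pmf \<mu> (F i)) (j + k)" for j k s0
  proof (induction k arbitrary: j)
    case 0 then show ?case by (simp add: bind_return_pmf')
  next
    case (Suc k)
    then show ?case using Suc[of "Suc j"] by (simp add: bind_assoc_pmf)
  qed
  have "runs (Seq (Assign x (Const 0)) ?W) s (Suc (1 + (2 + reg s l * (T + 5))))
    (bind_pmf (return_pmf (set_reg x 0 s)) (rec_nat (\<lambda>_. return_pmf) (\<lambda>_ g i s'. bind_pmf (F i s') (g (Suc i))) (reg s l) 0))"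
  proof (rule runs_Seq)
    show "runs (Assign x (Const 0)) s 1 (return_pmf (set_reg x 0 s))" by (rule runs_atomic) simp
    fix s' assume "s' \<in> set_pmf (return_pmf (set_reg x 0 s))"
    then show "runs ?W s' (2 + reg s l * (T + 5)) (rec_nat (\<lambda>_. return_pmf) (\<lambda>_ g i s'. bind_pmf (F i s') (g (Suc i))) (reg s l) 0 s')"
      using W[of "set_reg x 0 s" "reg s l"] s xl by simp
  qed
  moreover have "Suc (1 + (2 + reg s l * (T + 5))) = 4 + reg s l * (T + 5)" by simp
  ultimately have "runs (Seq (Assign x (Const 0)) ?W) s (4 + reg s l * (T + 5))
    (bind_pmf (return_pmf (set_reg x 0 s)) (rec_nat (\<lambda>_. return_pmf) (\<lambda>_ g i s'. bind_pmf (F i s') (g (Suc i))) (reg s l) 0))"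
    by metis
  then show ?thesis using shift[of "set_reg x 0 s" 0 "reg s l"] unfolding F_def by (simp add: bind_return_pmf)
qed

lemma runs_compile:
  assumes "wfp p" "limits p \<inter> assigned p = {}" "\<And>l. l \<in> limits p \<Longrightarrow> reg s l \<le> N"
  shows "runs (compile p) s (poly (pcost p) N) (psem p s)"
  using assms
proof (induction p arbitrary: s)
  case (PFor x l p)
  let ?I = "{s'. \<forall>l'\<in>limits (PFor x l p). reg s' l' = reg s l'}"
  have "runs (compile (PFor x l p)) s (4 + reg s l * (poly (pcost p) N + 5)) (psem (PFor x l p) s)"
    unfolding compile.simps psem.simps
  proof (rule runs_For[where I = "?I" and f = "psem p"])
    show "runs (compile p) s' (poly (pcost p) N) (psem p s')" if "s' \<in> ?I" for s'
      using that PFor by (intro PFor.IH) auto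
    show "reg s'' x = reg s' x \<and> reg s'' l = reg s' l \<and> (\<forall>v. set_reg x v s'' \<in> ?I)"
      if "s' \<in> ?I" "s'' \<in> set_pmf (psem p s')" for s' s''
    proof -
      have "reg s'' y = reg s' y" if "y = x \<or> y \<in> limits (PFor x l p)" for y
        using reg_psem[OF \<open>s'' \<in> _\<close>, of y] that PFor.prems by auto
      moreover have "x \<notin> limits (PFor x l p)" using PFor.prems by auto
      ultimately show ?thesis using \<open>s' \<in> ?I\<close> by auto
    qed
    show "set_reg x 0 s \<in> ?I" using PFor.prems by auto
  qed (use PFor.prems in auto)
  moreover have "reg s l * (poly (pcost p) N + 5) \<le> N * (poly (pcost p) N + 5)"
    using PFor.prems(3)[of l] by (intro mult_le_mono1) auto
  ultimately show ?case by (elim runs_le) (simp add: algebra_simps)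
next
  case (PSeq p q)
  have "runs (compile (PSeq p q)) s (Suc (poly (pcost p) N + poly (pcost q) N)) (psem (PSeq p q) s)"
    unfolding compile.simps psem.simps
  proof (rule runs_Seq)
    show "runs (compile p) s (poly (pcost p) N) (psem p s)" using PSeq by (intro PSeq.IH) auto
    fix s' assume s': "s' \<in> set_pmf (psem p s)"
    have "reg s' l \<le> N" if l: "l \<in> limits q" for l
    proof -
      have "l \<notin> assigned p" "reg s l \<le> N" using PSeq.prems l by auto
      then show ?thesis using reg_psem[OF s', of l] by simp
    qed
    then show "runs (compile q) s' (poly (pcost q) N) (psem q s')" using PSeq by (intro PSeq.IH) auto
  qed
  then show ?case by simp
next
  case (PIf b p q)
  have "runs (if bval b s then compile p else compile q) s (poly (pcost p) N + poly (pcost q) N) (psem (PIf b p q) s)"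
  proof (cases "bval b s")
    case True
    have "runs (compile p) s (poly (pcost p) N) (psem p s)" using PIf by (intro PIf.IH) auto
    then have "runs (compile p) s (poly (pcost p) N + poly (pcost q) N) (psem p s)" by (rule runs_le) simp
    then show ?thesis using True by simp
  next
    case False
    have "runs (compile q) s (poly (pcost q) N) (psem q s)" using PIf by (intro PIf.IH) auto
    then have "runs (compile q) s (poly (pcost p) N + poly (pcost q) N) (psem q s)" by (rule runs_le) simp
    then show ?thesis using False by simp
  qed
  then have "runs (compile (PIf b p q)) s (Suc (poly (pcost p) N + poly (pcost q) N)) (psem (PIf b p q) s)"
    unfolding compile.simps by (rule runs_If)
  then show ?case by simp
next
  case PSkip then show ?case using runs_Skip by simp
next
  case (PFlip x)
  have "runs (Flip x) s 1 (psem (PFlip x) s)" by (rule runs_atomic) (simp add: pmf.map_comp comp_def)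
  then show ?case by simp
next
  case (PAssign x a)
  have "runs (Assign x a) s 1 (psem (PAssign x a) s)" by (rule runs_atomic) simp
  then show ?case by simp
next
  case (PStore i a)
  have "runs (Store i a) s 1 (psem (PStore i a) s)" by (rule runs_atomic) simp
  then show ?case by simp
next
  case (PArr a i v)
  have "runs (Store (addr a i) v) s 1 (psem (PArr a i v) s)" by (rule runs_atomic) (simp add: set_arr_def aval_addr)
  then show ?case by simp
qed

section \<open>Frame conditions and loop invariants\<close>

definition frame :: "string set \<Rightarrow> nat set \<Rightarrow> ram \<Rightarrow> ram \<Rightarrow> bool" where
  "frame X A s s' \<longleftrightarrow> (\<forall>y. y \<notin> X \<longrightarrow> reg s' y = reg s y) \<and> (\<forall>a<8. a \<notin> A \<longrightarrow> arr s' a = arr s a) \<and>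
     (8 \<notin> A \<longrightarrow> (\<forall>j < reg s ''B''. mem s' j = mem s j))"

lemma frame_refl: "frame X A s s"
  unfolding frame_def by auto

lemma frame_trans:
  "frame X A s s' \<Longrightarrow> frame Y A' s' s'' \<Longrightarrow> ''B'' \<notin> X \<Longrightarrow> frame (X \<union> Y) (A \<union> A') s s''"
  unfolding frame_def by auto

lemma frame_mono: "frame X A s s' \<Longrightarrow> X \<subseteq> Y \<Longrightarrow> A \<subseteq> A' \<Longrightarrow> frame Y A' s s'"
  unfolding frame_def by auto

lemma frame_set_reg: "x \<noteq> ''B'' \<Longrightarrow> frame {x} {} s (set_reg x v s)"
  unfolding frame_def by (simp add: fun_eq_iff)

lemma For_frame:
  assumes b: "\<And>s. frame (assigned p) (arrs p) s (sem p s)" and B: "''B'' \<notin> insert x (assigned p)"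
  shows "frame (insert x (assigned p)) (arrs p) s (rec_nat (set_reg x 0 s) (\<lambda>i s'. set_reg x (Suc i) (sem p s')) k)"
proof (induction k)
  case 0
  then show ?case using frame_mono[OF frame_set_reg] B by auto
next
  case (Suc k)
  have 1: "x \<noteq> ''B''" "''B'' \<notin> assigned p" using B by auto
  show ?case unfolding nat.rec
    by (rule frame_mono[OF frame_trans[OF Suc frame_trans[OF b frame_set_reg[OF 1(1)] 1(2)] B]]) auto
qed

lemma sem_frame:
  assumes "wfp p" "''B'' \<notin> assigned p"
  shows "frame (assigned p) (arrs p) s (sem p s)"
  using assms
proof (induction p arbitrary: s)
  case (PArr a i v) then show ?case unfolding frame_def by (simp add: fun_eq_iff)
next
  case (PSeq p q) then show ?case using frame_trans[OF PSeq.IH(1) PSeq.IH(2)] by simp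
next
  case (PIf b p q)
  then have "frame (assigned p) (arrs p) s (sem p s)" "frame (assigned q) (arrs q) s (sem q s)" by simp_all
  then show ?case by (auto elim!: frame_mono)
next
  case (PFor x l p)
  then have "frame (assigned p) (arrs p) s (sem p s)" for s by simp
  then show ?case using For_frame[of p x s "reg s l"] PFor.prems by simp
qed (auto simp: frame_def)

lemma psem_frame:
  assumes "wfp p" "''B'' \<notin> assigned p" "s' \<in> set_pmf (psem p s)"
  shows "frame (assigned p) (arrs p) s s'"
  using assms
proof (induction p arbitrary: s s')
  case (PFlip x) then show ?case unfolding frame_def by (auto simp: fun_eq_iff)
next
  case (PArr a i v) then show ?case unfolding frame_def by (simp add: fun_eq_iff)
next
  case (PSeq p q)
  then obtain s1 where "s1 \<in> set_pmf (psem p s)" "s' \<in> set_pmf (psem q s1)" by auto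
  then show ?case using frame_trans[OF PSeq.IH(1) PSeq.IH(2)] PSeq.prems by simp
next
  case (PIf b p q)
  show ?case
  proof (cases "bval b s")
    case True
    then have "frame (assigned p) (arrs p) s s'" using PIf.IH(1) PIf.prems by simp
    then show ?thesis by (rule frame_mono) auto
  next
    case False
    then have "frame (assigned q) (arrs q) s s'" using PIf.IH(2) PIf.prems by simp
    then show ?thesis by (rule frame_mono) auto
  qed
next
  case (PFor x l p)
  have x: "x \<noteq> ''B''" "''B'' \<notin> assigned p" "''B'' \<notin> insert x (assigned p)" using PFor.prems by auto
  have "s' \<in> set_pmf (rec_nat (return_pmf (set_reg x 0 s))
     (\<lambda>i \<mu>. bind_pmf \<mu> (\<lambda>s'. map_pmf (set_reg x (Suc i)) (psem p s'))) k) \<Longrightarrow>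
     frame (insert x (assigned p)) (arrs p) s s'" for k s'
  proof (induction k arbitrary: s')
    case 0 then show ?case using frame_mono[OF frame_set_reg[OF x(1)]] by auto
  next
    case (Suc k)
    then obtain s1 s2 where s: "frame (insert x (assigned p)) (arrs p) s s1" "s2 \<in> set_pmf (psem p s1)"
      "s' = set_reg x (Suc k) s2" by auto
    have "frame (assigned p) (arrs p) s1 s2" using PFor.IH[OF _ _ s(2)] PFor.prems by simp
    then show ?case unfolding s(3)
      by (rule frame_mono[OF frame_trans[OF s(1) frame_trans[OF _ frame_set_reg[OF x(1)] x(2)] x(3)]]) auto
  qed
  then show ?case using PFor.prems by simp
qed (auto simp: frame_def)

text \<open>In the step the frame condition relates the current state to the one before the loop, so
  an invariant only has to mention what the loop changes.\<close>

lemma sem_For: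
  assumes wf: "wfp p" "''B'' \<notin> insert x (assigned p)"
    and init: "I 0 (set_reg x 0 s)"
    and step: "\<And>i s'. i < reg s l \<Longrightarrow> reg s' x = i \<Longrightarrow> frame (insert x (assigned p)) (arrs p) s s' \<Longrightarrow> I i s' \<Longrightarrow>
      I (Suc i) (set_reg x (Suc i) (sem p s'))"
  shows "I (reg s l) (sem (PFor x l p) s)"
proof -
  let ?R = "rec_nat (set_reg x 0 s) (\<lambda>i s'. set_reg x (Suc i) (sem p s'))"
  have "reg (?R k) x = k \<and> (k \<le> reg s l \<longrightarrow> I k (?R k))" for k
  proof (induction k)
    case 0 then show ?case using init by simp
  next
    case (Suc k)
    then show ?case using step[of k "?R k"] For_frame[OF sem_frame, of p x s k] wf by auto
  qed
  then show ?thesis by simp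
qed


section \<open>Breadth-first search\<close>

abbreviation Eq :: "aexp \<Rightarrow> aexp \<Rightarrow> bexp" where
  "Eq a b \<equiv> BAnd (BNot (Less a b)) (BNot (Less b a))"

abbreviation Suc_exp :: "aexp \<Rightarrow> aexp" where
  "Suc_exp a \<equiv> Add a (Const 1)"

abbreviation src_exp :: "aexp \<Rightarrow> aexp" where
  "src_exp e \<equiv> Load (Add (Const 3) (Add e e))"

abbreviation tgt_exp :: "aexp \<Rightarrow> aexp" where
  "tgt_exp e \<equiv> Load (Add (Const 4) (Add e e))"

lemma frame_reg: "frame X A s s' \<Longrightarrow> y \<notin> X \<Longrightarrow> reg s' y = reg s y"
  unfolding frame_def by auto

lemma frame_arr: "frame X A s s' \<Longrightarrow> a < 8 \<Longrightarrow> a \<notin> A \<Longrightarrow> arr s' a = arr s a"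
  unfolding frame_def by auto

text \<open>
  Arrays 1, 2 and 3 hold the marked edges, the distances plus one and the tree edges of a
  breadth-first search from the vertex in register \<open>a\<close>.
\<close>

definition scan_body :: prog where
  "scan_body = PIf (Less (Const 0) (Arr 1 (Reg ''f'')))
     (PSeq (PAssign ''u'' (src_exp (Reg ''f''))) (PSeq (PAssign ''w'' (tgt_exp (Reg ''f'')))
       (PIf (BAnd (Eq (Arr 2 (Reg ''u'')) (Suc_exp (Reg ''d''))) (Eq (Arr 2 (Reg ''w'')) (Const 0)))
         (PSeq (PArr 2 (Reg ''w'') (Add (Reg ''d'') (Const 2))) (PArr 3 (Reg ''f'') (Const 1)))
         (PIf (BAnd (Eq (Arr 2 (Reg ''w'')) (Suc_exp (Reg ''d''))) (Eq (Arr 2 (Reg ''u'')) (Const 0)))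
           (PSeq (PArr 2 (Reg ''u'') (Add (Reg ''d'') (Const 2))) (PArr 3 (Reg ''f'') (Const 1)))
           PSkip))))
     PSkip"

definition reach_init :: prog where
  "reach_init = PSeq (PFor ''v'' ''n'' (PArr 2 (Reg ''v'') (Const 0)))
     (PSeq (PFor ''f'' ''m'' (PArr 3 (Reg ''f'') (Const 0))) (PArr 2 (Reg ''a'') (Const 1)))"

text \<open>There is no queue: round \<open>d\<close> scans all edges and enters the vertices at
  distance \<open>d + 1\<close>. The distances are less than \<open>n\<close>, so \<open>n\<close>
  rounds suffice.\<close>

definition reach :: prog where
  "reach = PSeq reach_init (PFor ''d'' ''n'' (PFor ''f'' ''m'' scan_body))"

lemma scan_body_wf [simp]:
  "wfp scan_body" "assigned scan_body = {''u'', ''w''}" "arrs scan_body = {2, 3}" "limits scan_body = {}"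
  "flipless scan_body"
  unfolding scan_body_def by auto

lemma reach_init_wf [simp]:
  "wfp reach_init" "assigned reach_init = {''v'', ''f''}" "arrs reach_init = {2, 3}"
  "limits reach_init = {''n'', ''m''}" "flipless reach_init"
  unfolding reach_init_def by auto

lemma reach_wf [simp]:
  "wfp reach" "assigned reach = {''v'', ''f'', ''d'', ''u'', ''w''}" "arrs reach = {2, 3}"
  "limits reach = {''n'', ''m''}" "flipless reach"
  unfolding reach_def by auto

locale input_graph =
  fixes n :: nat and es :: "(nat \<times> nat) list"
  assumes mg: "multigraph (graph_of n es)"
begin

abbreviation "m \<equiv> length es"

sublocale mgraph_loc "graph_of n es"
  using mg by unfold_locales

lemma graph_of_simps [simp]:
  "vertices (graph_of n es) = {..<n}" "edges (graph_of n es) = {..<m}"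
  "ends (graph_of n es) e = {fst (es ! e), snd (es ! e)}"
  unfolding graph_of_def by auto

lemma es_bounds: "e < m \<Longrightarrow> fst (es ! e) < n" "e < m \<Longrightarrow> snd (es ! e) < n" "e < m \<Longrightarrow> fst (es ! e) \<noteq> snd (es ! e)"
  using en_subset[of e] card_en[of e] by auto

lemma ends_less:
  assumes "e < m" "ends (graph_of n es) e = {u, w}"
  shows "u < n" "w < n"
proof -
  have "{u, w} \<subseteq> {..<n}" using en_subset[of e] assms by (simp del: insert_subset)
  then show "u < n" "w < n" by auto
qed

definition inp :: "ram \<Rightarrow> bool" where
  "inp s \<longleftrightarrow> reg s ''n'' = n \<and> reg s ''m'' = m \<and> reg s ''B'' = 3 + 2 * m \<and>
     (\<forall>e<m. mem s (3 + 2 * e) = fst (es ! e) \<and> mem s (4 + 2 * e) = snd (es ! e))"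

lemma inp_frame:
  assumes "inp s" "frame X A s s'" "''n'' \<notin> X" "''m'' \<notin> X" "''B'' \<notin> X" "8 \<notin> A"
  shows "inp s'"
proof -
  have "mem s' j = mem s j" if "j < 3 + 2 * m" for j
    using assms that unfolding frame_def inp_def by auto
  moreover have "reg s' x = reg s x" if "x \<in> {''n'', ''m'', ''B''}" for x
    using frame_reg[OF assms(2), of x] assms(3-5) that by auto
  ultimately show ?thesis using assms(1) unfolding inp_def by auto
qed

text \<open>\<open>V\<close> holds distances plus one. The second condition yields tree paths to the
  root, the third one yields acyclicity through \<open>acyclic_by_rank\<close>.\<close>

definition tree_inv :: "nat set \<Rightarrow> (nat \<Rightarrow> nat) \<Rightarrow> (nat \<Rightarrow> nat) \<Rightarrow> bool" where
  "tree_inv M V T \<longleftrightarrow>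
     (\<forall>e<m. T e \<noteq> 0 \<longrightarrow> e \<in> M \<and> (\<exists>v w. ends (graph_of n es) e = {v, w} \<and> V w \<noteq> 0 \<and> V v = Suc (V w))) \<and>
     (\<forall>v<n. 1 < V v \<longrightarrow> (\<exists>e<m. T e \<noteq> 0 \<and> (\<exists>w. ends (graph_of n es) e = {v, w} \<and> V w \<noteq> 0 \<and> V v = Suc (V w)))) \<and>
     (\<forall>e<m. \<forall>e'<m. \<forall>v w w'. T e \<noteq> 0 \<and> T e' \<noteq> 0 \<and> ends (graph_of n es) e = {v, w} \<and> ends (graph_of n es) e' = {v, w'} \<and>
        V v = Suc (V w) \<and> V v = Suc (V w') \<longrightarrow> e = e')"

text \<open>The situation in round \<open>i\<close> after the first \<open>f\<close> edges: all
  vertices within distance \<open>i\<close> have their final values, those entered in this round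
  have value \<open>i + 2\<close>, and no scanned edge leads from distance \<open>i\<close> to an
  unreached vertex.\<close>

definition bfs_inv :: "nat set \<Rightarrow> nat \<Rightarrow> nat \<Rightarrow> nat \<Rightarrow> (nat \<Rightarrow> nat) \<Rightarrow> (nat \<Rightarrow> nat) \<Rightarrow> bool" where
  "bfs_inv M a i f V T \<longleftrightarrow>
     (\<forall>v<n. V v \<le> i + 2 \<and> (\<forall>j. V v = Suc j \<longrightarrow> rch M j a v) \<and> (\<forall>j\<le>i. rch M j a v \<longrightarrow> 0 < V v \<and> V v \<le> Suc j)) \<and>
     (\<forall>g<f. \<forall>u w. g \<in> M \<and> ends (graph_of n es) g = {u, w} \<and> V u = Suc i \<longrightarrow> V w \<noteq> 0) \<and>
     tree_inv M V T"

text \<open>The old tree edges join reached vertices, so none of them meets \<open>w\<close>. No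
  value exceeds \<open>i + 2\<close>, so \<open>w\<close> is not the predecessor of any
  vertex.\<close>

lemma tree_inv_update:
  assumes I: "tree_inv M V T" and f: "f < m" "f \<in> M" "ends (graph_of n es) f = {u, w}"
    and V: "V u = Suc i" "V w = 0" "\<And>v. v < n \<Longrightarrow> V v \<le> i + 2"
  shows "tree_inv M (V(w := i + 2)) (T(f := 1))"
proof -
  let ?en = "ends (graph_of n es)" and ?V = "V(w := i + 2)" and ?T = "T(f := 1)"
  have uw: "u \<noteq> w" using V by auto
  have old: "w \<notin> ?en e" if "e < m" "T e \<noteq> 0" for e
  proof -
    from I that obtain v x where "?en e = {v, x}" "V x \<noteq> 0" "V v = Suc (V x)" unfolding tree_inv_def by metis
    then show ?thesis using V(2) by (metis empty_iff insertE nat.distinct(1))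
  qed
  have 1: "e \<in> M \<and> (\<exists>v x. ?en e = {v, x} \<and> ?V x \<noteq> 0 \<and> ?V v = Suc (?V x))" if e: "e < m" "?T e \<noteq> 0" for e
  proof (cases "e = f")
    case True
    have "?en f = {w, u}" "?V u \<noteq> 0" "?V w = Suc (?V u)" using f(3) V uw by auto
    then show ?thesis using True f(2) by blast
  next
    case False
    then have T: "T e \<noteq> 0" using e by simp
    from I e(1) T obtain v x where vx: "e \<in> M" "?en e = {v, x}" "V x \<noteq> 0" "V v = Suc (V x)" unfolding tree_inv_def by metis
    have "v \<noteq> w" "x \<noteq> w" using old[OF e(1) T] vx(2) by auto
    then have "?V x \<noteq> 0" "?V v = Suc (?V x)" using vx by auto
    then show ?thesis using vx by blast
  qed
  have 2: "\<exists>e<m. ?T e \<noteq> 0 \<and> (\<exists>x. ?en e = {v, x} \<and> ?V x \<noteq> 0 \<and> ?V v = Suc (?V x))" if v: "v < n" "1 < ?V v" for v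
  proof (cases "v = w")
    case True
    have "?en f = {w, u}" "?V u \<noteq> 0" "?V w = Suc (?V u)" "?T f \<noteq> 0" using f(3) V uw by auto
    then show ?thesis using True f(1) by blast
  next
    case False
    then have "1 < V v" using v by simp
    then obtain e x where e: "e < m" "T e \<noteq> 0" "?en e = {v, x}" "V x \<noteq> 0" "V v = Suc (V x)"
      using I v(1) unfolding tree_inv_def by metis
    have "x \<noteq> w" using e V by auto
    then have "?V x \<noteq> 0" "?V v = Suc (?V x)" "?T e \<noteq> 0" using e False by auto
    then show ?thesis using e by blast
  qed
  have 3: "e = e'" if e: "e < m" "e' < m" "?T e \<noteq> 0" "?T e' \<noteq> 0" "?en e = {v, x}" "?en e' = {v, x'}" "?V v = Suc (?V x)" "?V v = Suc (?V x')"
    for e e' v x x'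
  proof (cases "v = w")
    case True
    have "e = f" using old[OF e(1)] e(3,5) True by (cases "e = f") auto
    moreover have "e' = f" using old[OF e(2)] e(4,6) True by (cases "e' = f") auto
    ultimately show ?thesis by simp
  next
    case False
    have vn: "v < n" by (rule ends_less(1)[OF e(1,5)])
    have x: "y \<noteq> w" if "?V v = Suc (?V y)" for y
    proof
      assume "y = w"
      then have "V v = Suc (i + 2)" using that False by simp
      then show False using V(3)[OF vn] by simp
    qed
    have nf: "g \<noteq> f" if "?en g = {v, y}" "?V v = Suc (?V y)" for g y
    proof
      assume "g = f"
      then have "{u, w} = {v, y}" using that f(3) by simp
      then show False using False x[OF that(2)] by (metis doubleton_eq_iff)
    qed
    have "V v = Suc (V x)" "V v = Suc (V x')" using e(7,8) x[OF e(7)] x[OF e(8)] False by auto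
    moreover have "T e \<noteq> 0" "T e' \<noteq> 0" using nf[OF e(5,7)] nf[OF e(6,8)] e(3,4) by auto
    ultimately show ?thesis using I e unfolding tree_inv_def by metis
  qed
  show ?thesis unfolding tree_inv_def using 1 2 3 by blast
qed

lemma bfs_inv_update:
  assumes I: "bfs_inv M a i f V T" and f: "f < m" "f \<in> M" "ends (graph_of n es) f = {u, w}"
    and V: "V u = Suc i" "V w = 0" and a: "a < n" and M: "M \<subseteq> {..<m}"
  shows "bfs_inv M a i (Suc f) (V(w := i + 2)) (T(f := 1))"
proof -
  let ?V = "V(w := i + 2)"
  have uw: "u < n" "w < n" using ends_less[OF f(1,3)] by auto
  have b: "V v \<le> i + 2" if "v < n" for v using I that unfolding bfs_inv_def by blast
  have T: "tree_inv M ?V (T(f := 1))"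
    by (rule tree_inv_update[OF _ f V b]) (use I bfs_inv_def in auto)
  have "rch M i a u" using I uw V unfolding bfs_inv_def by blast
  then have rw: "rch M (Suc i) a w" using f unfolding rch.simps adj_def by blast
  have nw: "\<not> rch M j a w" if "j \<le> i" for j using I uw V that unfolding bfs_inv_def by (metis less_irrefl)
  have 1: "?V v \<le> i + 2 \<and> (\<forall>j. ?V v = Suc j \<longrightarrow> rch M j a v) \<and> (\<forall>j\<le>i. rch M j a v \<longrightarrow> 0 < ?V v \<and> ?V v \<le> Suc j)"
    if "v < n" for v
  proof (cases "v = w")
    case True then show ?thesis using rw nw by (simp del: rch.simps)
  next
    case False
    then have "?V v = V v" by simp
    then show ?thesis using I that unfolding bfs_inv_def by simp
  qed
  have 2: "?V y \<noteq> 0" if g: "g < Suc f" "g \<in> M" "ends (graph_of n es) g = {x, y}" "?V x = Suc i" for g x y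
  proof (cases "y = w")
    case False
    have x: "x \<noteq> w" "V x = Suc i" using g(4) by (auto split: if_splits)
    show ?thesis
    proof (cases "g = f")
      case True
      then have "{x, y} = {u, w}" using g f by simp
      then show ?thesis using x(1) False by (metis doubleton_eq_iff)
    next
      case False': False
      then have "V y \<noteq> 0" using I g x unfolding bfs_inv_def by (metis less_SucE)
      then show ?thesis by simp
    qed
  qed simp
  show ?thesis unfolding bfs_inv_def using 1 2 T by blast
qed

text \<open>The last edge of a walk of length \<open>Suc i\<close> starts at distance
  \<open>i\<close>, and then its scan has reached \<open>v\<close>, or at a smaller distance, and
  then \<open>v\<close> was reached before.\<close>

lemma bfs_inv_next:
  assumes I: "bfs_inv M a i m V T" and M: "M \<subseteq> {..<m}" and a: "a < n"
  shows "bfs_inv M a (Suc i) 0 V T"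
proof -
  have "0 < V v \<and> V v \<le> Suc j" if v: "v < n" "j \<le> Suc i" "rch M j a v" for v j
  proof (cases "j = Suc i")
    case False then show ?thesis using I v unfolding bfs_inv_def by (metis le_SucE)
  next
    case True
    have b: "V v \<le> i + 2" using I v unfolding bfs_inv_def by blast
    from True v(3) consider "rch M i a v" | w where "rch M i a w" "adj M w v" by auto
    then show ?thesis
    proof cases
      case 1 then show ?thesis using I v True unfolding bfs_inv_def by (meson le_SucI order_refl)
    next
      case 2
      then obtain e where e: "e \<in> M" "ends (graph_of n es) e = {w, v}" unfolding adj_def by auto
      have "e < m" using e M by auto
      then have "w < n" using ends_less[OF _ e(2)] by simp
      then have w: "0 < V w" "V w \<le> Suc i" using I 2 unfolding bfs_inv_def by blast+
      have "V v \<noteq> 0"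
      proof (cases "V w = Suc i")
        case True
        show ?thesis using I e True \<open>e < m\<close> unfolding bfs_inv_def by blast
      next
        case False
        then obtain j' where j': "V w = Suc j'" "Suc j' \<le> i" using w by (cases "V w") auto
        then have "rch M j' a w" using I \<open>w < n\<close> unfolding bfs_inv_def by blast
        then have "rch M (Suc j') a v" using 2 by auto
        then show ?thesis using I v j' unfolding bfs_inv_def by (metis less_irrefl)
      qed
      then show ?thesis using b True by simp
    qed
  qed
  then show ?thesis using I unfolding bfs_inv_def by (simp add: le_SucI)
qed

lemma bfs_inv_init: "a < n \<Longrightarrow> (\<And>v. v < n \<Longrightarrow> V v = (if v = a then 1 else 0)) \<Longrightarrow> (\<And>e. e < m \<Longrightarrow> T e = 0) \<Longrightarrow> bfs_inv M a 0 0 V T"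
  unfolding bfs_inv_def tree_inv_def by simp

definition marked :: "ram \<Rightarrow> nat set" where
  "marked s = {e. e < m \<and> arr s 1 e \<noteq> 0}"

definition bfs_post :: "nat set \<Rightarrow> nat \<Rightarrow> (nat \<Rightarrow> nat) \<Rightarrow> (nat \<Rightarrow> nat) \<Rightarrow> bool" where
  "bfs_post M a V T \<longleftrightarrow> (\<forall>v<n. V v \<noteq> 0 \<longleftrightarrow> con M a v) \<and> (\<forall>v<n. \<forall>j. rch M j a v \<longrightarrow> V v \<le> Suc j) \<and>
     (\<forall>v<n. \<forall>j. V v = Suc j \<longrightarrow> rch M j a v) \<and> tree_inv M V T"

text \<open>By \<open>con_rch_card\<close>, walks of length \<open>n - 1\<close> reach everything
  that is reachable, so the invariant for walks of length at most \<open>n\<close> covers all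
  lengths.\<close>

lemma bfs_inv_post:
  assumes I: "bfs_inv M a n 0 V T" and M: "M \<subseteq> {..<m}" and a: "a < n"
  shows "bfs_post M a V T"
proof -
  have c: "rch M (n - 1) a v" if "con M a v" for v using con_rch_card[of M a v] M a that by simp
  have "V v \<le> Suc j" if v: "v < n" "rch M j a v" for v j
  proof (cases "j \<le> n")
    case True then show ?thesis using I v unfolding bfs_inv_def by blast
  next
    case False
    have "con M a v" using v con_def by blast
    then have "V v \<le> Suc (n - 1)" using I v(1) c unfolding bfs_inv_def by (meson diff_le_self)
    then show ?thesis using False by simp
  qed
  moreover have "V v \<noteq> 0 \<longleftrightarrow> con M a v" if "v < n" for v
  proof
    assume "V v \<noteq> 0"
    then obtain j where "V v = Suc j" by (cases "V v") auto
    then show "con M a v" using I that unfolding bfs_inv_def con_def by blast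
  next
    assume "con M a v"
    then show "V v \<noteq> 0" using I that c unfolding bfs_inv_def by (metis diff_le_self less_irrefl)
  qed
  ultimately show ?thesis using I unfolding bfs_post_def bfs_inv_def by blast
qed

lemma scan_body_step:
  assumes inp: "inp s" and f: "reg s ''f'' = f" "f < m" and d: "reg s ''d'' = i" and a: "a < n"
    and M: "marked s = M" and I: "bfs_inv M a i f (arr s 2) (arr s 3)"
  shows "bfs_inv M a i (Suc f) (arr (sem scan_body s) 2) (arr (sem scan_body s) 3)"
proof -
  let ?u = "fst (es ! f)" and ?w = "snd (es ! f)" and ?V = "arr s 2" and ?T = "arr s 3"
  have MM: "M \<subseteq> {..<m}" using M unfolding marked_def by auto
  have mem: "mem s (3 + (f + f)) = ?u" "mem s (4 + (f + f)) = ?w"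
    using inp f unfolding inp_def by (simp_all add: mult_2[symmetric])
  have ends: "ends (graph_of n es) f = {?u, ?w}" by simp
  have u2: "arr (set_arr 3 f 1 (set_arr 2 x y s')) 2 = (arr s' 2)(x := y)"
    "arr (set_arr 3 f 1 (set_arr 2 x y s')) 3 = (arr s' 3)(f := 1)" for x y s'
    by (auto simp: fun_eq_iff)
  consider "f \<notin> M" | "f \<in> M" "?V ?u = Suc i" "?V ?w = 0" | "f \<in> M" "?V ?w = Suc i" "?V ?u = 0"
    | "f \<in> M" "\<not> (?V ?u = Suc i \<and> ?V ?w = 0)" "\<not> (?V ?w = Suc i \<and> ?V ?u = 0)" by metis
  then show ?thesis
  proof cases
    case 1
    then have "sem scan_body s = s" using f M unfolding scan_body_def marked_def by auto
    then show ?thesis using I 1 unfolding bfs_inv_def by (metis less_SucE)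
  next
    case 2
    then have s: "sem scan_body s = set_arr 3 f 1 (set_arr 2 ?w (i + 2) (set_reg ''w'' ?w (set_reg ''u'' ?u s)))"
      using f M mem d unfolding scan_body_def marked_def by auto
    then show ?thesis unfolding s u2 using bfs_inv_update[OF I f(2) 2(1) ends 2(2,3) a MM] by simp
  next
    case 3
    then have s: "sem scan_body s = set_arr 3 f 1 (set_arr 2 ?u (i + 2) (set_reg ''w'' ?w (set_reg ''u'' ?u s)))"
      using f M mem d unfolding scan_body_def marked_def by auto
    have "ends (graph_of n es) f = {?w, ?u}" by (simp add: insert_commute)
    then show ?thesis unfolding s u2 using bfs_inv_update[OF I f(2) 3(1) _ 3(2,3) a MM] by simp
  next
    case 4
    then have "arr (sem scan_body s) = arr s"
      using f M mem d unfolding scan_body_def marked_def by auto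
    moreover have "?V y \<noteq> 0" if "{?u, ?w} = {x, y}" "?V x = Suc i" for x y
      using 4 that by (metis doubleton_eq_iff)
    ultimately show ?thesis using I ends unfolding bfs_inv_def by (simp only: less_Suc_eq) metis
  qed
qed

lemma reach_init_post:
  assumes "inp s" "reg s ''a'' = a" "a < n"
  shows "bfs_inv M a 0 0 (arr (sem reach_init s) 2) (arr (sem reach_init s) 3)"
proof -
  let ?p = "PFor ''v'' ''n'' (PArr 2 (Reg ''v'') (Const 0))" and ?q = "PFor ''f'' ''m'' (PArr 3 (Reg ''f'') (Const 0))"
  have 1: "\<forall>v<reg s ''n''. arr (sem ?p s) 2 v = 0"
    by (rule sem_For[where I = "\<lambda>i s. \<forall>v<i. arr s 2 v = 0"]) (auto simp: less_Suc_eq)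
  let ?s = "sem ?p s"
  have "frame (assigned ?p) (arrs ?p) s ?s" by (rule sem_frame) auto
  then have r: "reg ?s ''n'' = n" "reg ?s ''m'' = m" "reg ?s ''a'' = a"
    using frame_reg assms unfolding inp_def by auto
  have 2: "\<forall>v<reg ?s ''m''. arr (sem ?q ?s) 3 v = 0"
    by (rule sem_For[where I = "\<lambda>i s. \<forall>v<i. arr s 3 v = 0"]) (auto simp: less_Suc_eq)
  let ?t = "sem ?q ?s"
  have "frame (assigned ?q) (arrs ?q) ?s ?t" by (rule sem_frame) auto
  then have t: "reg ?t ''a'' = a" "arr ?t 2 = arr ?s 2" using frame_reg[of _ _ ?s ?t] frame_arr[of _ _ ?s ?t] r by auto
  have "sem reach_init s = set_arr 2 a 1 ?t" unfolding reach_init_def using t by simp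
  then show ?thesis using 1 2 t r assms unfolding inp_def by (intro bfs_inv_init) auto
qed

lemma reach_post:
  assumes inp: "inp s" and a: "reg s ''a'' = a" "a < n"
  shows "bfs_post (marked s) a (arr (sem reach s) 2) (arr (sem reach s) 3)"
proof -
  let ?s = "sem reach_init s" and ?M = "marked s"
  have M: "?M \<subseteq> {..<m}" unfolding marked_def by auto
  have fr: "frame (assigned reach_init) (arrs reach_init) s ?s" by (rule sem_frame) auto
  have inp': "inp ?s" by (rule inp_frame[OF inp fr]) auto
  have mk: "marked s' = marked s''" if "arr s' 1 = arr s'' 1" for s' s'' using that unfolding marked_def by simp
  have M': "marked ?s = ?M" by (rule mk) (use frame_arr[OF fr, of 1] in auto)
  have rn: "reg ?s ''n'' = n" using inp' unfolding inp_def by simp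
  have "bfs_inv ?M a (reg ?s ''n'') 0 (arr (sem (PFor ''d'' ''n'' (PFor ''f'' ''m'' scan_body)) ?s) 2)
    (arr (sem (PFor ''d'' ''n'' (PFor ''f'' ''m'' scan_body)) ?s) 3)"
  proof (rule sem_For[where I = "\<lambda>i s'. bfs_inv ?M a i 0 (arr s' 2) (arr s' 3)"])
    show "bfs_inv ?M a 0 0 (arr (set_reg ''d'' 0 ?s) 2) (arr (set_reg ''d'' 0 ?s) 3)"
      using reach_init_post[OF inp a, of ?M] by simp
    fix i t
    assume i: "i < reg ?s ''n''" "reg t ''d'' = i"
      and frt: "frame (insert ''d'' (assigned (PFor ''f'' ''m'' scan_body))) (arrs (PFor ''f'' ''m'' scan_body)) ?s t"
      and I: "bfs_inv ?M a i 0 (arr t 2) (arr t 3)"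
    have inpt: "inp t" by (rule inp_frame[OF inp' frt]) auto
    have Mt: "marked t = ?M" unfolding M'[symmetric] by (rule mk) (use frame_arr[OF frt, of 1] in auto)
    have "bfs_inv ?M a i (reg t ''m'') (arr (sem (PFor ''f'' ''m'' scan_body) t) 2) (arr (sem (PFor ''f'' ''m'' scan_body) t) 3)"
    proof (rule sem_For[where I = "\<lambda>f s'. bfs_inv ?M a i f (arr s' 2) (arr s' 3)"])
      show "bfs_inv ?M a i 0 (arr (set_reg ''f'' 0 t) 2) (arr (set_reg ''f'' 0 t) 3)" using I by simp
      fix f t'
      assume f: "f < reg t ''m''" "reg t' ''f'' = f" and fr': "frame (insert ''f'' (assigned scan_body)) (arrs scan_body) t t'"
        and I': "bfs_inv ?M a i f (arr t' 2) (arr t' 3)"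
      have inpt': "inp t'" by (rule inp_frame[OF inpt fr']) auto
      have Mt': "marked t' = ?M" unfolding Mt[symmetric] by (rule mk) (use frame_arr[OF fr', of 1] in auto)
      have "bfs_inv ?M a i (Suc f) (arr (sem scan_body t') 2) (arr (sem scan_body t') 3)"
        by (rule scan_body_step) (use inpt' f inpt i frame_reg[OF fr', of "''d''"] a Mt' I' inp_def in auto)
      then show "bfs_inv ?M a i (Suc f) (arr (set_reg ''f'' (Suc f) (sem scan_body t')) 2) (arr (set_reg ''f'' (Suc f) (sem scan_body t')) 3)"
        by simp
    qed auto
    then have "bfs_inv ?M a i m (arr (sem (PFor ''f'' ''m'' scan_body) t) 2) (arr (sem (PFor ''f'' ''m'' scan_body) t) 3)"
      using inpt unfolding inp_def by simp
    from bfs_inv_next[OF this M a(2)]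
    show "bfs_inv ?M a (Suc i) 0 (arr (set_reg ''d'' (Suc i) (sem (PFor ''f'' ''m'' scan_body) t)) 2)
      (arr (set_reg ''d'' (Suc i) (sem (PFor ''f'' ''m'' scan_body) t)) 3)"
      by simp
  qed auto
  from bfs_inv_post[OF this[unfolded rn] M a(2)] show ?thesis unfolding reach_def by simp
qed

end


section \<open>Computing a tree packing\<close>

definition mark :: "bexp \<Rightarrow> prog" where
  "mark b = PFor ''f'' ''m'' (PIf b (PArr 1 (Reg ''f'') (Const 1)) (PArr 1 (Reg ''f'') (Const 0)))"

lemma mark_wf [simp]:
  "wfp (mark b)" "assigned (mark b) = {''f''}" "arrs (mark b) = {1}" "limits (mark b) = {''m''}" "flipless (mark b)"
  unfolding mark_def by auto

text \<open>Afterwards \<open>arr s 2\<close> vanishes at the target of \<open>e\<close> iff \<open>e\<close> is separated by the marked edges.\<close>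

definition sep_test :: "bexp \<Rightarrow> aexp \<Rightarrow> prog" where
  "sep_test b e = PSeq (mark b) (PSeq (PAssign ''a'' (src_exp e)) reach)"

lemma sep_test_wf [simp]:
  "wfp (sep_test b e)" "assigned (sep_test b e) = {''f'', ''a'', ''v'', ''d'', ''u'', ''w''}"
  "arrs (sep_test b e) = {1, 2, 3}" "limits (sep_test b e) = {''n'', ''m''}" "flipless (sep_test b e)"
  unfolding sep_test_def by auto

text \<open>
  Array 0 holds the colours, arrays 4 and 5 the positions and colours of the augmenting sequence.
  Register \<open>x\<close> holds its length, register \<open>z\<close> whether it has reached an uncoloured edge, and
  register \<open>y\<close> that edge.
\<close>

definition build_body :: prog where
  "build_body = PIf (BAnd (Eq (Reg ''z'') (Const 0)) (Eq (Arr 4 (Reg ''e'')) (Const 0)))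
     (PSeq (sep_test (BAnd (Eq (Arr 0 (Reg ''f'')) (Reg ''c'')) (Eq (Arr 4 (Reg ''f'')) (Const 0))) (Reg ''e''))
       (PIf (Eq (Arr 2 (tgt_exp (Reg ''e''))) (Const 0))
         (PSeq (PAssign ''x'' (Suc_exp (Reg ''x''))) (PSeq (PArr 4 (Reg ''e'') (Reg ''x''))
           (PSeq (PArr 5 (Reg ''e'') (Reg ''c''))
             (PIf (Eq (Arr 0 (Reg ''e'')) (Reg ''r'')) (PSeq (PAssign ''z'' (Const 1)) (PAssign ''y'' (Reg ''e''))) PSkip))))
         PSkip))
     PSkip"

text \<open>A pass that does not lengthen the sequence has tested all pairs of an edge and a colour
  in the same state and thereby certifies that the sequence is closed.\<close>

definition build_pass :: prog where
  "build_pass = PFor ''e'' ''m'' (PFor ''c'' ''r'' build_body)"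

definition build_init :: prog where
  "build_init = PSeq (PFor ''f'' ''m'' (PArr 4 (Reg ''f'') (Const 0)))
     (PSeq (PAssign ''x'' (Const 0)) (PAssign ''z'' (Const 0)))"

definition build :: prog where
  "build = PSeq build_init (PFor ''p'' ''m'' build_pass)"

lemma build_body_wf [simp]:
  "wfp build_body" "assigned build_body = {''f'', ''a'', ''v'', ''d'', ''u'', ''w'', ''x'', ''z'', ''y''}"
  "arrs build_body = {1, 2, 3, 4, 5}" "limits build_body = {''n'', ''m''}" "flipless build_body"
  unfolding build_body_def by auto

lemma build_pass_wf [simp]:
  "wfp build_pass" "assigned build_pass = {''f'', ''a'', ''v'', ''d'', ''u'', ''w'', ''x'', ''z'', ''y'', ''e'', ''c''}"
  "arrs build_pass = {1, 2, 3, 4, 5}" "limits build_pass = {''n'', ''m'', ''r''}" "flipless build_pass"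
  unfolding build_pass_def by auto

lemma build_init_wf [simp]:
  "wfp build_init" "assigned build_init = {''f'', ''x'', ''z''}"
  "arrs build_init = {4}" "limits build_init = {''m''}" "flipless build_init"
  unfolding build_init_def by auto

lemma build_wf [simp]:
  "wfp build" "assigned build = {''f'', ''a'', ''v'', ''d'', ''u'', ''w'', ''x'', ''z'', ''y'', ''e'', ''c'', ''p''}"
  "arrs build = {1, 2, 3, 4, 5}" "limits build = {''n'', ''m'', ''r''}" "flipless build"
  unfolding build_def by auto

context input_graph
begin

lemma inp_ends:
  assumes "inp s" "e < m"
  shows "mem s (3 + (e + e)) = fst (es ! e)" "mem s (4 + (e + e)) = snd (es ! e)"
  using assms unfolding inp_def mult_2 by blast+

lemma mark_post:
  assumes inp: "inp s" and b: "\<And>s'. frame {''f''} {1} s s' \<Longrightarrow> reg s' ''f'' < m \<Longrightarrow> bval b s' \<longleftrightarrow> reg s' ''f'' \<in> A"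
    and A: "A \<subseteq> {..<m}"
  shows "marked (sem (mark b) s) = A"
proof -
  have "\<forall>f<reg s ''m''. arr (sem (mark b) s) 1 f \<noteq> 0 \<longleftrightarrow> f \<in> A"
    unfolding mark_def
  proof (rule sem_For[where I = "\<lambda>i s. \<forall>f<i. arr s 1 f \<noteq> 0 \<longleftrightarrow> f \<in> A"])
    fix i s'
    assume "i < reg s ''m''" "reg s' ''f'' = i"
      and fr: "frame (insert ''f'' (assigned (PIf b (PArr 1 (Reg ''f'') (Const 1)) (PArr 1 (Reg ''f'') (Const 0)))))
        (arrs (PIf b (PArr 1 (Reg ''f'') (Const 1)) (PArr 1 (Reg ''f'') (Const 0)))) s s'"
      and I: "\<forall>f<i. (arr s' 1 f \<noteq> 0) = (f \<in> A)"
    then show "\<forall>f<Suc i. (arr (set_reg ''f'' (Suc i) (sem (PIf b (PArr 1 (Reg ''f'') (Const 1)) (PArr 1 (Reg ''f'') (Const 0))) s')) 1 f \<noteq> 0) = (f \<in> A)"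
      using b[of s'] inp unfolding inp_def by (auto simp: less_Suc_eq)
  qed auto
  then show ?thesis using A inp unfolding marked_def inp_def by auto
qed

lemma sep_test_post:
  assumes inp: "inp s" and b: "\<And>s'. frame {''f''} {1} s s' \<Longrightarrow> reg s' ''f'' < m \<Longrightarrow> bval b s' \<longleftrightarrow> reg s' ''f'' \<in> A"
    and A: "A \<subseteq> {..<m}" and e: "\<And>s'. frame {''f''} {1} s s' \<Longrightarrow> aval ee s' = e" "e < m"
  shows "arr (sem (sep_test b ee) s) 2 (snd (es ! e)) = 0 \<longleftrightarrow> sep A e"
proof -
  let ?s = "sem (mark b) s" and ?u = "fst (es ! e)" and ?w = "snd (es ! e)"
  have M: "marked ?s = A" by (rule mark_post[OF inp b A])
  have fr: "frame {''f''} {1} s ?s" using sem_frame[of "mark b" s] by simp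
  have inp': "inp ?s" by (rule inp_frame[OF inp fr]) auto
  let ?t = "set_reg ''a'' ?u ?s"
  have t: "sem (PAssign ''a'' (src_exp ee)) ?s = ?t"
    by (simp only: sem.simps aval.simps e(1)[OF fr] inp_ends[OF inp' e(2)])
  have inpt: "inp ?t" by (rule inp_frame[OF inp' frame_set_reg]) auto
  have "bfs_post (marked ?t) ?u (arr (sem reach ?t) 2) (arr (sem reach ?t) 3)"
    by (rule reach_post[OF inpt]) (use es_bounds e in auto)
  moreover have "marked ?t = A" using M unfolding marked_def by simp
  ultimately have "arr (sem reach ?t) 2 ?w \<noteq> 0 \<longleftrightarrow> con A ?u ?w"
    using es_bounds e(2) unfolding bfs_post_def by blast
  moreover have "sep A e \<longleftrightarrow> \<not> con A ?u ?w" by (rule sep_iff) simp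
  ultimately show ?thesis unfolding sep_test_def sem.simps(6) t by auto
qed

definition seq_inv :: "nat \<Rightarrow> ram \<Rightarrow> bool" where
  "seq_inv r s \<longleftrightarrow> (let col = arr s 0; Ord = arr s 4; Y = arr s 5; cnt = reg s ''x'' in
     forests r col \<and> valid r col Ord Y cnt \<and> (\<forall>f<m. Ord f \<le> cnt) \<and> card {f. f < m \<and> 0 < Ord f} = cnt \<and>
     (reg s ''z'' = 0 \<longrightarrow> (\<forall>f<m. 0 < Ord f \<longrightarrow> col f < r)) \<and>
     (reg s ''z'' \<noteq> 0 \<longrightarrow> reg s ''y'' < m \<and> col (reg s ''y'') = r \<and> 0 < Ord (reg s ''y'')))"

lemma seq_inv_cong:
  assumes "arr s' 0 = arr s 0" "arr s' 4 = arr s 4" "arr s' 5 = arr s 5"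
    "reg s' ''x'' = reg s ''x''" "reg s' ''z'' = reg s ''z''" "reg s' ''y'' = reg s ''y''"
  shows "seq_inv r s' \<longleftrightarrow> seq_inv r s"
  unfolding seq_inv_def using assms by simp

text \<open>The alternatives are those a pass has to distinguish: the state of the sequence is kept
  and \<open>e\<close> is found closed for \<open>c\<close>, or the sequence has grown.\<close>

lemma build_body_step:
  assumes inp: "inp s" and r: "reg s ''r'' = r" and e: "reg s ''e'' = e" "e < m" and c: "reg s ''c'' = c" "c < r"
    and I: "seq_inv r s"
  shows "seq_inv r (sem build_body s)"
    and "reg (sem build_body s) ''x'' = reg s ''x'' \<and> reg (sem build_body s) ''z'' = reg s ''z'' \<and>
           arr (sem build_body s) 4 = arr s 4 \<and>
           (reg s ''z'' = 0 \<and> arr s 4 e = 0 \<longrightarrow> \<not> sep (pre (arr s 0) (arr s 4) c (reg s ''x'')) e) \<or>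
         reg (sem build_body s) ''x'' = Suc (reg s ''x'')"
proof -
  let ?s' = "sem build_body s"
  let ?col = "arr s 0" and ?O = "arr s 4" and ?Y = "arr s 5" and ?x = "reg s ''x''"
  let ?A = "pre ?col ?O c ?x"
  have "seq_inv r ?s' \<and> (reg ?s' ''x'' = ?x \<and> reg ?s' ''z'' = reg s ''z'' \<and> arr ?s' 4 = ?O \<and>
      (reg s ''z'' = 0 \<and> ?O e = 0 \<longrightarrow> \<not> sep ?A e) \<or> reg ?s' ''x'' = Suc ?x)"
  proof (cases "reg s ''z'' = 0 \<and> ?O e = 0")
    case False
    then have "?s' = s" using e unfolding build_body_def by auto
    then show ?thesis using I False by auto
  next
    case True
    \<comment> \<open>No position exceeds \<open>x\<close>, so \<open>pre\<close> at
      \<open>x\<close> consists of the edges of colour \<open>c\<close> with position 0.\<close>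
    let ?b = "BAnd (Eq (Arr 0 (Reg ''f'')) (Reg ''c'')) (Eq (Arr 4 (Reg ''f'')) (Const 0))"
    let ?t = "sem (sep_test ?b (Reg ''e'')) s"
    have A: "?A \<subseteq> {..<m}" unfolding pre_def by auto
    have Ole: "?O f \<le> ?x" if "f < m" for f using I that unfolding seq_inv_def by (simp add: Let_def)
    have fr: "frame {''f'', ''a'', ''v'', ''d'', ''u'', ''w''} {1, 2, 3} s ?t" using sem_frame[of "sep_test ?b (Reg ''e'')" s] by simp
    have sep: "arr ?t 2 (snd (es ! e)) = 0 \<longleftrightarrow> sep ?A e"
    proof (rule sep_test_post[OF inp _ A _ e(2)])
      fix s' assume f: "frame {''f''} {1} s s'"
      then have a: "arr s' 0 = ?col" "arr s' 4 = ?O" using frame_arr by auto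
      show "aval (Reg ''e'') s' = e" using frame_reg[OF f] e by simp
      have c': "reg s' ''c'' = c" using frame_reg[OF f] c by simp
      assume "reg s' ''f'' < m"
      then show "bval ?b s' \<longleftrightarrow> reg s' ''f'' \<in> ?A" unfolding pre_def using Ole[of "reg s' ''f''"] a c' by auto
    qed
    have inpt: "inp ?t" by (rule inp_frame[OF inp fr]) auto
    have regt: "reg ?t x = reg s x" if "x \<notin> {''f'', ''a'', ''v'', ''d'', ''u'', ''w''}" for x using frame_reg[OF fr that] .
    have arrt: "arr ?t 0 = ?col" "arr ?t 4 = ?O" "arr ?t 5 = ?Y" using frame_arr[OF fr] by auto
    have It: "seq_inv r ?t" using I by (subst seq_inv_cong[of ?t s]) (auto simp: arrt regt)
    have "reg ?t ''e'' = e" using regt[of "''e''"] e by simp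
    then have tgt: "aval (tgt_exp (Reg ''e'')) ?t = snd (es ! e)" by (simp only: aval.simps inp_ends[OF inpt e(2)])
    let ?q = "PSeq (PAssign ''x'' (Suc_exp (Reg ''x''))) (PSeq (PArr 4 (Reg ''e'') (Reg ''x''))
           (PSeq (PArr 5 (Reg ''e'') (Reg ''c''))
             (PIf (Eq (Arr 0 (Reg ''e'')) (Reg ''r'')) (PSeq (PAssign ''z'' (Const 1)) (PAssign ''y'' (Reg ''e''))) PSkip)))"
    have s': "?s' = (if sep ?A e then sem ?q ?t else ?t)"
      using True e sep tgt unfolding build_body_def by simp
    show ?thesis
    proof (cases "sep ?A e")
      case False
      then show ?thesis using s' It regt arrt by simp
    next
      case sepe: True
      let ?u = "set_arr 5 e c (set_arr 4 e (Suc ?x) (set_reg ''x'' (Suc ?x) ?t))"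
      have s'2: "?s' = (if ?col e = r then set_reg ''y'' e (set_reg ''z'' 1 ?u) else ?u)"
        using s' sepe regt e c r arrt by simp
      have arr': "arr ?s' 0 = ?col" "arr ?s' 4 = ?O(e := Suc ?x)" "arr ?s' 5 = ?Y(e := c)"
        unfolding s'2 by (auto simp: fun_eq_iff arrt)
      have reg': "reg ?s' ''x'' = Suc ?x" "reg ?s' ''z'' = (if ?col e = r then 1 else 0)"
        "reg ?s' ''y'' = (if ?col e = r then e else reg s ''y'')"
        unfolding s'2 using True regt by auto
      have J: "forests r ?col" "valid r ?col ?O ?Y ?x" "card {f. f < m \<and> 0 < ?O f} = ?x" "\<forall>f<m. 0 < ?O f \<longrightarrow> ?col f < r"
        using I True unfolding seq_inv_def by (auto simp: Let_def)
      have v: "valid r ?col (?O(e := Suc ?x)) (?Y(e := c)) (Suc ?x)"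
        by (rule valid_extend[OF J(2)]) (use Ole e c True sepe in auto)
      have "{f. f < m \<and> 0 < (?O(e := Suc ?x)) f} = insert e {f. f < m \<and> 0 < ?O f}" using e by auto
      then have cd: "card {f. f < m \<and> 0 < (?O(e := Suc ?x)) f} = Suc ?x" using J(3) True by simp
      have "?col e \<le> r" using J(1) e unfolding forests_def by auto
      then have "seq_inv r ?s'" unfolding seq_inv_def arr' reg' Let_def using J(1,4) v cd Ole e
        by (auto simp: le_SucI)
      then show ?thesis using reg' by simp
    qed
  qed
  then show "seq_inv r ?s'"
    "reg ?s' ''x'' = ?x \<and> reg ?s' ''z'' = reg s ''z'' \<and> arr ?s' 4 = ?O \<and>
      (reg s ''z'' = 0 \<and> ?O e = 0 \<longrightarrow> \<not> sep ?A e) \<or> reg ?s' ''x'' = Suc ?x" by blast+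
qed

definition closed_at :: "nat \<Rightarrow> ram \<Rightarrow> nat \<Rightarrow> nat \<Rightarrow> bool" where
  "closed_at r s e c \<longleftrightarrow> (arr s 4 e = 0 \<longrightarrow> \<not> sep (pre (arr s 0) (arr s 4) c (reg s ''x'')) e)"

definition all_conn :: "nat \<Rightarrow> (nat \<Rightarrow> nat) \<Rightarrow> bool" where
  "all_conn r col \<longleftrightarrow> (\<forall>c<r. conn_on (colc col c))"

text \<open>Without growth, \<open>closed_at\<close> holds for all edges and colours at the end of
  the pass. This is the closure hypothesis of \<open>forests_stuck\<close> for the edges in the
  sequence.\<close>

lemma build_pass_post:
  assumes inp: "inp s" and r: "reg s ''r'' = r" and I: "seq_inv r s" and k: "kcut k" "2 * r \<le> k"
  shows "seq_inv r (sem build_pass s) \<and>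
    (reg (sem build_pass s) ''z'' = 0 \<longrightarrow> reg s ''x'' < reg (sem build_pass s) ''x'' \<or> all_conn r (arr s 0))"
proof -
  let ?x0 = "reg s ''x''" and ?col = "arr s 0"
  let ?J = "\<lambda>t. seq_inv r t \<and> ?x0 \<le> reg t ''x''"
  let ?C = "\<lambda>e t. reg t ''z'' = 0 \<and> reg t ''x'' = ?x0 \<longrightarrow> (\<forall>g<e. \<forall>c<r. closed_at r t g c)"
  have "?J (sem build_pass s) \<and> ?C (reg s ''m'') (sem build_pass s)"
    unfolding build_pass_def
  proof (rule sem_For[where I = "\<lambda>e t. ?J t \<and> ?C e t"])
    have "seq_inv r (set_reg ''e'' 0 s)" using I by (subst seq_inv_cong[of _ s]) auto
    then show "?J (set_reg ''e'' 0 s) \<and> ?C 0 (set_reg ''e'' 0 s)" by simp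
    fix e t
    assume e: "e < reg s ''m''" "reg t ''e'' = e"
      and fr: "frame (insert ''e'' (assigned (PFor ''c'' ''r'' build_body))) (arrs (PFor ''c'' ''r'' build_body)) s t"
      and IH: "?J t \<and> ?C e t"
    have em: "e < m" using e inp unfolding inp_def by simp
    have inpt: "inp t" by (rule inp_frame[OF inp fr]) auto
    have rt: "reg t ''r'' = r" using frame_reg[OF fr, of "''r''"] r by simp
    let ?D = "\<lambda>c t. reg t ''z'' = 0 \<and> reg t ''x'' = ?x0 \<longrightarrow> (\<forall>g<e. \<forall>c<r. closed_at r t g c) \<and> (\<forall>c'<c. closed_at r t e c')"
    let ?t = "sem (PFor ''c'' ''r'' build_body) t"
    have "?J ?t \<and> ?D (reg t ''r'') ?t"
    proof (rule sem_For[where I = "\<lambda>c t. ?J t \<and> ?D c t"])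
      have "seq_inv r (set_reg ''c'' 0 t)" using IH by (subst seq_inv_cong[of _ t]) auto
      then show "?J (set_reg ''c'' 0 t) \<and> ?D 0 (set_reg ''c'' 0 t)" using IH by (simp add: closed_at_def)
      fix c q
      assume c: "c < reg t ''r''" "reg q ''c'' = c" and frq: "frame (insert ''c'' (assigned build_body)) (arrs build_body) t q"
        and IHq: "?J q \<and> ?D c q"
      have inpq: "inp q" by (rule inp_frame[OF inpt frq]) auto
      have rq: "reg q ''r'' = r" "reg q ''e'' = e"
        using frame_reg[OF frq, of "''r''"] frame_reg[OF frq, of "''e''"] rt e by simp_all
      have cr: "c < r" using c rt by simp
      have Iq: "seq_inv r q" using IHq by blast
      note st = build_body_step[OF inpq rq em c(2) cr Iq]
      let ?q = "sem build_body q" and ?q' = "set_reg ''c'' (Suc c) (sem build_body q)"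
      have col: "arr ?q 0 = arr q 0" using sem_frame[of build_body q] frame_arr[of _ _ q ?q 0] by simp
      have cl: "closed_at r ?q' g c' \<longleftrightarrow> closed_at r ?q g c'" for g c' unfolding closed_at_def by simp
      have S: "seq_inv r ?q'" using st(1) by (subst seq_inv_cong[of _ ?q]) auto
      from st(2) show "?J ?q' \<and> ?D (Suc c) ?q'"
      proof
        assume "reg ?q ''x'' = Suc (reg q ''x'')"
        then show ?thesis using S IHq by auto
      next
        assume a: "reg ?q ''x'' = reg q ''x'' \<and> reg ?q ''z'' = reg q ''z'' \<and> arr ?q 4 = arr q 4 \<and>
          (reg q ''z'' = 0 \<and> arr q 4 e = 0 \<longrightarrow> \<not> sep (pre (arr q 0) (arr q 4) c (reg q ''x'')) e)"
        then have "closed_at r ?q g c' \<longleftrightarrow> closed_at r q g c'" for g c' unfolding closed_at_def col by simp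
        moreover have "reg q ''z'' = 0 \<longrightarrow> closed_at r q e c" using a unfolding closed_at_def by blast
        ultimately show ?thesis using S IHq a unfolding cl by (auto simp: less_Suc_eq)
      qed
    qed auto
    then have P: "?J ?t" "?D r ?t" using rt by auto
    have "seq_inv r (set_reg ''e'' (Suc e) ?t)" using P by (subst seq_inv_cong[of _ ?t]) auto
    moreover have "closed_at r (set_reg ''e'' (Suc e) ?t) g c' \<longleftrightarrow> closed_at r ?t g c'" for g c' unfolding closed_at_def by simp
    ultimately show "?J (set_reg ''e'' (Suc e) ?t) \<and> ?C (Suc e) (set_reg ''e'' (Suc e) ?t)"
      using P by (auto simp: less_Suc_eq)
  qed auto
  then have J: "?J (sem build_pass s)" "?C m (sem build_pass s)" using inp unfolding inp_def by auto
  let ?s = "sem build_pass s"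
  have col: "arr ?s 0 = ?col" using sem_frame[of build_pass s] frame_arr[of _ _ s ?s 0] by simp
  have "all_conn r ?col" if z: "reg ?s ''z'' = 0" and x: "reg ?s ''x'' = ?x0"
    unfolding all_conn_def
  proof (intro allI impI)
    fix c assume c: "c < r"
    let ?X = "{e. e < m \<and> 0 < arr ?s 4 e}"
    have F: "forests r ?col" and O: "\<And>f. f < m \<Longrightarrow> arr ?s 4 f \<le> reg ?s ''x''" and X: "\<And>f. f \<in> ?X \<Longrightarrow> ?col f < r"
      using J(1) z unfolding seq_inv_def by (auto simp: Let_def col)
    have pre: "pre ?col (arr ?s 4) c' (reg ?s ''x'') = colc ?col c' - ?X" for c'
      unfolding pre_def colc_def using O by auto
    show "conn_on (colc ?col c)"
    proof (rule forests_stuck[OF k F _ X])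
      fix e c' assume e: "e \<in> edges (graph_of n es)" "c' < r" "sep (colc ?col c' - ?X) e"
      then have "e < m" "closed_at r ?s e c'" using J(2) z x by auto
      then show "e \<in> ?X" using e(3) unfolding closed_at_def col pre by auto
    qed (use c in auto)
  qed
  then show ?thesis using J by (auto simp: order_less_le)
qed

text \<open>Each of the \<open>m\<close> passes makes progress unless an uncoloured edge has been
  found or all classes are connected. A sequence of \<open>m\<close> coloured edges contains every
  edge and is trivially closed, so \<open>forests_stuck\<close> settles this case too.\<close>

lemma build_post:
  assumes inp: "inp s" and r: "reg s ''r'' = r" and F: "forests r (arr s 0)" and k: "kcut k" "2 * r \<le> k"
  shows "seq_inv r (sem build s)" "reg (sem build s) ''z'' = 0 \<Longrightarrow> all_conn r (arr s 0)"
proof -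
  let ?p = "PFor ''f'' ''m'' (PArr 4 (Reg ''f'') (Const 0))"
  let ?s = "sem build_init s" and ?col = "arr s 0"
  have 1: "\<forall>v<reg s ''m''. arr (sem ?p s) 4 v = 0"
    by (rule sem_For[where I = "\<lambda>i s. \<forall>v<i. arr s 4 v = 0"]) (auto simp: less_Suc_eq)
  have O0: "arr ?s 4 v = 0" if "v < m" for v using 1 inp that unfolding build_init_def inp_def by simp
  have x0: "reg ?s ''x'' = 0" "reg ?s ''z'' = 0" unfolding build_init_def by auto
  have fr: "frame {''f'', ''x'', ''z''} {4} s ?s" using sem_frame[of build_init s] by simp
  have inp': "inp ?s" by (rule inp_frame[OF inp fr]) auto
  have col: "arr ?s 0 = ?col" and rs: "reg ?s ''r'' = r" using frame_arr[OF fr] frame_reg[OF fr] r by auto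
  have "valid r ?col (arr ?s 4) (arr ?s 5) 0" unfolding valid_def by (auto intro!: inj_onI simp: O0)
  moreover have "{f. f < m \<and> 0 < arr ?s 4 f} = {}" using O0 by auto
  ultimately have I0: "seq_inv r ?s" unfolding seq_inv_def Let_def col x0 using F O0 by simp
  let ?Q = "\<lambda>i t. seq_inv r t \<and> (reg t ''z'' = 0 \<longrightarrow> i \<le> reg t ''x'' \<or> all_conn r ?col)"
  have "?Q (reg ?s ''m'') (sem (PFor ''p'' ''m'' build_pass) ?s)"
  proof (rule sem_For[where I = ?Q])
    have "seq_inv r (set_reg ''p'' 0 ?s)" using I0 by (subst seq_inv_cong[of _ ?s]) auto
    then show "?Q 0 (set_reg ''p'' 0 ?s)" by simp
    fix i t
    assume "i < reg ?s ''m''" "reg t ''p'' = i" and fr': "frame (insert ''p'' (assigned build_pass)) (arrs build_pass) ?s t"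
      and IH: "?Q i t"
    have inpt: "inp t" by (rule inp_frame[OF inp' fr']) auto
    have rt: "reg t ''r'' = r" and colt: "arr t 0 = ?col" using frame_reg[OF fr'] frame_arr[OF fr'] rs col by auto
    let ?t = "sem build_pass t"
    note P = build_pass_post[OF inpt rt conjunct1[OF IH] k, unfolded colt]

    have S: "seq_inv r (set_reg ''p'' (Suc i) ?t)" using P by (subst seq_inv_cong[of _ ?t]) auto
    show "?Q (Suc i) (set_reg ''p'' (Suc i) ?t)"
    proof (cases "reg t ''z'' = 0")
      case True
      then show ?thesis using S P IH by auto
    next
      case False
      \<comment> \<open>Once an uncoloured edge has been found, the remaining passes do
        nothing.\<close>
      have "reg ?t ''z'' \<noteq> 0"
        unfolding build_pass_def
      proof (rule sem_For[where I = "\<lambda>_ t. reg t ''z'' \<noteq> 0"])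
        fix q :: ram assume "reg q ''z'' \<noteq> 0"
        then have "reg (sem (PFor ''c'' ''r'' build_body) q) ''z'' \<noteq> 0"
          by (intro sem_For[where I = "\<lambda>_ t. reg t ''z'' \<noteq> 0"]) (auto simp: build_body_def)
        then show "reg (set_reg ''e'' (Suc i) (sem (PFor ''c'' ''r'' build_body) q)) ''z'' \<noteq> 0" for i by simp
      qed (use False in auto)
      then show ?thesis using S by simp
    qed
  qed auto
  then have Q: "?Q m (sem build s)" using inp' unfolding build_def inp_def by simp
  then show "seq_inv r (sem build s)" by simp
  assume z: "reg (sem build s) ''z'' = 0"
  let ?t = "sem build s"
  have colt: "arr ?t 0 = ?col" using sem_frame[of build s] frame_arr[of _ _ s ?t 0] by simp
  show "all_conn r ?col"
  proof (rule ccontr)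
    assume n: "\<not> ?thesis"
    then have "m \<le> reg ?t ''x''" using Q z by blast
    let ?X = "{f. f < m \<and> 0 < arr ?t 4 f}"
    have cX: "card ?X = reg ?t ''x''" and X: "\<And>f. f \<in> ?X \<Longrightarrow> ?col f < r"
      using Q z unfolding seq_inv_def by (auto simp: Let_def colt)
    have "?X = {..<m}" by (rule card_seteq) (use cX \<open>m \<le> _\<close> in auto)
    then have "all_conn r ?col" unfolding all_conn_def
      using forests_stuck[OF k F, of "{..<m}"] X by auto
    then show False using n by simp
  qed
qed

end

text \<open>Register \<open>t\<close> receives the first position at which the edge in register \<open>y\<close> gets separated.\<close>

definition find_pos_body :: prog where
  "find_pos_body = PIf (Eq (Reg ''s'') (Const 0))
     (PSeq (sep_test (BAnd (Eq (Arr 0 (Reg ''f'')) (Reg ''c''))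
         (BNot (BAnd (Less (Const 0) (Arr 4 (Reg ''f''))) (BNot (Less (Reg ''h'') (Arr 4 (Reg ''f'')))))))
         (Reg ''y''))
       (PIf (Eq (Arr 2 (tgt_exp (Reg ''y''))) (Const 0))
         (PSeq (PAssign ''s'' (Const 1)) (PAssign ''t'' (Reg ''h''))) PSkip))
     PSkip"

definition find_pos :: prog where
  "find_pos = PSeq (PAssign ''s'' (Const 0)) (PFor ''h'' ''m'' find_pos_body)"

text \<open>The branches carry out \<open>unwind_0\<close> and \<open>unwind_Suc\<close>. Resetting
  \<open>z\<close> signals that no edge is waiting for a colour any more.\<close>

definition exchange :: prog where
  "exchange = PIf (Eq (Reg ''t'') (Const 0))
     (PSeq (PArr 0 (Reg ''y'') (Reg ''c'')) (PAssign ''z'' (Const 0)))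
     (PSeq (PFor ''f'' ''m'' (PIf (Eq (Arr 4 (Reg ''f'')) (Reg ''t'')) (PAssign ''g'' (Reg ''f'')) PSkip))
       (PSeq (PArr 0 (Reg ''y'') (Reg ''c'')) (PSeq (PArr 0 (Reg ''g'') (Reg ''r'')) (PAssign ''y'' (Reg ''g'')))))"

definition unwind_body :: prog where
  "unwind_body = PIf (Eq (Reg ''z'') (Const 0)) PSkip
     (PSeq (PAssign ''c'' (Arr 5 (Reg ''y''))) (PSeq find_pos exchange))"

definition augment :: prog where
  "augment = PSeq build (PFor ''q'' ''m'' unwind_body)"

text \<open>The \<open>r\<close> forests have at most \<open>r * (n - 1)\<close> edges altogether,
  so \<open>r * n\<close> augmentations are enough.\<close>

definition fallback :: prog where
  "fallback = PSeq (PFor ''f'' ''m'' (PArr 0 (Reg ''f'') (Reg ''r'')))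
     (PFor ''i'' ''r'' (PFor ''o'' ''n'' augment))"

lemma find_pos_body_wf [simp]:
  "wfp find_pos_body" "assigned find_pos_body = {''f'', ''a'', ''v'', ''d'', ''u'', ''w'', ''s'', ''t''}"
  "arrs find_pos_body = {1, 2, 3}" "limits find_pos_body = {''n'', ''m''}" "flipless find_pos_body"
  unfolding find_pos_body_def by auto

lemma find_pos_wf [simp]:
  "wfp find_pos" "assigned find_pos = {''f'', ''a'', ''v'', ''d'', ''u'', ''w'', ''s'', ''t'', ''h''}"
  "arrs find_pos = {1, 2, 3}" "limits find_pos = {''n'', ''m''}" "flipless find_pos"
  unfolding find_pos_def by auto

lemma exchange_wf [simp]:
  "wfp exchange" "assigned exchange = {''f'', ''g'', ''y'', ''z''}"
  "arrs exchange = {0}" "limits exchange = {''m''}" "flipless exchange"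
  unfolding exchange_def by auto

lemma unwind_body_wf [simp]:
  "wfp unwind_body"
  "assigned unwind_body = {''f'', ''a'', ''v'', ''d'', ''u'', ''w'', ''s'', ''t'', ''h'', ''g'', ''y'', ''z'', ''c''}"
  "arrs unwind_body = {0, 1, 2, 3}" "limits unwind_body = {''n'', ''m''}" "flipless unwind_body"
  unfolding unwind_body_def by auto

lemma augment_wf [simp]:
  "wfp augment"
  "assigned augment = {''f'', ''a'', ''v'', ''d'', ''u'', ''w'', ''s'', ''t'', ''h'', ''g'', ''y'', ''z'', ''c'', ''x'', ''e'', ''p'', ''q''}"
  "arrs augment = {0, 1, 2, 3, 4, 5}" "limits augment = {''n'', ''m'', ''r''}" "flipless augment"
  unfolding augment_def by auto

lemma fallback_wf [simp]:
  "wfp fallback"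
  "assigned fallback = {''f'', ''a'', ''v'', ''d'', ''u'', ''w'', ''s'', ''t'', ''h'', ''g'', ''y'', ''z'', ''c'', ''x'', ''e'', ''p'', ''q'', ''i'', ''o''}"
  "arrs fallback = {0, 1, 2, 3, 4, 5}" "limits fallback = {''n'', ''m'', ''r''}" "flipless fallback"
  unfolding fallback_def by auto

lemma (in multigraph_on) ncomp_pos: "V \<noteq> {} \<Longrightarrow> 1 \<le> ncomp A"
  unfolding ncomp_def using finite_V by (simp add: Suc_leI card_gt_0_iff)

lemma (in multigraph_on) coloured_eq_sum: "coloured r col = (\<Sum>c<r. card (colc col c))"
proof -
  have "{e \<in> E. col e < r} = (\<Union>c<r. colc col c)" unfolding colc_def by auto
  moreover have "card (\<Union>c<r. colc col c) = (\<Sum>c<r. card (colc col c))"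
    by (rule card_UN_disjoint) (use finite_E in \<open>auto simp: colc_def\<close>)
  ultimately show ?thesis unfolding coloured_def by simp
qed

context input_graph
begin

lemma find_pos_post:
  assumes inp: "inp s" and y: "reg s ''y'' = y" "y < m" and c: "reg s ''c'' = c"
    and h0: "sep (pre (arr s 0) (arr s 4) c h0) y" "h0 < m"
  shows "sep (pre (arr s 0) (arr s 4) c (reg (sem find_pos s) ''t'')) y \<and>
    (\<forall>h < reg (sem find_pos s) ''t''. \<not> sep (pre (arr s 0) (arr s 4) c h) y)"
proof -
  let ?P = "\<lambda>h. sep (pre (arr s 0) (arr s 4) c h) y"
  let ?s = "set_reg ''s'' 0 s"
  let ?I = "\<lambda>i q. (reg q ''s'' = 0 \<longrightarrow> (\<forall>h<i. \<not> ?P h)) \<and>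
    (reg q ''s'' \<noteq> 0 \<longrightarrow> ?P (reg q ''t'') \<and> (\<forall>h < reg q ''t''. \<not> ?P h))"
  have inps: "inp ?s" by (rule inp_frame[OF inp frame_set_reg]) auto
  have "?I (reg ?s ''m'') (sem (PFor ''h'' ''m'' find_pos_body) ?s)"
  proof (rule sem_For[where I = ?I])
    show "?I 0 (set_reg ''h'' 0 ?s)" by simp
    fix i q
    assume i: "i < reg ?s ''m''" "reg q ''h'' = i"
      and fr: "frame (insert ''h'' (assigned find_pos_body)) (arrs find_pos_body) ?s q" and IH: "?I i q"
    have inpq: "inp q" by (rule inp_frame[OF inps fr]) auto
    have rq: "reg q ''c'' = c" "reg q ''y'' = y" and aq: "arr q 0 = arr s 0" "arr q 4 = arr s 4"
      using frame_reg[OF fr, of "''c''"] frame_reg[OF fr, of "''y''"] frame_arr[OF fr] c y by auto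
    show "?I (Suc i) (set_reg ''h'' (Suc i) (sem find_pos_body q))"
    proof (cases "reg q ''s'' = 0")
      case False
      then show ?thesis using IH unfolding find_pos_body_def by simp
    next
      case True
      let ?b = "BAnd (Eq (Arr 0 (Reg ''f'')) (Reg ''c''))
         (BNot (BAnd (Less (Const 0) (Arr 4 (Reg ''f''))) (BNot (Less (Reg ''h'') (Arr 4 (Reg ''f''))))))"
      let ?t = "sem (sep_test ?b (Reg ''y'')) q"
      have frt: "frame {''f'', ''a'', ''v'', ''d'', ''u'', ''w''} {1, 2, 3} q ?t" using sem_frame[of "sep_test ?b (Reg ''y'')" q] by simp
      have sep: "arr ?t 2 (snd (es ! y)) = 0 \<longleftrightarrow> ?P i"
      proof (rule sep_test_post[OF inpq _ _ _ y(2)])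
        fix s' assume f: "frame {''f''} {1} q s'"
        then have a: "arr s' 0 = arr s 0" "arr s' 4 = arr s 4" using frame_arr[OF f] aq by auto
        have r': "reg s' ''c'' = c" "reg s' ''h'' = i" using frame_reg[OF f] rq i by auto
        show "aval (Reg ''y'') s' = y" using frame_reg[OF f] rq by simp
        assume "reg s' ''f'' < m"
        then show "bval ?b s' \<longleftrightarrow> reg s' ''f'' \<in> pre (arr s 0) (arr s 4) c i" unfolding pre_def using a r' by auto
      qed (unfold pre_def, auto)
      have inpt: "inp ?t" by (rule inp_frame[OF inpq frt]) auto
      have rt: "reg ?t ''y'' = y" "reg ?t ''h'' = i" "reg ?t ''s'' = 0" using frame_reg[OF frt] rq i True by auto
      then have tgt: "aval (tgt_exp (Reg ''y'')) ?t = snd (es ! y)" by (simp only: aval.simps inp_ends[OF inpt y(2)])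
      have b: "sem find_pos_body q = (if ?P i then set_reg ''t'' i (set_reg ''s'' 1 ?t) else ?t)"
        unfolding find_pos_body_def using True sep tgt rt(2) by simp
      show ?thesis using True IH rt unfolding b by (auto simp: less_Suc_eq)
    qed
  qed auto
  then have "?I m (sem find_pos s)" using inps unfolding find_pos_def inp_def by simp
  then show ?thesis using h0 by blast
qed

text \<open>\<open>N\<close> is the number of coloured edges before the augmentation and
  \<open>q\<close> counts the rounds. Each exchange moves \<open>y\<close> to an earlier position,
  so \<open>Ord y + q\<close> does not increase, and after \<open>m\<close> rounds no position is
  left for a waiting edge.\<close>

definition unwind_inv :: "nat \<Rightarrow> nat \<Rightarrow> nat \<Rightarrow> ram \<Rightarrow> bool" where
  "unwind_inv r N q s \<longleftrightarrow> (let col = arr s 0; Ord = arr s 4; Y = arr s 5; y = reg s ''y'' in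
     forests r col \<and> (reg s ''z'' = 0 \<longrightarrow> coloured r col = Suc N) \<and>
     (reg s ''z'' \<noteq> 0 \<longrightarrow> coloured r col = N \<and> y < m \<and> col y = r \<and> 0 < Ord y \<and> valid r col Ord Y (Ord y) \<and> Ord y + q \<le> m))"

lemma unwind_body_step:
  assumes inp: "inp s" and r: "reg s ''r'' = r" and I: "unwind_inv r N q s"
  shows "unwind_inv r N (Suc q) (sem unwind_body s)"
proof (cases "reg s ''z'' = 0")
  case True
  then show ?thesis using I unfolding unwind_body_def unwind_inv_def by simp
next
  case False
  let ?col = "arr s 0" and ?O = "arr s 4" and ?Y = "arr s 5" and ?y = "reg s ''y''"
  let ?c = "?Y ?y"
  have J: "forests r ?col" "coloured r ?col = N" "?y < m" "?col ?y = r" "0 < ?O ?y" "valid r ?col ?O ?Y (?O ?y)" "?O ?y + q \<le> m"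
    using I False unfolding unwind_inv_def by (auto simp: Let_def)
  let ?P = "\<lambda>h. sep (pre ?col ?O ?c h) ?y"
  have P0: "?P (?O ?y - 1)" "?c < r" using J unfolding valid_def by auto
  let ?s = "set_reg ''c'' ?c s"
  have inps: "inp ?s" by (rule inp_frame[OF inp frame_set_reg]) auto
  let ?t = "sem find_pos ?s"
  define h where "h = reg ?t ''t''"
  have h: "?P h" "\<forall>h'<h. \<not> ?P h'"
    using find_pos_post[OF inps _ J(3), of ?c "?O ?y - 1"] P0 J unfolding h_def by auto
  have hO: "h < ?O ?y"
  proof (rule ccontr)
    assume "\<not> ?thesis"
    then have "?O ?y - 1 < h" using J(5) by simp
    then show False using h(2) P0(1) by blast
  qed
  have frt: "frame {''f'', ''a'', ''v'', ''d'', ''u'', ''w'', ''s'', ''t'', ''h''} {1, 2, 3} ?s ?t" using sem_frame[of find_pos ?s] by simp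
  have at: "arr ?t 0 = ?col" "arr ?t 4 = ?O" "arr ?t 5 = ?Y" using frame_arr[OF frt] by auto
  have rt: "reg ?t ''y'' = ?y" "reg ?t ''c'' = ?c" "reg ?t ''r'' = r" "reg ?t ''z'' = reg s ''z''"
    using frame_reg[OF frt] r by auto
  have inpt: "inp ?t" by (rule inp_frame[OF inps frt]) auto
  have s': "sem unwind_body s = sem exchange ?t" using False unfolding unwind_body_def by simp
  show ?thesis
  proof (cases "h = 0")
    case True
    have e: "sem exchange ?t = set_reg ''z'' 0 (set_arr 0 ?y ?c ?t)" unfolding exchange_def using True rt h_def by simp
    have "arr (sem exchange ?t) 0 = ?col(?y := ?c)" unfolding e by (auto simp: fun_eq_iff at)
    then show ?thesis using unwind_0[OF J(1) _ J(4) P0(2)] h(1) True J e unfolding s' unwind_inv_def by simp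
  next
    case False
    then obtain h' where h': "h = Suc h'" by (cases h) auto
    have ns: "\<not> ?P h'" using h h' by simp
    obtain f where f: "f < m" "?O f = Suc h'" using sep_drop_ex[OF ns] h h' by auto
    have uniq: "g = f" if "g < m" "?O g = h" for g
      using J(6) that f h' unfolding valid_def inj_on_def by auto
    let ?l = "PFor ''f'' ''m'' (PIf (Eq (Arr 4 (Reg ''f'')) (Reg ''t'')) (PAssign ''g'' (Reg ''f'')) PSkip)"
    define u where "u = sem ?l ?t"
    have "(\<exists>i < reg ?t ''m''. ?O i = h) \<longrightarrow> reg u ''g'' < m \<and> ?O (reg u ''g'') = h"
      unfolding u_def
    proof (rule sem_For[where I = "\<lambda>i q. (\<exists>i'<i. ?O i' = h) \<longrightarrow> reg q ''g'' < m \<and> ?O (reg q ''g'') = h"])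
      fix i q
      assume i: "i < reg ?t ''m''" "reg q ''f'' = i"
        and fr: "frame (insert ''f'' (assigned (PIf (Eq (Arr 4 (Reg ''f'')) (Reg ''t'')) (PAssign ''g'' (Reg ''f'')) PSkip)))
          (arrs (PIf (Eq (Arr 4 (Reg ''f'')) (Reg ''t'')) (PAssign ''g'' (Reg ''f'')) PSkip)) ?t q"
        and IH: "(\<exists>i'<i. ?O i' = h) \<longrightarrow> reg q ''g'' < m \<and> ?O (reg q ''g'') = h"
      have a: "arr q 4 = ?O" "reg q ''t'' = h" using frame_arr[OF fr, of 4] frame_reg[OF fr, of "''t''"] at h_def by auto
      have "i < m" using i inpt unfolding inp_def by simp
      then show "(\<exists>i'<Suc i. ?O i' = h) \<longrightarrow> reg (set_reg ''f'' (Suc i)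
          (sem (PIf (Eq (Arr 4 (Reg ''f'')) (Reg ''t'')) (PAssign ''g'' (Reg ''f'')) PSkip) q)) ''g'' < m \<and>
        ?O (reg (set_reg ''f'' (Suc i) (sem (PIf (Eq (Arr 4 (Reg ''f'')) (Reg ''t'')) (PAssign ''g'' (Reg ''f'')) PSkip) q)) ''g'') = h"
        using IH a i by (auto simp: less_Suc_eq)
    qed auto
    moreover have "f < reg ?t ''m''" "?O f = h" using f h' inpt unfolding inp_def by auto
    ultimately have "reg u ''g'' < m" "?O (reg u ''g'') = h" by blast+
    then have g: "reg u ''g'' = f" by (rule uniq)
    have fru: "frame {''f'', ''g''} {} ?t u" unfolding u_def using sem_frame[of ?l ?t] by simp
    have au: "arr u 0 = ?col" "arr u 4 = ?O" "arr u 5 = ?Y" using frame_arr[OF fru] at by auto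
    have ru: "reg u ''y'' = ?y" "reg u ''c'' = ?c" "reg u ''r'' = r" "reg u ''z'' = reg s ''z''"
      using frame_reg[OF fru] rt by auto
    have e: "sem exchange ?t = set_reg ''y'' f (set_arr 0 f r (set_arr 0 ?y ?c u))"
      unfolding exchange_def using False h_def ru g by (simp add: u_def)
    have a': "arr (sem exchange ?t) 0 = ?col(?y := ?c, f := r)" "arr (sem exchange ?t) 4 = ?O" "arr (sem exchange ?t) 5 = ?Y"
      unfolding e by (auto simp: fun_eq_iff au)
    have r': "reg (sem exchange ?t) ''y'' = f" "reg (sem exchange ?t) ''z'' = reg s ''z''" unfolding e using ru by auto
    have hs: "Suc h' < ?O ?y" using hO h' by simp
    note * = unwind_Suc[OF J(1) J(6) _ J(4) J(5) hs ns h(1)[unfolded h'] _ f(2)]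
    show ?thesis using * J f hs \<open>reg s ''z'' \<noteq> 0\<close> unfolding s' unwind_inv_def a' r' Let_def by auto
  qed
qed

text \<open>A forest with \<open>n\<close> vertices has \<open>n\<close> minus its number of
  components as its number of edges: at most \<open>n - 1\<close>, with equality exactly if it is
  connected.\<close>

lemma coloured_le: "0 < n \<Longrightarrow> forests r col \<Longrightarrow> coloured r col \<le> r * (n - 1)"
  and coloured_all_conn: "0 < n \<Longrightarrow> forests r col \<Longrightarrow> coloured r col = r * (n - 1) \<longleftrightarrow> all_conn r col"
proof -
  assume n: "0 < n" and F: "forests r col"
  have pos: "1 \<le> ncomp (colc col c)" for c
    by (rule ncomp_pos) (use n in auto)
  have eq: "card (colc col c) + ncomp (colc col c) = n" if "c < r" for c
  proof -
    have "ncomp (colc col c) + card (colc col c) = card (vertices (graph_of n es))"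
      using F that unfolding forests_def by blast
    then show ?thesis by simp
  qed
  have le: "card (colc col c) \<le> n - 1" if "c < r" for c using eq[OF that] pos[of c] by simp
  have sum: "coloured r col = (\<Sum>c<r. card (colc col c))" by (rule coloured_eq_sum)
  show "coloured r col \<le> r * (n - 1)" unfolding sum using sum_mono[of "{..<r}" "\<lambda>c. card (colc col c)" "\<lambda>_. n - 1"] le by simp
  have conn: "conn_on (colc col c) \<longleftrightarrow> card (colc col c) = n - 1" if "c < r" for c
    using ncomp_le_1_iff[of "colc col c"] eq[OF that] pos[of c] by linarith
  show "coloured r col = r * (n - 1) \<longleftrightarrow> all_conn r col"
  proof
    assume "all_conn r col"
    then show "coloured r col = r * (n - 1)" unfolding sum all_conn_def using conn by simp
  next
    assume c: "coloured r col = r * (n - 1)"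
    show "all_conn r col" unfolding all_conn_def
    proof (intro allI impI)
      fix c assume "c < r"
      show "conn_on (colc col c)"
      proof (rule ccontr)
        assume "\<not> ?thesis"
        then have "card (colc col c) < n - 1" using conn[OF \<open>c < r\<close>] le[OF \<open>c < r\<close>] by simp
        then have "(\<Sum>c<r. card (colc col c)) < (\<Sum>c<r. n - 1)"
          by (intro sum_strict_mono_ex1) (use le \<open>c < r\<close> in auto)
        then show False using c unfolding sum by simp
      qed
    qed
  qed
qed

text \<open>The minimum covers both outcomes: one more edge is coloured, or all classes are
  connected and the number is already maximal.\<close>

lemma augment_post:
  assumes inp: "inp s" and r: "reg s ''r'' = r" and F: "forests r (arr s 0)" and k: "kcut k" "2 * r \<le> k" and n: "0 < n"
  shows "forests r (arr (sem augment s) 0) \<and>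
    min (Suc (coloured r (arr s 0))) (r * (n - 1)) \<le> coloured r (arr (sem augment s) 0)"
proof -
  let ?s = "sem build s" and ?N = "coloured r (arr s 0)"
  have fr: "frame {''f'', ''a'', ''v'', ''d'', ''u'', ''w'', ''x'', ''z'', ''y'', ''e'', ''c'', ''p''} {1, 2, 3, 4, 5} s ?s"
    using sem_frame[of build s] by simp
  have col: "arr ?s 0 = arr s 0" and rs: "reg ?s ''r'' = r" using frame_arr[OF fr] frame_reg[OF fr] r by auto
  have inps: "inp ?s" by (rule inp_frame[OF inp fr]) auto
  have B: "seq_inv r ?s" using build_post[OF inp r F k] by blast
  show ?thesis
  proof (cases "reg ?s ''z'' = 0")
    case True
    then have "all_conn r (arr s 0)" using build_post[OF inp r F k] by blast
    then have N: "?N = r * (n - 1)" using coloured_all_conn[OF n F] by simp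
    have "arr (sem (PFor ''q'' ''m'' unwind_body) ?s) 0 = arr s 0 \<and> reg (sem (PFor ''q'' ''m'' unwind_body) ?s) ''z'' = 0"
      by (rule sem_For[where I = "\<lambda>_ t. arr t 0 = arr s 0 \<and> reg t ''z'' = 0"])
        (auto simp: True col unwind_body_def find_pos_def exchange_def)
    then show ?thesis using F N unfolding augment_def by simp
  next
    case False
    have "unwind_inv r ?N (reg ?s ''m'') (sem (PFor ''q'' ''m'' unwind_body) ?s)"
    proof (rule sem_For[where I = "unwind_inv r ?N"])
      let ?O = "arr ?s 4"
      have "card {f. f < m \<and> 0 < ?O f} \<le> card {..<m}" by (rule card_mono) auto
      then have "reg ?s ''x'' \<le> m" using B unfolding seq_inv_def by (simp add: Let_def)
      then show "unwind_inv r ?N 0 (set_reg ''q'' 0 ?s)"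
        using B False valid_le unfolding unwind_inv_def seq_inv_def by (auto simp: Let_def col intro: order_trans)
      fix i t
      assume "i < reg ?s ''m''" "reg t ''q'' = i" and fr': "frame (insert ''q'' (assigned unwind_body)) (arrs unwind_body) ?s t"
        and I: "unwind_inv r ?N i t"
      have inpt: "inp t" by (rule inp_frame[OF inps fr']) auto
      have rt: "reg t ''r'' = r" using frame_reg[OF fr'] rs by auto
      show "unwind_inv r ?N (Suc i) (set_reg ''q'' (Suc i) (sem unwind_body t))"
        using unwind_body_step[OF inpt rt I] unfolding unwind_inv_def by simp
    qed auto
    then have U: "unwind_inv r ?N m (sem augment s)" using inps unfolding augment_def inp_def by simp
    then have "reg (sem augment s) ''z'' = 0" unfolding unwind_inv_def by (auto simp: Let_def)
    then show ?thesis using U unfolding unwind_inv_def by (simp add: Let_def)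
  qed
qed

lemma fallback_post:
  assumes inp: "inp s" and r: "reg s ''r'' = r" and k: "kcut k" "2 * r \<le> k" and n: "0 < n"
  shows "all_conn r (arr (sem fallback s) 0) \<and> (\<forall>e<m. arr (sem fallback s) 0 e \<le> r)"
proof -
  let ?p = "PFor ''f'' ''m'' (PArr 0 (Reg ''f'') (Reg ''r''))"
  let ?s = "sem ?p s"
  have fr: "frame {''f''} {0} s ?s" using sem_frame[of ?p s] by simp
  have inps: "inp ?s" by (rule inp_frame[OF inp fr]) auto
  have rs: "reg ?s ''r'' = r" using frame_reg[OF fr] r by simp
  have "reg ?s ''r'' = r \<and> (\<forall>f<reg s ''m''. arr ?s 0 f = r)"
    by (rule sem_For[where I = "\<lambda>i s. reg s ''r'' = r \<and> (\<forall>f<i. arr s 0 f = r)"]) (use r in \<open>auto simp: less_Suc_eq\<close>)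
  then have "arr ?s 0 f = r" if "f < m" for f using that inp unfolding inp_def by simp
  then have "colc (arr ?s 0) c = colc (\<lambda>_. r) c" "(\<forall>e<m. arr ?s 0 e \<le> r)" for c unfolding colc_def by auto
  then have F0: "forests r (arr ?s 0)" using forests_init[of r] unfolding forests_def by simp
  let ?Q = "\<lambda>i t. forests r (arr t 0) \<and> min i (r * (n - 1)) \<le> coloured r (arr t 0)"
  have "?Q (reg ?s ''r'' * n) (sem (PFor ''i'' ''r'' (PFor ''o'' ''n'' augment)) ?s)"
  proof (rule sem_For[where I = "\<lambda>i. ?Q (i * n)"])
    show "?Q (0 * n) (set_reg ''i'' 0 ?s)" using F0 by simp
    fix i t
    assume "i < reg ?s ''r''" "reg t ''i'' = i"
      and fr': "frame (insert ''i'' (assigned (PFor ''o'' ''n'' augment))) (arrs (PFor ''o'' ''n'' augment)) ?s t"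
      and IH: "?Q (i * n) t"
    have inpt: "inp t" by (rule inp_frame[OF inps fr']) auto
    have rt: "reg t ''r'' = r" using frame_reg[OF fr', of "''r''"] rs by simp
    have "?Q (i * n + reg t ''n'') (sem (PFor ''o'' ''n'' augment) t)"
    proof (rule sem_For[where I = "\<lambda>j. ?Q (i * n + j)"])
      show "?Q (i * n + 0) (set_reg ''o'' 0 t)" using IH by simp
      fix j q
      assume "j < reg t ''n''" "reg q ''o'' = j" and frq: "frame (insert ''o'' (assigned augment)) (arrs augment) t q"
        and IHq: "?Q (i * n + j) q"
      have inpq: "inp q" by (rule inp_frame[OF inpt frq]) auto
      have rq: "reg q ''r'' = r" using frame_reg[OF frq, of "''r''"] rt by simp
      show "?Q (i * n + Suc j) (set_reg ''o'' (Suc j) (sem augment q))"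
        using augment_post[OF inpq rq conjunct1[OF IHq] k n] IHq by auto
    qed auto
    then show "?Q (Suc i * n) (set_reg ''i'' (Suc i) (sem (PFor ''o'' ''n'' augment) t))"
      using inpt unfolding inp_def by (simp add: add.commute)
  qed auto
  then have Q: "?Q (r * n) (sem fallback s)" using rs unfolding fallback_def by simp
  have "min (r * n) (r * (n - 1)) = r * (n - 1)" by (intro min_absorb2 mult_le_mono2) simp
  then have "coloured r (arr (sem fallback s) 0) = r * (n - 1)"
    using Q coloured_le[OF n conjunct1[OF Q]] by linarith
  then show ?thesis using coloured_all_conn[OF n conjunct1[OF Q]] Q unfolding forests_def by auto
qed

end


section \<open>Extraction and output of the trees\<close>

definition class_bfs :: prog where
  "class_bfs = PSeq (mark (Eq (Arr 0 (Reg ''f'')) (Reg ''c''))) (PSeq (PAssign ''a'' (Const 0)) reach)"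

lemma class_bfs_wf [simp]:
  "wfp class_bfs" "assigned class_bfs = {''f'', ''a'', ''v'', ''d'', ''u'', ''w''}"
  "arrs class_bfs = {1, 2, 3}" "limits class_bfs = {''n'', ''m''}" "flipless class_bfs"
  unfolding class_bfs_def by auto

definition test_all :: prog where
  "test_all = PSeq (PAssign ''b'' (Const 1)) (PFor ''c'' ''r'' (PSeq class_bfs
     (PFor ''v'' ''n'' (PIf (Eq (Arr 2 (Reg ''v'')) (Const 0)) (PAssign ''b'' (Const 0)) PSkip))))"

lemma test_all_wf [simp]:
  "wfp test_all" "assigned test_all = {''f'', ''a'', ''v'', ''d'', ''u'', ''w'', ''b'', ''c''}"
  "arrs test_all = {1, 2, 3}" "limits test_all = {''n'', ''m'', ''r''}" "flipless test_all"
  unfolding test_all_def by auto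

text \<open>Array 6 receives the index of the tree of an edge plus one, or 0.\<close>

definition extract_trees :: prog where
  "extract_trees = PSeq (PFor ''f'' ''m'' (PArr 6 (Reg ''f'') (Const 0)))
     (PFor ''c'' ''r'' (PSeq class_bfs
       (PFor ''e'' ''m'' (PIf (Eq (Arr 3 (Reg ''e'')) (Const 0)) PSkip
          (PArr 6 (Reg ''e'') (Suc_exp (Reg ''c'')))))))"

lemma extract_trees_wf [simp]:
  "wfp extract_trees" "assigned extract_trees = {''f'', ''a'', ''v'', ''d'', ''u'', ''w'', ''c'', ''e''}"
  "arrs extract_trees = {1, 2, 3, 6}" "limits extract_trees = {''n'', ''m'', ''r''}" "flipless extract_trees"
  unfolding extract_trees_def by auto

definition output_item :: prog where
  "output_item = PIf (Eq (Arr 6 (Reg ''e'')) (Suc_exp (Reg ''c'')))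
     (PSeq (PStore (Reg ''l'') (Reg ''e'')) (PAssign ''l'' (Suc_exp (Reg ''l'')))) PSkip"

text \<open>The cell for the length precedes the entries, so its address is kept in \<open>h\<close>
  and the cell is filled at the end.\<close>

definition output_block :: prog where
  "output_block = PSeq (PAssign ''h'' (Reg ''l'')) (PSeq (PAssign ''l'' (Suc_exp (Reg ''l'')))
     (PSeq (PFor ''e'' ''m'' output_item)
       (PStore (Reg ''h'') (Sub (Reg ''l'') (Suc_exp (Reg ''h''))))))"

definition write_out :: prog where
  "write_out = PSeq (PStore (Const 0) (Reg ''r'')) (PSeq (PAssign ''l'' (Const 1)) (PFor ''c'' ''r'' output_block))"

lemma output_item_wf [simp]:
  "wfp output_item" "assigned output_item = {''l''}" "limits output_item = {}" "flipless output_item"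
  unfolding output_item_def by auto

lemma output_block_wf [simp]:
  "wfp output_block" "assigned output_block = {''h'', ''l'', ''e''}" "limits output_block = {''m''}" "flipless output_block"
  unfolding output_block_def by auto

lemma write_out_wf [simp]:
  "wfp write_out" "assigned write_out = {''h'', ''l'', ''e'', ''c''}" "limits write_out = {''m'', ''r''}" "flipless write_out"
  unfolding write_out_def by auto

definition block_enc :: "nat list list \<Rightarrow> nat list" where
  "block_enc Ls = concat (map (\<lambda>L. length L # L) Ls)"

lemma block_enc_snoc: "block_enc (Ls @ [L]) = block_enc Ls @ length L # L"
  unfolding block_enc_def by simp

lemma read_blocks_enc:
  "map f [a..<a + length (block_enc Ls)] = block_enc Ls \<Longrightarrow> read_blocks f (length Ls) a = Ls"
proof (induction Ls arbitrary: a)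
  case (Cons L Ls)
  let ?b = "Suc a + length L"
  have len: "a + length (block_enc (L # Ls)) = ?b + length (block_enc Ls)" unfolding block_enc_def by simp
  have "[a..<?b + length (block_enc Ls)] = a # [Suc a..<?b] @ [?b..<?b + length (block_enc Ls)]"
    using upt_add_eq_append[of "Suc a" ?b "length (block_enc Ls)"] by (simp add: upt_conv_Cons del: upt_Suc)
  then have "f a # map f [Suc a..<?b] @ map f [?b..<?b + length (block_enc Ls)] = length L # L @ block_enc Ls"
    using Cons.prems unfolding len by (simp add: block_enc_def del: upt_Suc)
  then have fa: "f a = length L" and "map f [Suc a..<?b] @ map f [?b..<?b + length (block_enc Ls)] = L @ block_enc Ls"
    by simp_all
  then have "map f [Suc a..<?b] = L" "map f [?b..<?b + length (block_enc Ls)] = block_enc Ls"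
    using append_eq_append_conv[of "map f [Suc a..<?b]" L] by (simp_all del: upt_Suc)
  then show ?case using Cons.IH[of ?b] fa by (simp del: upt_Suc)
qed simp

text \<open>An element belongs to at most one of the classes. This limits the size of the output,
  which must not run into the arrays.\<close>

lemma sum_filter_le: "(\<Sum>c<k. length (filter (\<lambda>e. f e = Suc c) xs)) \<le> length xs"
proof (induction xs)
  case (Cons x xs)
  have "(\<Sum>c<k. if f x = Suc c then 1 else 0) \<le> (1::nat)"
    by (cases "f x") (auto simp: sum.delta')
  moreover have "(\<Sum>c<k. length (filter (\<lambda>e. f e = Suc c) (x # xs))) =
    (\<Sum>c<k. if f x = Suc c then 1 else 0) + (\<Sum>c<k. length (filter (\<lambda>e. f e = Suc c) xs))"
    unfolding sum.distrib[symmetric] by (rule sum.cong) auto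
  ultimately show ?case using Cons by simp
qed simp

lemma length_block_enc: "length (block_enc Ls) = (\<Sum>L\<leftarrow>Ls. Suc (length L))"
  unfolding block_enc_def by (induction Ls) auto

context input_graph
begin

lemma class_bfs_post:
  assumes inp: "inp s" and c: "reg s ''c'' = c" and n: "0 < n"
  shows "bfs_post (colc (arr s 0) c) 0 (arr (sem class_bfs s) 2) (arr (sem class_bfs s) 3)"
proof -
  let ?b = "Eq (Arr 0 (Reg ''f'')) (Reg ''c'')"
  let ?s = "sem (mark ?b) s"
  have M: "marked ?s = colc (arr s 0) c"
  proof (rule mark_post[OF inp])
    fix s' assume f: "frame {''f''} {1} s s'" and m: "reg s' ''f'' < m"
    have "arr s' 0 = arr s 0" "reg s' ''c'' = c" using frame_arr[OF f] frame_reg[OF f] c by auto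
    then show "bval ?b s' \<longleftrightarrow> reg s' ''f'' \<in> colc (arr s 0) c" unfolding colc_def using m by auto
  qed (unfold colc_def, auto)
  have fr: "frame {''f''} {1} s ?s" using sem_frame[of "mark ?b" s] by simp
  have inps: "inp ?s" by (rule inp_frame[OF inp fr]) auto
  let ?t = "set_reg ''a'' 0 ?s"
  have inpt: "inp ?t" by (rule inp_frame[OF inps frame_set_reg]) auto
  have Mt: "marked ?t = colc (arr s 0) c" using M unfolding marked_def by simp
  have "sem class_bfs s = sem reach ?t" unfolding class_bfs_def by simp
  then show ?thesis using reach_post[OF inpt _ n] Mt by simp
qed

lemma conn_on_iff_root:
  assumes "0 < n"
  shows "conn_on A \<longleftrightarrow> (\<forall>v<n. con A 0 v)"
proof
  assume "conn_on A"
  then show "\<forall>v<n. con A 0 v" using assms unfolding conn_on_def by auto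
next
  assume *: "\<forall>v<n. con A 0 v"
  have "con A u v" if "u < n" "v < n" for u v
    using con_trans[OF con_sym[of A 0 u], of v] * that by simp
  then show "conn_on A" unfolding conn_on_def by auto
qed

lemma test_all_post:
  assumes inp: "inp s" and r: "reg s ''r'' = r" and n: "0 < n"
  shows "reg (sem test_all s) ''b'' \<noteq> 0 \<longleftrightarrow> all_conn r (arr s 0)"
proof -
  let ?s = "set_reg ''b'' 1 s"
  let ?l = "PFor ''v'' ''n'' (PIf (Eq (Arr 2 (Reg ''v'')) (Const 0)) (PAssign ''b'' (Const 0)) PSkip)"
  have inps: "inp ?s" by (rule inp_frame[OF inp frame_set_reg]) auto
  let ?I = "\<lambda>i q. reg q ''b'' \<noteq> 0 \<longleftrightarrow> (\<forall>c<i. conn_on (colc (arr s 0) c))"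
  have "?I (reg ?s ''r'') (sem (PFor ''c'' ''r'' (PSeq class_bfs ?l)) ?s)"
  proof (rule sem_For[where I = ?I])
    fix i q
    assume i: "i < reg ?s ''r''" "reg q ''c'' = i"
      and fr: "frame (insert ''c'' (assigned (PSeq class_bfs ?l))) (arrs (PSeq class_bfs ?l)) ?s q" and IH: "?I i q"
    have inpq: "inp q" by (rule inp_frame[OF inps fr]) auto
    have aq: "arr q 0 = arr s 0" using frame_arr[OF fr] by simp
    let ?t = "sem class_bfs q"
    have P: "bfs_post (colc (arr s 0) i) 0 (arr ?t 2) (arr ?t 3)" using class_bfs_post[OF inpq i(2) n] aq by simp
    have frt: "frame {''f'', ''a'', ''v'', ''d'', ''u'', ''w''} {1, 2, 3} q ?t" using sem_frame[of class_bfs q] by simp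
    have inpt: "inp ?t" by (rule inp_frame[OF inpq frt]) auto
    have bt: "reg ?t ''b'' = reg q ''b''" using frame_reg[OF frt] by simp
    have "reg (sem ?l ?t) ''b'' \<noteq> 0 \<longleftrightarrow> reg q ''b'' \<noteq> 0 \<and> (\<forall>v<reg ?t ''n''. arr ?t 2 v \<noteq> 0)"
    proof (rule sem_For[where I = "\<lambda>i p. reg p ''b'' \<noteq> 0 \<longleftrightarrow> reg q ''b'' \<noteq> 0 \<and> (\<forall>v<i. arr ?t 2 v \<noteq> 0)"])
      fix j p
      assume j: "reg p ''v'' = j" and IHp: "reg p ''b'' \<noteq> 0 \<longleftrightarrow> reg q ''b'' \<noteq> 0 \<and> (\<forall>v<j. arr ?t 2 v \<noteq> 0)"
        and frp: "frame (insert ''v'' (assigned (PIf (Eq (Arr 2 (Reg ''v'')) (Const 0)) (PAssign ''b'' (Const 0)) PSkip)))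
          (arrs (PIf (Eq (Arr 2 (Reg ''v'')) (Const 0)) (PAssign ''b'' (Const 0)) PSkip)) ?t p"
      have "arr p 2 = arr ?t 2" using frame_arr[OF frp] by simp
      then show "reg (set_reg ''v'' (Suc j) (sem (PIf (Eq (Arr 2 (Reg ''v'')) (Const 0)) (PAssign ''b'' (Const 0)) PSkip) p)) ''b'' \<noteq> 0 \<longleftrightarrow>
        reg q ''b'' \<noteq> 0 \<and> (\<forall>v<Suc j. arr ?t 2 v \<noteq> 0)"
        using IHp j by (auto simp: less_Suc_eq)
    qed (use bt in auto)
    then have "reg (sem ?l ?t) ''b'' \<noteq> 0 \<longleftrightarrow> reg q ''b'' \<noteq> 0 \<and> conn_on (colc (arr s 0) i)"
      using inpt P unfolding conn_on_iff_root[OF n] bfs_post_def inp_def by auto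
    then show "?I (Suc i) (set_reg ''c'' (Suc i) (sem (PSeq class_bfs ?l) q))"
      using IH unfolding sem.simps(6) by (auto simp: less_Suc_eq simp del: sem.simps)
  qed auto
  then show ?thesis using r unfolding test_all_def all_conn_def by simp
qed

text \<open>Later rounds do not overwrite a tree because their tree edges lie in other colour
  classes. The bound \<open>i\<close> on the entries shows that the value \<open>Suc i\<close> is
  new in round \<open>i\<close>.\<close>

lemma extract_trees_post:
  assumes inp: "inp s" and r: "reg s ''r'' = r" and n: "0 < n" and c: "c < r"
  shows "\<exists>V T. bfs_post (colc (arr s 0) c) 0 V T \<and> (\<forall>e<m. arr (sem extract_trees s) 6 e = Suc c \<longleftrightarrow> T e \<noteq> 0)"
proof -
  let ?p = "PFor ''f'' ''m'' (PArr 6 (Reg ''f'') (Const 0))"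
  let ?l = "PFor ''e'' ''m'' (PIf (Eq (Arr 3 (Reg ''e'')) (Const 0)) PSkip (PArr 6 (Reg ''e'') (Suc_exp (Reg ''c''))))"
  let ?s = "sem ?p s"
  have fr0: "frame {''f''} {6} s ?s" using sem_frame[of ?p s] by simp
  have inps: "inp ?s" by (rule inp_frame[OF inp fr0]) auto
  have s: "arr ?s 0 = arr s 0" "reg ?s ''r'' = r" using frame_reg[OF fr0] frame_arr[OF fr0] r by auto
  have "\<forall>e<reg s ''m''. arr ?s 6 e = 0"
    by (rule sem_For[where I = "\<lambda>i q. \<forall>e<i. arr q 6 e = 0"]) (auto simp: less_Suc_eq)
  then have z: "\<forall>e<m. arr ?s 6 e = 0" using inp unfolding inp_def by simp
  let ?I = "\<lambda>i q. (\<forall>e<m. arr q 6 e \<le> i) \<and>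
    (\<forall>c<i. \<exists>V T. bfs_post (colc (arr s 0) c) 0 V T \<and> (\<forall>e<m. arr q 6 e = Suc c \<longleftrightarrow> T e \<noteq> 0))"
  have "?I (reg ?s ''r'') (sem (PFor ''c'' ''r'' (PSeq class_bfs ?l)) ?s)"
  proof (rule sem_For[where I = ?I])
    show "?I 0 (set_reg ''c'' 0 ?s)" using z by (simp del: sem.simps)
    fix i q
    assume i: "i < reg ?s ''r''" "reg q ''c'' = i"
      and fr: "frame (insert ''c'' (assigned (PSeq class_bfs ?l))) (arrs (PSeq class_bfs ?l)) ?s q" and IH: "?I i q"
    have inpq: "inp q" by (rule inp_frame[OF inps fr]) auto
    have aq: "arr q 0 = arr s 0" using frame_arr[OF fr, of 0] s by (simp del: sem.simps)
    define t where "t = sem class_bfs q"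
    have P: "bfs_post (colc (arr s 0) i) 0 (arr t 2) (arr t 3)"
      unfolding t_def using class_bfs_post[OF inpq i(2) n] aq by simp
    have frt: "frame {''f'', ''a'', ''v'', ''d'', ''u'', ''w''} {1, 2, 3} q t" unfolding t_def using sem_frame[of class_bfs q] by simp
    have inpt: "inp t" by (rule inp_frame[OF inpq frt]) auto
    have at: "arr t 6 = arr q 6" "reg t ''c'' = i" using frame_reg[OF frt] frame_arr[OF frt] i by auto
    have "\<forall>e<m. arr (sem ?l t) 6 e = (if e < reg t ''m'' \<and> arr t 3 e \<noteq> 0 then Suc i else arr t 6 e)"
    proof (rule sem_For[where I = "\<lambda>j p. \<forall>e<m. arr p 6 e = (if e < j \<and> arr t 3 e \<noteq> 0 then Suc i else arr t 6 e)"])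
      fix j p
      assume j: "reg p ''e'' = j" "j < reg t ''m''"
        and IHp: "\<forall>e<m. arr p 6 e = (if e < j \<and> arr t 3 e \<noteq> 0 then Suc i else arr t 6 e)"
        and frp: "frame (insert ''e'' (assigned (PIf (Eq (Arr 3 (Reg ''e'')) (Const 0)) PSkip (PArr 6 (Reg ''e'') (Suc_exp (Reg ''c''))))))
          (arrs (PIf (Eq (Arr 3 (Reg ''e'')) (Const 0)) PSkip (PArr 6 (Reg ''e'') (Suc_exp (Reg ''c''))))) t p"
      have "arr p 3 = arr t 3" "reg p ''c'' = i" using frame_arr[OF frp] frame_reg[OF frp] at by auto
      then show "\<forall>e<m. arr (set_reg ''e'' (Suc j) (sem (PIf (Eq (Arr 3 (Reg ''e'')) (Const 0)) PSkip
          (PArr 6 (Reg ''e'') (Suc_exp (Reg ''c'')))) p)) 6 e = (if e < Suc j \<and> arr t 3 e \<noteq> 0 then Suc i else arr t 6 e)"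
        using IHp j by (auto simp: less_Suc_eq)
    qed auto
    then have L: "arr (sem ?l t) 6 e = (if arr t 3 e \<noteq> 0 then Suc i else arr q 6 e)" if "e < m" for e
      using inpt at that unfolding inp_def by (simp del: sem.simps)
    have new: "arr (sem ?l t) 6 e = Suc i \<longleftrightarrow> arr t 3 e \<noteq> 0" if "e < m" for e
    proof -
      have "arr q 6 e \<le> i" using IH that by blast
      then show ?thesis using L[OF that] by auto
    qed
    have old: "arr (sem ?l t) 6 e = Suc c \<longleftrightarrow> arr q 6 e = Suc c" if e: "e < m" and c: "c < i" for e c
    proof (cases "arr t 3 e = 0")
      case True then show ?thesis using L[OF e] by simp
    next
      case False
      then have ei: "e \<in> colc (arr s 0) i" using P e unfolding bfs_post_def tree_inv_def by blast
      have "arr q 6 e \<noteq> Suc c"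
      proof
        assume a: "arr q 6 e = Suc c"
        obtain V T where VT: "bfs_post (colc (arr s 0) c) 0 V T" "\<forall>e<m. arr q 6 e = Suc c \<longleftrightarrow> T e \<noteq> 0" using IH c by blast
        then have "T e \<noteq> 0" "tree_inv (colc (arr s 0) c) V T" using e a unfolding bfs_post_def by auto
        then have "e \<in> colc (arr s 0) c" using e unfolding tree_inv_def by blast
        then show False using ei c unfolding colc_def by auto
      qed
      then show ?thesis using L[OF e] False c by simp
    qed
    have le: "\<forall>e<m. arr (sem ?l t) 6 e \<le> Suc i" using L IH by (simp add: le_SucI del: sem.simps)
    have "\<exists>V T. bfs_post (colc (arr s 0) c) 0 V T \<and> (\<forall>e<m. arr (sem ?l t) 6 e = Suc c \<longleftrightarrow> T e \<noteq> 0)" if "c < Suc i" for c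
    proof (cases "c = i")
      case True then show ?thesis using P new by blast
    next
      case False
      then have "c < i" using that by simp
      then obtain V T where "bfs_post (colc (arr s 0) c) 0 V T" "\<forall>e<m. arr q 6 e = Suc c \<longleftrightarrow> T e \<noteq> 0" using IH by blast
      then show ?thesis using old[OF _ \<open>c < i\<close>] by (intro exI[of _ V] exI[of _ T]) simp
    qed
    then show "?I (Suc i) (set_reg ''c'' (Suc i) (sem (PSeq class_bfs ?l) q))"
      using le unfolding sem.simps(6) t_def by (simp del: sem.simps)
  qed auto
  then show ?thesis using c s unfolding extract_trees_def by (simp del: sem.simps add: sem.simps(6))
qed

definition tree_list :: "(nat \<Rightarrow> nat) \<Rightarrow> nat \<Rightarrow> nat list" where
  "tree_list TC c = filter (\<lambda>e. TC e = Suc c) [0..<m]"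

text \<open>The output replaces the input at the start of the memory while array 6 is still being
  read. It consists of \<open>1 + r\<close> numbers and at most \<open>m\<close> edges, and by
  \<open>r \<le> m\<close> it ends before the arrays, which begin at
  \<open>3 + 2 * m\<close>.\<close>

lemma write_out_post:
  assumes inp: "inp s" and r: "reg s ''r'' = r" "r \<le> m"
  shows "output_of (sem write_out s) = map (tree_list (arr s 6)) [0..<r]"
proof -
  let ?TC = "arr s 6" and ?B = "3 + 2 * m"
  define E where "E = (\<lambda>c. block_enc (map (tree_list ?TC) [0..<c]))"
  have lenE: "length (E c) = c + (\<Sum>c'<c. length (tree_list ?TC c'))" for c
    unfolding E_def length_block_enc by (induction c) auto
  have E_Suc: "E (Suc c) = E c @ length (tree_list ?TC c) # tree_list ?TC c" for c
    unfolding E_def by (simp add: block_enc_snoc)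
  have bnd: "Suc (length (E c)) + Suc (length (filter (\<lambda>e. ?TC e = Suc c) [0..<e])) < ?B" if "c < r" "e \<le> m" for c e
  proof -
    have "[0..<m] = [0..<e] @ [e..<m]" using that upt_add_eq_append[of 0 e "m - e"] by simp
    then have "length (filter (\<lambda>e. ?TC e = Suc c) [0..<e]) \<le> length (tree_list ?TC c)" unfolding tree_list_def by simp
    moreover have "(\<Sum>c'<Suc c. length (tree_list ?TC c')) \<le> m"
      unfolding tree_list_def using sum_filter_le[where k = "Suc c" and f = ?TC and xs = "[0..<m]"] by simp
    ultimately show ?thesis using that r lenE[of c] by simp
  qed
  have setm: "arr (set_mem i v q) a = arr q a" if "i < ?B" "reg q ''B'' = ?B" for i v q a
    unfolding arr_def using that by auto
  let ?s = "set_reg ''l'' 1 (set_mem 0 r s)"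
  have B: "reg s ''B'' = ?B" "reg s ''m'' = m" using inp unfolding inp_def by auto
  let ?K = "\<lambda>q. reg q ''B'' = ?B \<and> reg q ''m'' = m \<and> mem q 0 = r \<and> arr q 6 = ?TC"
  let ?I = "\<lambda>c q. ?K q \<and> reg q ''l'' = Suc (length (E c)) \<and> map (mem q) [1..<Suc (length (E c))] = E c"
  have "?I (reg ?s ''r'') (sem (PFor ''c'' ''r'' output_block) ?s)"
  proof (rule sem_For[where I = ?I])
    show "?I 0 (set_reg ''c'' 0 ?s)" using B setm[of 0 s r 6] by (simp add: E_def block_enc_def)
    fix c q
    assume c: "c < reg ?s ''r''" "reg q ''c'' = c" and IH: "?I c q"
    have cr: "c < r" using c r by simp
    let ?h = "Suc (length (E c))"
    let ?F = "\<lambda>e. filter (\<lambda>e. ?TC e = Suc c) [0..<e]"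
    define t where "t = set_reg ''l'' (Suc ?h) (set_reg ''h'' ?h q)"
    let ?J = "\<lambda>e p. ?K p \<and> reg p ''h'' = ?h \<and> reg p ''c'' = c \<and> reg p ''l'' = Suc ?h + length (?F e) \<and>
      map (mem p) [1..<?h] = E c \<and> map (mem p) [Suc ?h..<Suc ?h + length (?F e)] = ?F e"
    have "?J (reg t ''m'') (sem (PFor ''e'' ''m'' output_item) t)"
    proof (rule sem_For[where I = ?J])
      show "?J 0 (set_reg ''e'' 0 t)" using IH c(2) unfolding t_def by simp
      fix e p
      assume e: "e < reg t ''m''" "reg p ''e'' = e" and J: "?J e p"
      have em: "e < m" using e IH unfolding t_def by simp
      show "?J (Suc e) (set_reg ''e'' (Suc e) (sem output_item p))"
      proof (cases "?TC e = Suc c")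
        case False
        then have "sem output_item p = p" unfolding output_item_def using J e by auto
        then show ?thesis using J False by simp
      next
        case True
        let ?l = "Suc ?h + length (?F e)"
        have o: "sem output_item p = set_reg ''l'' (Suc ?l) (set_mem ?l e p)"
          unfolding output_item_def using J e True by simp
        have lB: "?l < ?B" using bnd[OF cr, of e] em by simp
        have a: "arr (set_mem ?l e p) 6 = ?TC" using setm[OF lB, of p e 6] J by simp
        have F: "?F (Suc e) = ?F e @ [e]" using True by simp
        have m1: "map (mem (set_mem ?l e p)) [1..<?h] = E c"
          using J by (subst map_cong[OF refl, of _ _ "mem p"]) auto
        have "map (mem (set_mem ?l e p)) [Suc ?h..<?l] = ?F e"
          using J by (subst map_cong[OF refl, of _ _ "mem p"]) auto
        then have "map (mem (set_mem ?l e p)) [Suc ?h..<Suc ?l] = ?F e @ [e]" by simp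
        then show ?thesis unfolding o F using J a m1 by simp
      qed
    qed auto
    then have J: "?J m (sem (PFor ''e'' ''m'' output_item) t)" using IH unfolding t_def by simp
    define p where "p = sem (PFor ''e'' ''m'' output_item) t"
    have L: "?F m = tree_list ?TC c" unfolding tree_list_def by simp
    note J = J[folded p_def, unfolded L]
    let ?n = "length (tree_list ?TC c)"
    have o: "sem output_block q = set_mem ?h ?n p"
      unfolding output_block_def using J IH by (simp add: p_def t_def)
    have hB: "?h < ?B" using bnd[OF cr, of 0] by simp
    have a: "arr (set_mem ?h ?n p) 6 = ?TC" using setm[OF hB, of p ?n 6] J by simp
    have m1: "map (mem (set_mem ?h ?n p)) [1..<?h] = E c"
      using J by (subst map_cong[OF refl, of _ _ "mem p"]) auto
    have m2: "map (mem (set_mem ?h ?n p)) [Suc ?h..<Suc ?h + ?n] = tree_list ?TC c"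
      using J by (subst map_cong[OF refl, of _ _ "mem p"]) auto
    have "[1..<Suc (length (E (Suc c)))] = [1..<?h] @ ?h # [Suc ?h..<Suc ?h + ?n]"
      unfolding E_Suc using upt_add_eq_append[of 1 ?h "Suc ?n"] by (simp add: upt_conv_Cons del: upt_Suc)
    then have m3: "map (mem (set_mem ?h ?n p)) [1..<Suc (length (E (Suc c)))] = E (Suc c)"
      unfolding E_Suc using m1 m2 by (simp del: upt_Suc)
    have "length (E (Suc c)) = ?h + ?n" unfolding E_Suc by simp
    then show "?I (Suc c) (set_reg ''c'' (Suc c) (sem output_block q))"
      unfolding o using J a m3 by simp
  qed auto
  then have I: "?I r (sem write_out s)" unfolding write_out_def using r by simp
  have "map (mem (sem write_out s)) [1..<1 + length (block_enc (map (tree_list ?TC) [0..<r]))] = block_enc (map (tree_list ?TC) [0..<r])"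
    using I unfolding E_def by simp
  from read_blocks_enc[OF this] show ?thesis using I unfolding output_of_def by simp
qed

lemma tree_inv_edge:
  "tree_inv M V T \<Longrightarrow> e < m \<Longrightarrow> T e \<noteq> 0 \<Longrightarrow>
     e \<in> M \<and> (\<exists>v w. ends (graph_of n es) e = {v, w} \<and> V w \<noteq> 0 \<and> V v = Suc (V w))"
  unfolding tree_inv_def by (elim conjE) (drule spec, drule (1) mp, drule (1) mp, assumption)

lemma tree_inv_unique:
  "tree_inv M V T \<Longrightarrow> e < m \<Longrightarrow> e' < m \<Longrightarrow> T e \<noteq> 0 \<Longrightarrow> T e' \<noteq> 0 \<Longrightarrow> ends (graph_of n es) e = {v, w} \<Longrightarrow>
     ends (graph_of n es) e' = {v, w'} \<Longrightarrow> V v = Suc (V w) \<Longrightarrow> V v = Suc (V w') \<Longrightarrow> e = e'"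
  unfolding tree_inv_def by (elim conjE) metis

lemma tree_rch:
  assumes P: "bfs_post M 0 V T" and M: "M \<subseteq> {..<m}" and v: "v < n" "V v = Suc j"
  shows "rch {e. e < m \<and> T e \<noteq> 0} j v 0"
  using v
proof (induction j arbitrary: v)
  case 0
  then have "rch M 0 0 v" using P unfolding bfs_post_def by blast
  then have "v = 0" by simp
  then show ?case by (simp only: rch_refl)
next
  case (Suc j)
  let ?A = "{e. e < m \<and> T e \<noteq> 0}"
  have "1 < V v" using Suc.prems by simp
  then obtain e w where e: "e < m" "T e \<noteq> 0" "ends (graph_of n es) e = {v, w}" "V v = Suc (V w)"
    using P Suc.prems(1) unfolding bfs_post_def tree_inv_def by metis
  have "w < n" by (rule ends_less(2)[OF e(1,3)])
  moreover have "V w = Suc j" using e(4) Suc.prems by simp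
  ultimately have "rch ?A j w 0" by (rule Suc.IH)
  moreover have "rch ?A (Suc 0) v w" using e unfolding rch.simps adj_def by blast
  ultimately have "rch ?A (Suc 0 + j) v 0" by (rule rch_trans[rotated])
  then show ?case by (simp only: plus_1_eq_Suc One_nat_def[symmetric])
qed

text \<open>The search tree preserves the distances from the root, so going through the root costs
  at most \<open>2 * g\<close>.\<close>

lemma bfs_tree:
  assumes P: "bfs_post M 0 V T" and M: "M \<subseteq> {..<m}" and c: "conn_on M" and n: "0 < n"
  shows "spanning_tree_edges (graph_of n es) {e. e < m \<and> T e \<noteq> 0}"
    and "(\<And>v. v < n \<Longrightarrow> rch M g v 0) \<Longrightarrow>
      graph_diameter (with_edges (graph_of n es) {e. e < m \<and> T e \<noteq> 0}) \<le> enat (2 * g)"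
proof -
  let ?A = "{e. e < m \<and> T e \<noteq> 0}"
  have A: "?A \<subseteq> edges (graph_of n es)" by auto
  have root: "rch ?A (V v - 1) v 0" if "v < n" for v
  proof -
    have "con M 0 v" using c n that unfolding conn_on_def by auto
    then have "V v \<noteq> 0" using P that unfolding bfs_post_def by blast
    then show ?thesis using tree_rch[OF P M that, of "V v - 1"] by simp
  qed
  have "conn_on ?A" unfolding conn_on_iff_root[OF n] using root con_def con_sym by blast
  then have "connected_graph (with_edges (graph_of n es) ?A)" using connected_graph_iff[OF A] n by auto
  moreover have "\<not> is_cycle (with_edges (graph_of n es) ?A) vs es'" for vs es'
  proof (rule acyclic_by_rank[where R = V])
    have T: "tree_inv M V T" using P unfolding bfs_post_def by blast
    have step: "V u = Suc (V v) \<or> V v = Suc (V u)" if "e \<in> ?A" "ends (graph_of n es) e = {u, v}" for e u v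
    proof -
      have "e < m" "T e \<noteq> 0" using that(1) by auto
      then obtain x w where "ends (graph_of n es) e = {x, w}" "V x = Suc (V w)" using tree_inv_edge[OF T] by blast
      then show ?thesis using that(2) by (metis doubleton_eq_iff)
    qed
    show "V u \<noteq> V v" if "e \<in> ?A" "ends (graph_of n es) e = {u, v}" for e u v using step[OF that] by auto
    show "e = e'" if e: "e \<in> ?A" "e' \<in> ?A" "ends (graph_of n es) e = {v, w}" "ends (graph_of n es) e' = {v, w'}" "V w < V v" "V w' < V v"
      for e e' v w w'
    proof -
      have "V v = Suc (V w)" "V v = Suc (V w')" using step[OF e(1,3)] step[OF e(2,4)] e(5,6) by auto
      moreover have "e < m" "T e \<noteq> 0" "e' < m" "T e' \<noteq> 0" using e(1,2) by auto
      ultimately show ?thesis using tree_inv_unique[OF T] e(3,4) by blast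
    qed
  qed (rule A)
  ultimately show "spanning_tree_edges (graph_of n es) ?A" unfolding spanning_tree_edges_def tree_graph_def using A by blast
  assume g: "\<And>v. v < n \<Longrightarrow> rch M g v 0"
  have rg: "rch ?A g v 0" if "v < n" for v
  proof -
    have "V v \<le> Suc g" using P g[OF that] that rch_sym unfolding bfs_post_def by blast
    then show ?thesis using root[OF that] rch_le by (metis diff_Suc_1 diff_le_mono)
  qed
  show "graph_diameter (with_edges (graph_of n es) ?A) \<le> enat (2 * g)"
  proof (rule graph_diameter_le[OF A])
    fix u v assume "u \<in> vertices (graph_of n es)" "v \<in> vertices (graph_of n es)"
    then have "u < n" "v < n" by auto
    then have "rch ?A (g + g) u v" using rch_trans[OF rg rch_sym[OF rg]] by blast
    then show "rch ?A (2 * g) u v" by (simp only: mult_2)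
  qed
qed

end


section \<open>The algorithm\<close>

definition flip_loop :: prog where
  "flip_loop = PSeq (PAssign ''x'' (Const 0))
     (PFor ''i'' ''j'' (PSeq (PFlip ''g'') (PAssign ''x'' (Add (Add (Reg ''x'') (Reg ''x'')) (Reg ''g'')))))"

definition rand :: prog where
  "rand = PFor ''e'' ''m'' (PSeq flip_loop (PArr 0 (Reg ''e'') (Reg ''x'')))"

lemma flip_loop_wf [simp]:
  "wfp flip_loop" "assigned flip_loop = {''x'', ''i'', ''g''}" "arrs flip_loop = {}" "limits flip_loop = {''j''}"
  unfolding flip_loop_def by auto

lemma rand_wf [simp]:
  "wfp rand" "assigned rand = {''x'', ''i'', ''g'', ''e''}" "arrs rand = {0}" "limits rand = {''m'', ''j''}"
  unfolding rand_def by auto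

definition post :: prog where
  "post = PSeq test_all (PSeq (PIf (Eq (Reg ''b'') (Const 0)) fallback PSkip) (PSeq extract_trees write_out))"

lemma post_wf [simp]:
  "wfp post" "flipless post" "limits post = {''n'', ''m'', ''r''}"
  "''n'' \<notin> assigned post" "''m'' \<notin> assigned post" "''r'' \<notin> assigned post" "''j'' \<notin> assigned post"
  unfolding post_def by auto

text \<open>Appending a bit to a number below \<open>N\<close> is a bijection onto the numbers below
  \<open>2 * N\<close>.\<close>

lemma uniform_double:
  fixes N :: nat
  assumes "0 < N"
  shows "bind_pmf (pmf_of_set {..<N}) (\<lambda>x. map_pmf (\<lambda>b. x + x + (if b then 1 else 0)) (bernoulli_pmf (1/2))) = pmf_of_set {..<2 * N}"
proof -
  let ?f = "\<lambda>(x, b). x + x + (if b then 1 else 0 :: nat)"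
  have "bind_pmf (pmf_of_set {..<N}) (\<lambda>x. map_pmf (\<lambda>b. x + x + (if b then 1 else 0)) (bernoulli_pmf (1/2)))
    = map_pmf ?f (pair_pmf (pmf_of_set {..<N}) (pmf_of_set UNIV))"
    unfolding bernoulli_pmf_half_conv_pmf_of_set pair_pmf_def by (simp add: map_bind_pmf map_pmf_def bind_assoc_pmf bind_return_pmf)
  also have "pair_pmf (pmf_of_set {..<N}) (pmf_of_set (UNIV :: bool set)) = pmf_of_set ({..<N} \<times> UNIV)"
  proof (rule pmf_eqI)
    fix z :: "nat \<times> bool"
    show "pmf (pair_pmf (pmf_of_set {..<N}) (pmf_of_set UNIV)) z = pmf (pmf_of_set ({..<N} \<times> UNIV)) z"
      using assms by (cases z) (simp add: pmf_pair pmf_of_set indicator_def lessThan_empty_iff)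
  qed
  also have "map_pmf ?f (pmf_of_set ({..<N} \<times> UNIV)) = pmf_of_set {..<2 * N}"
  proof (rule map_pmf_of_set_bij_betw)
    show "bij_betw ?f ({..<N} \<times> UNIV) {..<2 * N}"
    proof (rule bij_betwI[where g = "\<lambda>y. (y div 2, odd y)"])
      show "?f \<in> {..<N} \<times> UNIV \<rightarrow> {..<2 * N}" by (auto split: if_splits)
      show "(\<lambda>y. (y div 2, odd y)) \<in> {..<2 * N} \<rightarrow> {..<N} \<times> UNIV" by auto
      show "(\<lambda>y. (y div 2, odd y)) (?f z) = z" if "z \<in> {..<N} \<times> UNIV" for z using that by (auto split: if_splits)
      show "?f (y div 2, odd y) = y" if "y \<in> {..<2 * N}" for y by (auto simp: mult_2[symmetric])
    qed
  qed (use assms in auto)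
  finally show ?thesis .
qed

lemma flip_loop_uniform: "map_pmf (\<lambda>s. reg s ''x'') (psem flip_loop s) = pmf_of_set {..<2 ^ reg s ''j''}"
proof -
  let ?s = "set_reg ''x'' 0 s"
  let ?b = "PSeq (PFlip ''g'') (PAssign ''x'' (Add (Add (Reg ''x'') (Reg ''x'')) (Reg ''g'')))"
  let ?R = "rec_nat (return_pmf (set_reg ''i'' 0 ?s)) (\<lambda>i \<mu>. bind_pmf \<mu> (\<lambda>s'. map_pmf (set_reg ''i'' (Suc i)) (psem ?b s')))"
  have "map_pmf (\<lambda>s. reg s ''x'') (?R k) = pmf_of_set {..<2 ^ k}" for k
  proof (induction k)
    case 0
    have "{..<1::nat} = {0}" by auto
    then show ?case by (simp add: pmf_of_set_singleton)
  next
    case (Suc k)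
    have "map_pmf (\<lambda>s. reg s ''x'') (?R (Suc k))
      = bind_pmf (?R k) (\<lambda>s. map_pmf (\<lambda>b. reg s ''x'' + reg s ''x'' + (if b then 1 else 0)) (bernoulli_pmf (1/2)))"
      by (simp add: map_bind_pmf pmf.map_comp comp_def bind_map_pmf map_pmf_def bind_assoc_pmf bind_return_pmf)
    also have "\<dots> = bind_pmf (map_pmf (\<lambda>s. reg s ''x'') (?R k))
        (\<lambda>x. map_pmf (\<lambda>b. x + x + (if b then 1 else 0)) (bernoulli_pmf (1/2)))"
      by (simp add: bind_map_pmf)
    also have "\<dots> = pmf_of_set {..<2 ^ Suc k}" unfolding Suc using uniform_double[of "2 ^ k"] by simp
    finally show ?case .
  qed
  then show ?thesis unfolding flip_loop_def by (simp add: bind_return_pmf)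
qed

text \<open>The value 0 for the edges not yet coloured agrees with the default value of
  \<open>Pi_pmf\<close>.\<close>

definition cols :: "nat \<Rightarrow> ram \<Rightarrow> nat \<Rightarrow> nat" where
  "cols i s e = (if e < i then arr s 0 e else 0)"

text \<open>From any state a round draws a uniform colour and leaves the earlier colours alone,
  which is how \<open>Pi_pmf\<close> grows when an index is inserted.\<close>

lemma rand_uniform:
  "map_pmf (cols (reg s ''m'')) (psem rand s) = Pi_pmf {..<reg s ''m''} 0 (\<lambda>_. pmf_of_set {..<2 ^ reg s ''j''})"
proof -
  let ?b = "PSeq flip_loop (PArr 0 (Reg ''e'') (Reg ''x''))"
  let ?R = "rec_nat (return_pmf (set_reg ''e'' 0 s)) (\<lambda>i \<mu>. bind_pmf \<mu> (\<lambda>s'. map_pmf (set_reg ''e'' (Suc i)) (psem ?b s')))"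
  let ?U = "pmf_of_set {..<2 ^ reg s ''j''} :: nat pmf"
  have inv: "s' \<in> set_pmf (?R k) \<Longrightarrow> reg s' ''e'' = k \<and> reg s' ''j'' = reg s ''j''" for s' k
  proof (induction k arbitrary: s')
    case 0 then show ?case by simp
  next
    case (Suc k)
    then obtain s1 s2 where "s1 \<in> set_pmf (?R k)" "s2 \<in> set_pmf (psem ?b s1)" "s' = set_reg ''e'' (Suc k) s2" by auto
    then show ?case using Suc.IH reg_psem[of s2 ?b s1 "''j''"] by simp
  qed
  have "map_pmf (cols k) (?R k) = Pi_pmf {..<k} 0 (\<lambda>_. ?U)" for k
  proof (induction k)
    case 0
    have "cols 0 (set_reg ''e'' 0 s) = (\<lambda>_. 0)" unfolding cols_def by auto
    then show ?case by simp
  next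
    case (Suc k)
    have "map_pmf (cols (Suc k)) (?R (Suc k)) = bind_pmf (?R k) (\<lambda>t. map_pmf (cols (Suc k)) (map_pmf (set_reg ''e'' (Suc k)) (psem ?b t)))"
      by (simp add: map_bind_pmf)
    also have "\<dots> = bind_pmf (?R k) (\<lambda>t. map_pmf (\<lambda>v. (cols k t)(k := v)) ?U)"
    proof (rule bind_pmf_cong[OF refl])
      fix t assume t: "t \<in> set_pmf (?R k)"
      note tk = inv[OF t]
      have "map_pmf (cols (Suc k)) (map_pmf (set_reg ''e'' (Suc k)) (psem ?b t))
        = map_pmf (\<lambda>t'. cols (Suc k) (set_reg ''e'' (Suc k) (set_arr 0 (reg t' ''e'') (reg t' ''x'') t'))) (psem flip_loop t)"
      proof -
        have "psem (PArr 0 (Reg ''e'') (Reg ''x'')) = (\<lambda>t'. return_pmf (set_arr 0 (reg t' ''e'') (reg t' ''x'') t'))"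
          by (rule ext) simp
        then have "psem ?b t = map_pmf (\<lambda>t'. set_arr 0 (reg t' ''e'') (reg t' ''x'') t') (psem flip_loop t)"
          unfolding map_pmf_def by (simp only: psem.simps(6))
        then show ?thesis by (simp add: pmf.map_comp comp_def)
      qed
      also have "\<dots> = map_pmf (\<lambda>t'. (cols k t)(k := reg t' ''x'')) (psem flip_loop t)"
      proof (rule map_pmf_cong[OF refl])
        fix t' assume t': "t' \<in> set_pmf (psem flip_loop t)"
        have "frame {''x'', ''i'', ''g''} {} t t'" using psem_frame[OF _ _ t'] by simp
        then have "arr t' 0 = arr t 0" "reg t' ''e'' = k" using frame_arr frame_reg tk by auto
        then show "cols (Suc k) (set_reg ''e'' (Suc k) (set_arr 0 (reg t' ''e'') (reg t' ''x'') t')) = (cols k t)(k := reg t' ''x'')"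
          unfolding cols_def by (auto simp: fun_eq_iff)
      qed
      also have "\<dots> = map_pmf (\<lambda>v. (cols k t)(k := v)) (map_pmf (\<lambda>s. reg s ''x'') (psem flip_loop t))"
        by (simp add: pmf.map_comp comp_def)
      finally show "map_pmf (cols (Suc k)) (map_pmf (set_reg ''e'' (Suc k)) (psem ?b t)) = map_pmf (\<lambda>v. (cols k t)(k := v)) ?U"
        using flip_loop_uniform[of t] tk by simp
    qed
    also have "\<dots> = bind_pmf (map_pmf (cols k) (?R k)) (\<lambda>f. map_pmf (\<lambda>v. f(k := v)) ?U)" by (simp add: bind_map_pmf)
    also have "\<dots> = bind_pmf ?U (\<lambda>v. map_pmf (\<lambda>f. f(k := v)) (Pi_pmf {..<k} 0 (\<lambda>_. ?U)))"
      unfolding Suc by (simp only: map_pmf_def) (rule bind_commute_pmf)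
    also have "\<dots> = Pi_pmf {..<Suc k} 0 (\<lambda>_. ?U)"
      unfolding lessThan_Suc by (subst Pi_pmf_insert') (auto simp: map_pmf_def)
    finally show ?case .
  qed
  then show ?thesis unfolding rand_def by simp
qed

context input_graph
begin

text \<open>\<open>col\<close> is the colouring that the trees are taken from. It is the random one
  whenever that has connected classes, so the analysis of random colourings applies to the
  output.\<close>

lemma post_result:
  assumes inp: "inp s" and r: "reg s ''r'' = r" "r \<le> m" and k: "kcut k" "2 * r \<le> k" and n: "0 < n"
  obtains col TC where "all_conn r col" "all_conn r (arr s 0) \<Longrightarrow> col = arr s 0"
    "output_of (sem post s) = map (tree_list TC) [0..<r]"
    "\<And>c. c < r \<Longrightarrow> \<exists>V T. bfs_post (colc col c) 0 V T \<and> set (tree_list TC c) = {e. e < m \<and> T e \<noteq> 0}"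
proof -
  define t where "t = sem test_all s"
  have frt: "frame {''f'', ''a'', ''v'', ''d'', ''u'', ''w'', ''b'', ''c''} {1, 2, 3} s t"
    unfolding t_def using sem_frame[of test_all s] by simp
  have inpt: "inp t" by (rule inp_frame[OF inp frt]) auto
  have at: "arr t 0 = arr s 0" "reg t ''r'' = r" using frame_arr[OF frt] frame_reg[OF frt] r by auto
  have b: "reg t ''b'' \<noteq> 0 \<longleftrightarrow> all_conn r (arr s 0)" unfolding t_def by (rule test_all_post[OF inp r(1) n])
  define u where "u = (if reg t ''b'' = 0 then sem fallback t else t)"
  have fru: "frame (assigned fallback) (arrs fallback) t u"
    unfolding u_def using sem_frame[of fallback t] frame_refl by auto
  have inpu: "inp u" by (rule inp_frame[OF inpt fru]) auto
  have ru: "reg u ''r'' = r" using frame_reg[OF fru] at by simp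
  have conn: "all_conn r (arr u 0)"
    unfolding u_def using fallback_post[OF inpt at(2) k n] b at(1) by auto
  have same: "arr u 0 = arr s 0" if "all_conn r (arr s 0)" using that b at(1) unfolding u_def by simp
  define v where "v = sem extract_trees u"
  have frv: "frame (assigned extract_trees) (arrs extract_trees) u v" unfolding v_def by (rule sem_frame) auto
  have inpv: "inp v" by (rule inp_frame[OF inpu frv]) auto
  have rv: "reg v ''r'' = r" using frame_reg[OF frv] ru by simp
  have "sem post s = sem write_out v" unfolding post_def v_def u_def t_def by simp
  then have out: "output_of (sem post s) = map (tree_list (arr v 6)) [0..<r]" using write_out_post[OF inpv rv r(2)] by simp
  have "\<exists>V T. bfs_post (colc (arr u 0) c) 0 V T \<and> set (tree_list (arr v 6) c) = {e. e < m \<and> T e \<noteq> 0}" if c: "c < r" for c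
  proof -
    obtain V T where VT: "bfs_post (colc (arr u 0) c) 0 V T" "\<forall>e<m. arr v 6 e = Suc c \<longleftrightarrow> T e \<noteq> 0"
      using extract_trees_post[OF inpu ru n c] unfolding v_def by blast
    then have "set (tree_list (arr v 6) c) = {e. e < m \<and> T e \<noteq> 0}" unfolding tree_list_def by auto
    then show ?thesis using VT(1) by blast
  qed
  then show ?thesis using that[of "arr u 0" "arr v 6"] conn same out by blast
qed

end

section \<open>Choice of the parameters and numerical bounds\<close>

definition read_input :: prog where
  "read_input = PSeq (PAssign ''n'' (Load (Const 0))) (PSeq (PAssign ''m'' (Load (Const 1)))
     (PSeq (PAssign ''k'' (Load (Const 2))) (PAssign ''B'' (Add (Const 3) (Add (Reg ''m'') (Reg ''m''))))))"

text \<open>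
  Register \<open>l\<close> receives 100 times the bit length of \<open>n\<close>, and \<open>r\<close> the largest power of 2 with
  \<open>l * r \<le> k\<close>.
\<close>

definition num_colours :: prog where
  "num_colours = PSeq (PAssign ''u'' (Const 1)) (PSeq (PAssign ''l'' (Const 0))
     (PSeq (PFor ''f'' ''m'' (PIf (Less (Reg ''n'') (Reg ''u'')) PSkip
        (PSeq (PAssign ''u'' (Add (Reg ''u'') (Reg ''u''))) (PAssign ''l'' (Add (Reg ''l'') (Const 100))))))
     (PSeq (PAssign ''t'' (Reg ''l'')) (PSeq (PAssign ''r'' (Const 1)) (PSeq (PAssign ''j'' (Const 0))
       (PFor ''f'' ''m'' (PIf (Less (Reg ''k'') (Add (Reg ''t'') (Reg ''t''))) PSkip
          (PSeq (PAssign ''t'' (Add (Reg ''t'') (Reg ''t''))) (PSeq (PAssign ''r'' (Add (Reg ''r'') (Reg ''r'')))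
            (PAssign ''j'' (Add (Reg ''j'') (Const 1))))))))))))"

lemma num_colours_wf [simp]:
  "wfp num_colours" "flipless num_colours" "limits num_colours = {''m''}" "arrs num_colours = {}"
  "assigned num_colours = {''u'', ''l'', ''t'', ''r'', ''j'', ''f''}"
  unfolding num_colours_def by auto

text \<open>Both loops may be limited by \<open>m\<close> because \<open>n\<close> and
  \<open>k\<close> are below \<open>2 ^ m\<close>. The assumption \<open>bits\<close> admits the
  initial value \<open>r = 1\<close>.\<close>

lemma num_colours_post:
  assumes m: "reg s ''m'' = m" and n: "reg s ''n'' = n" "1 \<le> n" "n < 2 ^ m" and k: "reg s ''k'' = k" "k < 2 ^ m"
    and bits: "\<And>b. 1 \<le> b \<Longrightarrow> 2 ^ (b - 1) \<le> n \<Longrightarrow> 100 * b \<le> k"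
  obtains b j where "1 \<le> b" "n < 2 ^ b" "2 ^ (b - 1) \<le> n"
    "reg (sem num_colours s) ''j'' = j" "reg (sem num_colours s) ''r'' = 2 ^ j" "j \<le> m"
    "100 * b * 2 ^ j \<le> k" "k < 200 * b * 2 ^ j"
proof -
  let ?b1 = "PIf (Less (Reg ''n'') (Reg ''u'')) PSkip
        (PSeq (PAssign ''u'' (Add (Reg ''u'') (Reg ''u''))) (PAssign ''l'' (Add (Reg ''l'') (Const 100))))"
  let ?b2 = "PIf (Less (Reg ''k'') (Add (Reg ''t'') (Reg ''t''))) PSkip
          (PSeq (PAssign ''t'' (Add (Reg ''t'') (Reg ''t''))) (PSeq (PAssign ''r'' (Add (Reg ''r'') (Reg ''r'')))
            (PAssign ''j'' (Add (Reg ''j'') (Const 1)))))"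
  define s1 where "s1 = set_reg ''l'' 0 (set_reg ''u'' 1 s)"
  define s2 where "s2 = sem (PFor ''f'' ''m'' ?b1) s1"
  let ?I = "\<lambda>i q. \<exists>b. reg q ''u'' = 2 ^ b \<and> reg q ''l'' = 100 * b \<and> b \<le> i \<and> (b = i \<or> n < 2 ^ b) \<and> (1 \<le> b \<longrightarrow> 2 ^ (b - 1) \<le> n)"
  have "?I (reg s1 ''m'') (sem (PFor ''f'' ''m'' ?b1) s1)"
  proof (rule sem_For[where I = ?I])
    show "?I 0 (set_reg ''f'' 0 s1)" unfolding s1_def by simp
    fix i q
    assume fr: "frame (insert ''f'' (assigned ?b1)) (arrs ?b1) s1 q" and I: "?I i q"
    have nq: "reg q ''n'' = n" using frame_reg[OF fr, of "''n''"] n unfolding s1_def by simp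
    obtain b where b: "reg q ''u'' = 2 ^ b" "reg q ''l'' = 100 * b" "b \<le> i" "b = i \<or> n < 2 ^ b" "1 \<le> b \<longrightarrow> 2 ^ (b - 1) \<le> n"
      using I by blast
    show "?I (Suc i) (set_reg ''f'' (Suc i) (sem ?b1 q))"
    proof (cases "n < 2 ^ b")
      case True then show ?thesis using b nq by (intro exI[of _ b]) simp
    next
      case False then show ?thesis using b nq by (intro exI[of _ "Suc b"]) auto
    qed
  qed auto
  then obtain b where b: "reg s2 ''l'' = 100 * b" "b = m \<or> n < 2 ^ b" "1 \<le> b \<longrightarrow> 2 ^ (b - 1) \<le> n"
    using m unfolding s2_def s1_def by auto
  have nb: "n < 2 ^ b" using b n by auto
  have b1: "1 \<le> b" using nb n(2) by (cases b) auto
  have bn: "2 ^ (b - 1) \<le> n" using b b1 by simp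
  have bk: "100 * b \<le> k" using bits b1 bn by simp
  have fr2: "frame (assigned (PFor ''f'' ''m'' ?b1)) (arrs (PFor ''f'' ''m'' ?b1)) s1 s2" unfolding s2_def by (rule sem_frame) auto
  have r2: "reg s2 ''m'' = m" "reg s2 ''k'' = k"
    using frame_reg[OF fr2, of "''m''"] frame_reg[OF fr2, of "''k''"] m k unfolding s1_def by auto
  define s3 where "s3 = set_reg ''j'' 0 (set_reg ''r'' 1 (set_reg ''t'' (100 * b) s2))"
  let ?J = "\<lambda>i q. \<exists>j. reg q ''j'' = j \<and> reg q ''r'' = 2 ^ j \<and> reg q ''t'' = 100 * b * 2 ^ j \<and> j \<le> i \<and>
    100 * b * 2 ^ j \<le> k \<and> (j = i \<or> k < 200 * b * 2 ^ j)"
  have "?J (reg s3 ''m'') (sem (PFor ''f'' ''m'' ?b2) s3)"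
  proof (rule sem_For[where I = ?J])
    show "?J 0 (set_reg ''f'' 0 s3)" unfolding s3_def using bk by simp
    fix i q
    assume fr: "frame (insert ''f'' (assigned ?b2)) (arrs ?b2) s3 q" and J: "?J i q"
    have kq: "reg q ''k'' = k" using frame_reg[OF fr, of "''k''"] r2 unfolding s3_def by simp
    obtain j where j: "reg q ''j'' = j" "reg q ''r'' = 2 ^ j" "reg q ''t'' = 100 * b * 2 ^ j" "j \<le> i"
      "100 * b * 2 ^ j \<le> k" "j = i \<or> k < 200 * b * 2 ^ j" using J by blast
    show "?J (Suc i) (set_reg ''f'' (Suc i) (sem ?b2 q))"
    proof (cases "k < 200 * b * 2 ^ j")
      case True
      then have "k < reg q ''t'' + reg q ''t''" using j by simp
      then show ?thesis using j kq True by (intro exI[of _ j]) simp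
    next
      case False
      then have "\<not> k < reg q ''t'' + reg q ''t''" using j by simp
      then show ?thesis using j kq False by (intro exI[of _ "Suc j"]) auto
    qed
  qed auto
  moreover have "sem num_colours s = sem (PFor ''f'' ''m'' ?b2) s3"
    unfolding num_colours_def s3_def b(1)[symmetric] s2_def s1_def by simp
  moreover have "reg s3 ''m'' = m" unfolding s3_def using r2 by simp
  ultimately obtain j where j: "reg (sem num_colours s) ''j'' = j" "reg (sem num_colours s) ''r'' = 2 ^ j" "j \<le> m"
      "100 * b * 2 ^ j \<le> k" "j = m \<or> k < 200 * b * 2 ^ j" by metis
  have "k < 200 * b * 2 ^ j"
  proof (rule ccontr)
    assume "\<not> ?thesis"
    then have "j = m" using j by blast
    then have "2 ^ m \<le> 100 * b * 2 ^ j" using b1 by simp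
    then show False using j k by simp
  qed
  then show ?thesis using that b1 nb bn j by blast
qed

lemma pairs_nth:
  "i < length es \<Longrightarrow> concat (map (\<lambda>(u, v). [u, v]) es) ! (2 * i) = fst (es ! i) \<and>
     concat (map (\<lambda>(u, v). [u, v]) es) ! Suc (2 * i) = snd (es ! i)"
proof (induction es arbitrary: i)
  case (Cons e es)
  then show ?case by (cases i) (auto simp: case_prod_unfold)
qed simp

lemma length_encode: "length (encode n k es) = 3 + 2 * length es"
proof -
  have "length (concat (map (\<lambda>(u, v). [u, v]) es)) = 2 * length es" by (induction es) auto
  then show ?thesis unfolding encode_def by simp
qed

text \<open>From \<open>D\<close> to \<open>D + 1\<close> the left side gains the factor
  \<open>3 * k\<close> and the right side \<open>k ^ (D + 1)\<close>; the surplus factor 3 is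
  absorbed by \<open>k ^ D\<close>.\<close>

lemma num_levels_bound:
  assumes "1 \<le> D" "9 \<le> (k::nat)"
  shows "(3 * k) ^ D \<le> 3 * k ^ (D * (D + 1) div 2)"
  using assms(1)
proof (induction D rule: dec_induct)
  case base then show ?case by simp
next
  case (step D)
  have T: "Suc D * (Suc D + 1) div 2 = D * (D + 1) div 2 + Suc D"
  proof -
    have "Suc D * (Suc D + 1) = D * (D + 1) + 2 * Suc D" by (simp add: algebra_simps)
    then show ?thesis by simp
  qed
  have "k ^ 1 \<le> k ^ D" by (rule power_increasing) (use step assms(2) in auto)
  then have "3 \<le> k ^ D" using assms(2) by simp
  then have "3 * k ^ (D * (D + 1) div 2) \<le> k ^ D * k ^ (D * (D + 1) div 2)" by (rule mult_le_mono1)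
  then have "(3 * k) * (3 * k ^ (D * (D + 1) div 2)) \<le> (3 * k) * (k ^ D * k ^ (D * (D + 1) div 2))" by (rule mult_le_mono2)
  moreover have "(3 * k) ^ Suc D \<le> (3 * k) * (3 * k ^ (D * (D + 1) div 2))"
    unfolding power_Suc by (rule mult_le_mono2[OF step.IH])
  moreover have "(3 * k) * (k ^ D * k ^ (D * (D + 1) div 2)) = 3 * k ^ (D * (D + 1) div 2 + Suc D)"
    by (simp only: power_add power_Suc mult_ac)
  ultimately show ?case unfolding T by linarith
qed

text \<open>As \<open>ln 2\<close> is at least \<open>2 / 3\<close>, both \<open>b - 1\<close> and 1
  are at most \<open>3 / 2 * ln n\<close>.\<close>

lemma bit_length_le:
  assumes n: "2 \<le> (n::nat)" and b: "1 \<le> b" "2 ^ (b - 1) \<le> n"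
  shows "real b \<le> 3 * ln (real n)"
proof -
  have "real (b - 1) * ln 2 \<le> ln (real n)"
  proof -
    have "(2::real) ^ (b - 1) \<le> real n" using b(2) by (metis of_nat_le_iff of_nat_numeral of_nat_power)
    then have "ln ((2::real) ^ (b - 1)) \<le> ln (real n)" by (intro ln_mono) auto
    then show ?thesis by (simp add: ln_realpow)
  qed
  moreover have "real (b - 1) * (2 / 3) \<le> real (b - 1) * ln 2" using ln2_ge_two_thirds by (intro mult_left_mono) auto
  moreover have "ln 2 \<le> ln (real n)" using n by (intro ln_mono) auto
  ultimately show ?thesis using b(1) ln2_ge_two_thirds by simp
qed

text \<open>The exponent is at least \<open>10 * b * r\<close>, so the power is at most
  \<open>exp (- 10 * b)\<close>, and \<open>n < 2 ^ b \<le> exp b\<close>.\<close>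

lemma avoid_bound:
  assumes n: "2 \<le> (n::nat)" and b: "n < 2 ^ b" "1 \<le> b" and r: "0 < (r::nat)" and k: "100 * b * r \<le> (k::nat)"
  shows "(1 - 1 / real r) ^ (k div 2) \<le> 1 / real n ^ 10"
proof -
  have le: "1 - 1 / real r \<le> exp (- (1 / real r))" using exp_ge_add_one_self[of "- (1 / real r)"] by simp
  have br: "1 \<le> b * r" using b r by simp
  have t: "10 * b * r \<le> k div 2" using k br by linarith
  have "(1 - 1 / real r) ^ (k div 2) \<le> exp (- (1 / real r)) ^ (k div 2)"
    using le r by (intro power_mono) auto
  also have "\<dots> = exp (- (real (k div 2) / real r))" by (simp add: exp_of_nat_mult[symmetric])
  also have "\<dots> \<le> exp (- (10 * real b))"
  proof -
    have "real (10 * b * r) \<le> real (k div 2)" using t of_nat_le_iff by blast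
    then have "10 * real b \<le> real (k div 2) / real r" using r by (simp add: field_simps)
    then show ?thesis by simp
  qed
  also have "\<dots> = 1 / exp (real b) ^ 10" by (simp add: exp_minus exp_of_nat_mult[symmetric] field_simps)
  also have "\<dots> \<le> 1 / real n ^ 10"
  proof -
    have "real n \<le> 2 ^ b" using b(1) by (metis less_imp_le of_nat_le_iff of_nat_numeral of_nat_power)
    also have "\<dots> \<le> exp 1 ^ b" using exp_ge_add_one_self[of 1] by (intro power_mono) auto
    also have "\<dots> = exp (real b)" by (simp add: exp_of_nat_mult[symmetric])
    finally have "real n ^ 10 \<le> exp (real b) ^ 10" by (intro power_mono) auto
    then show ?thesis using n by (intro divide_left_mono) auto
  qed
  finally show ?thesis .
qed

context input_graph
begin

text \<open>The levels are the distances from vertex 0. Their bound \<open>D'\<close> is the minimum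
  of \<open>D\<close> and \<open>n\<close>: the diameter bound needs \<open>D' \<le> D\<close>, the
  union bound \<open>D' \<le> n\<close>.\<close>

lemma levels_exist:
  assumes n: "2 \<le> n" and D: "graph_diameter (graph_of n es) \<le> enat D"
  obtains lev par D' where "leveled lev par" "lev 0 = 0" "\<And>v. v < n \<Longrightarrow> lev v = 0 \<Longrightarrow> v = 0"
    "\<And>v. v < n \<Longrightarrow> lev v \<le> D'" "D' \<le> n" "D' \<le> D" "1 \<le> D"
proof -
  let ?E = "edges (graph_of n es)"
  define lev where "lev = (\<lambda>v. LEAST i. rch ?E i 0 v)"
  have rD: "rch ?E D 0 v" if "v < n" for v using graph_diameter_rch[OF D, of 0 v] n that by simp
  have lev: "rch ?E (lev v) 0 v" if "v < n" for v unfolding lev_def using rD[OF that] by (rule LeastI)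
  have least: "lev v \<le> i" if "rch ?E i 0 v" for v i unfolding lev_def using that by (rule Least_le)
  define ok where "ok = (\<lambda>v e. e \<in> ?E \<and> (\<exists>w\<in>vertices (graph_of n es). ends (graph_of n es) e = {v, w} \<and> Suc (lev w) = lev v))"
  have ex: "\<exists>e. ok v e" if v: "v < n" "0 < lev v" for v
  proof -
    obtain i where i: "lev v = Suc i" using v by (cases "lev v") auto
    have "\<not> rch ?E i 0 v" using least[of i v] i by linarith
    then obtain w where w: "rch ?E i 0 w" "adj ?E w v" using lev[OF v(1)] unfolding i rch.simps by blast
    then obtain e where e: "e \<in> ?E" "ends (graph_of n es) e = {v, w}" unfolding adj_def by (metis insert_commute)
    have "w \<in> vertices (graph_of n es)" using adj_in_V[OF w(2)] by blast
    moreover have "Suc (lev w) = lev v"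
    proof -
      have "rch ?E (lev w) 0 w" using lev \<open>w \<in> _\<close> by simp
      then have "rch ?E (Suc (lev w)) 0 v" using w(2) unfolding rch.simps by blast
      then show ?thesis using least[of "Suc (lev w)" v] least[OF w(1)] i by linarith
    qed
    ultimately show ?thesis unfolding ok_def using e by blast
  qed
  define par where "par = (\<lambda>v. SOME e. ok v e)"
  have "ok v (par v)" if "v < n" "0 < lev v" for v unfolding par_def using ex[OF that] by (rule someI_ex)
  then have L: "leveled lev par" unfolding leveled_def ok_def by simp
  have l0: "lev 0 = 0" using least[of 0 0] by simp
  have root: "v = 0" if "v < n" "lev v = 0" for v using lev[OF that(1)] that(2) by simp
  have "lev v \<le> min D n" if "v < n" for v
  proof -
    have "rch ?E (card (vertices (graph_of n es)) - 1) 0 v"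
      by (rule con_rch_card) (use n rD[OF that] con_def in auto)
    then have "lev v \<le> n - 1" using least by simp
    then show ?thesis using least[OF rD[OF that]] by simp
  qed
  moreover have "1 \<le> D"
  proof (rule ccontr)
    assume "\<not> ?thesis"
    then have D0: "D = 0" by simp
    have "rch ?E D 0 1" by (rule rD) (use n in simp)
    then show False unfolding D0 by simp
  qed
  ultimately show ?thesis using that[of lev par "min D n"] L l0 root by simp
qed

text \<open>The edges at a single vertex form a cut, and a connected graph has at least
  \<open>n - 1\<close> edges. So both numbers are bounded by the input length
  \<open>3 + 2 * m\<close>, on which the running time depends.\<close>

lemma size_bounds:
  assumes k: "kcut k" and n: "2 \<le> n" and c: "conn_on (edges (graph_of n es))"
  shows "k \<le> m" "n \<le> Suc m"
proof -
  have "{0} \<subseteq> vertices (graph_of n es)" "1 \<in> vertices (graph_of n es)" using n by auto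
  then have "{0} \<subseteq> vertices (graph_of n es) \<and> {0} \<noteq> {} \<and> {0} \<noteq> vertices (graph_of n es)" by force
  then have "k \<le> card (cut (edges (graph_of n es)) {0})" using k unfolding kcut_def by blast
  also have "\<dots> \<le> card (edges (graph_of n es))" by (rule card_mono) (auto simp: cut_def)
  finally show "k \<le> m" by simp
  have "card (vertices (graph_of n es)) \<le> ncomp (edges (graph_of n es)) + card (edges (graph_of n es))"
    by (rule ncomp_ge) simp
  then show "n \<le> Suc m" using c ncomp_le_1_iff[of "edges (graph_of n es)"] by simp
qed

text \<open>The first two claims hold for every colouring. Of the diameter bounds, the trivial one
  is for \<open>n \<le> k\<close>, the one with \<open>g\<close> for successful random
  colourings.\<close>

lemma good_output:
  assumes inp: "inp s" and r: "reg s ''r'' = r" "r \<le> m" and k: "kcut k" "2 * r \<le> k" and n: "0 < n"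
  shows "disjoint_spanning_trees (graph_of n es) (output_of (sem post s))" "length (output_of (sem post s)) = r"
    and "T \<in> set (output_of (sem post s)) \<Longrightarrow> graph_diameter (with_edges (graph_of n es) (set T)) \<le> enat (2 * (n - 1))"
    and "\<lbrakk>\<And>c v. c < r \<Longrightarrow> v < n \<Longrightarrow> rch (colc (arr s 0) c) g v 0; all_conn r (arr s 0); T \<in> set (output_of (sem post s))\<rbrakk> \<Longrightarrow>
      graph_diameter (with_edges (graph_of n es) (set T)) \<le> enat (2 * g)"
proof -
  obtain col TC where R: "all_conn r col" "all_conn r (arr s 0) \<Longrightarrow> col = arr s 0"
    "output_of (sem post s) = map (tree_list TC) [0..<r]"
    "\<And>c. c < r \<Longrightarrow> \<exists>V T. bfs_post (colc col c) 0 V T \<and> set (tree_list TC c) = {e. e < m \<and> T e \<noteq> 0}"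
    using post_result[OF inp r k n] by blast
  have sub: "colc col c \<subseteq> {..<m}" for c unfolding colc_def by auto
  have cc: "conn_on (colc col c)" if "c < r" for c using R(1) that unfolding all_conn_def by blast
  have sp: "spanning_tree_edges (graph_of n es) (set (tree_list TC c))" if c: "c < r" for c
  proof -
    obtain V T where VT: "bfs_post (colc col c) 0 V T" "set (tree_list TC c) = {e. e < m \<and> T e \<noteq> 0}" using R(4)[OF c] by blast
    show ?thesis unfolding VT(2) by (rule bfs_tree(1)[OF VT(1) sub cc[OF c] n])
  qed
  have di: "graph_diameter (with_edges (graph_of n es) (set (tree_list TC c))) \<le> enat (2 * h)"
    if c: "c < r" and h: "\<And>v. v < n \<Longrightarrow> rch (colc col c) h v 0" for c h
  proof -
    obtain V T where VT: "bfs_post (colc col c) 0 V T" "set (tree_list TC c) = {e. e < m \<and> T e \<noteq> 0}" using R(4)[OF c] by blast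
    show ?thesis unfolding VT(2) by (rule bfs_tree(2)[OF VT(1) sub cc[OF c] n h])
  qed
  show "length (output_of (sem post s)) = r" unfolding R(3) by simp
  show "disjoint_spanning_trees (graph_of n es) (output_of (sem post s))"
    unfolding disjoint_spanning_trees_def R(3) disjoint_family_on_def using sp by (auto simp: tree_list_def)
  show "graph_diameter (with_edges (graph_of n es) (set T)) \<le> enat (2 * (n - 1))" if T: "T \<in> set (output_of (sem post s))"
  proof -
    obtain c where c: "c < r" "T = tree_list TC c" using T unfolding R(3) by auto
    have "rch (colc col c) (n - 1) v 0" if "v < n" for v
    proof -
      have "con (colc col c) v 0" using cc[OF c(1)] that n unfolding conn_on_def by simp
      then show ?thesis using con_rch_card[OF colc_subset] that by simp
    qed
    then show ?thesis unfolding c(2) by (rule di[OF c(1)])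
  qed
  show "graph_diameter (with_edges (graph_of n es) (set T)) \<le> enat (2 * g)"
    if g: "\<And>c v. c < r \<Longrightarrow> v < n \<Longrightarrow> rch (colc (arr s 0) c) g v 0" and ac: "all_conn r (arr s 0)"
      and T: "T \<in> set (output_of (sem post s))"
  proof -
    obtain c where c: "c < r" "T = tree_list TC c" using T unfolding R(3) by auto
    show ?thesis unfolding c(2) by (rule di[OF c(1)]) (simp only: R(2)[OF ac] g[OF c(1)])
  qed
qed

end

lemma runs_halts: "runs P (init_ram xs) t \<mu> \<Longrightarrow> halts_within P xs t"
  unfolding runs_def halts_within_def by auto

lemma runs_output: "runs P (init_ram xs) t \<mu> \<Longrightarrow> output_pmf P xs t = map_pmf output_of \<mu>"
  unfolding runs_def output_pmf_def by (simp add: pmf.map_comp comp_def)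

definition main :: com where
  "main = Seq (compile read_input) (If (Less (Reg ''n'') (Const 2)) (Store (Const 0) (Const 0))
     (Seq (compile num_colours) (compile (PSeq rand post))))"

definition main_cost :: "nat poly" where
  "main_cost = pcost read_input + pcost num_colours + pcost (PSeq rand post) + [:4:]"

theorem theorem1p2:
  shows "\<exists>(P :: com) (p :: nat poly) (c :: real) (C :: nat) (d :: nat). c > 0 \<and> d > 0 \<and>
    (\<forall>(n :: nat) (k :: nat) (D :: nat) (es :: (nat \<times> nat) list).
       multigraph (graph_of n es) \<and>
       k_edge_connected k (graph_of n es) \<and>
       graph_diameter (graph_of n es) \<le> enat D \<and>
       real k > 1000 * ln (real n) \<longrightarrow>
       (let G = graph_of n es; x = encode n k es; t = poly p (length x) in
          halts_within P x t \<and>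
          (\<forall>Ts\<in>set_pmf (output_pmf P x t).
             disjoint_spanning_trees G Ts \<and> real (length Ts) \<ge> c * (real k / ln (real n))) \<and>
          measure_pmf.prob (output_pmf P x t)
            {Ts. \<forall>T\<in>set Ts. graph_diameter (with_edges G (set T))
                              \<le> enat (C * k ^ (D * (D + 1) div 2))}
            \<ge> 1 - 1 / real n ^ d))"
proof (intro exI conjI allI impI)
  \<comment> \<open>The constant 600 is 200 times 3, from \<open>k < 200 * b * r\<close> and
    \<open>b \<le> 3 * ln n\<close>.\<close>
  show "(1 / 600 :: real) > 0" "(1 :: nat) > 0" by auto
  fix n k D :: nat and es :: "(nat \<times> nat) list"
  assume A: "multigraph (graph_of n es) \<and> k_edge_connected k (graph_of n es) \<and>
       graph_diameter (graph_of n es) \<le> enat D \<and> real k > 1000 * ln (real n)"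
  interpret input_graph n es using A by unfold_locales simp
  let ?G = "graph_of n es" and ?x = "encode n k es"
  let ?N = "length ?x"
  let ?rest = "If (Less (Reg ''n'') (Const 2)) (Store (Const 0) (Const 0))
     (Seq (compile num_colours) (compile (PSeq rand post)))"
  let ?t = "poly main_cost ?N"
  have kc: "kcut k" using A k_edge_connected_kcut by blast
  have ln0: "0 \<le> ln (real n)" by (cases n) auto
  have kpos: "0 < k" using A ln0 by (cases k) auto
  have "connected_graph (with_edges ?G (edges ?G - {}))" using A kpos unfolding k_edge_connected_def by auto
  then have npos: "0 < n" and conn: "conn_on (edges ?G)" using connected_graph_iff[of "edges ?G"] by (auto simp: lessThan_empty_iff)
  let ?s0 = "init_ram ?x"
  define s1 where "s1 = sem read_input ?s0"
  have mem0: "mem ?s0 0 = n" "mem ?s0 (Suc 0) = m" "mem ?s0 2 = k" unfolding init_ram_def encode_def by auto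
  have s1: "s1 = set_reg ''B'' (3 + 2 * m) (set_reg ''k'' k (set_reg ''m'' m (set_reg ''n'' n ?s0)))"
    unfolding s1_def read_input_def by (simp add: mem0 add.commute)
  have inp1: "inp s1"
    unfolding inp_def
  proof (intro conjI allI impI)
    fix e assume e: "e < m"
    have "mem ?s0 (3 + i) = concat (map (\<lambda>(u, v). [u, v]) es) ! i" if "i < 2 * m" for i
      using that length_encode[of n k es] unfolding init_ram_def by (simp add: encode_def numeral_3_eq_3)
    from this[of "2 * e"] this[of "Suc (2 * e)"]
    show "mem s1 (3 + 2 * e) = fst (es ! e)" "mem s1 (4 + 2 * e) = snd (es ! e)"
      unfolding s1 using e pairs_nth[OF e] by (auto simp: eval_nat_numeral)
  qed (auto simp: s1)
  have run1: "runs (compile read_input) ?s0 (poly (pcost read_input) ?N) (return_pmf s1)"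
    unfolding s1_def
    using runs_compile[of read_input ?s0 ?N] psem_flipless[of read_input ?s0] by (simp add: read_input_def)
  have m_N: "m \<le> ?N" unfolding length_encode by simp
  have inner: "\<exists>\<mu>. runs ?rest s1
       (poly (pcost num_colours + pcost (PSeq rand post) + [:3:]) ?N) \<mu> \<and>
     (\<forall>s\<in>set_pmf \<mu>. disjoint_spanning_trees ?G (output_of s) \<and>
        real (length (output_of s)) \<ge> 1 / 600 * (real k / ln (real n))) \<and>
     measure_pmf.prob \<mu> {s. \<forall>T\<in>set (output_of s). graph_diameter (with_edges ?G (set T))
        \<le> enat (3 * k ^ (D * (D + 1) div 2))} \<ge> 1 - 1 / real n ^ 1"
  proof (cases "n < 2")
    case True
    \<comment> \<open>Here \<open>ln n\<close> is 0 and so is the quotient \<open>k / ln n\<close>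
      by convention, hence the empty collection has enough trees. The required probability is
      0.\<close>
    then have n1: "n = 1" using npos by simp
    let ?s = "set_mem 0 0 s1"
    have "runs (Store (Const 0) (Const 0)) s1 1 (return_pmf ?s)" by (rule runs_atomic) simp
    then have "runs ?rest s1 (Suc 1) (return_pmf ?s)"
      using True by (intro runs_If) (simp add: s1)
    then have "runs ?rest s1
       (poly (pcost num_colours + pcost (PSeq rand post) + [:3:]) ?N) (return_pmf ?s)"
      by (rule runs_le) simp
    moreover have "output_of ?s = []" unfolding output_of_def by simp
    ultimately show ?thesis using n1
      by (intro exI[of _ "return_pmf ?s"]) (simp add: disjoint_spanning_trees_def disjoint_family_on_def)
  next
    case False
    then have n2: "2 \<le> n" by simp
    note sz = size_bounds[OF kc n2 conn]
    have lnn: "ln 2 \<le> ln (real n)" using n2 by (intro ln_mono) auto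
    then have "2 / 3 \<le> ln (real n)" using ln2_ge_two_thirds by linarith
    then have "600 < real k" using A by linarith
    then have k600: "600 < k" by simp
    have pow: "Suc (Suc i) \<le> 2 ^ i" if "2 \<le> i" for i :: nat using that by (induction i rule: dec_induct) auto
    have "Suc (Suc m) \<le> 2 ^ m" using pow k600 sz(1) by simp
    then have "n < 2 ^ m" "k < 2 ^ m" using sz by auto
    \<comment> \<open>This is where the assumption on \<open>k\<close> enters: it leaves room for at
      least one colour.\<close>
    moreover have "100 * b \<le> k" if "1 \<le> b" "2 ^ (b - 1) \<le> n" for b
    proof -
      have "real (100 * b) \<le> 300 * ln (real n)" using bit_length_le[OF n2 that] by simp
      also have "\<dots> \<le> real k" using A ln0 by linarith
      finally show ?thesis by simp
    qed
    ultimately obtain b j where bj: "1 \<le> b" "n < 2 ^ b" "2 ^ (b - 1) \<le> n"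
      "reg (sem num_colours s1) ''j'' = j" "reg (sem num_colours s1) ''r'' = 2 ^ j" "j \<le> m"
      "100 * b * 2 ^ j \<le> k" "k < 200 * b * 2 ^ j"
      using num_colours_post[of s1 m n k] npos by (auto simp: s1)
    define r where "r = (2::nat) ^ j"
    have r0: "0 < r" unfolding r_def by simp
    have r100: "100 * r \<le> k"
    proof -
      have "100 * 1 * r \<le> 100 * b * r" using bj(1) by (intro mult_le_mono) auto
      also have "\<dots> \<le> k" unfolding r_def by (rule bj(7))
      finally show ?thesis by simp
    qed
    then have r2: "2 * r \<le> k" "r \<le> k" "r \<le> m" using sz by auto
    define s2 where "s2 = sem num_colours s1"
    have fr2: "frame {''u'', ''l'', ''t'', ''r'', ''j'', ''f''} {} s1 s2" unfolding s2_def using sem_frame[of num_colours s1] by simp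
    have inp2: "inp s2" by (rule inp_frame[OF inp1 fr2]) auto
    have reg2: "reg s2 ''m'' = m" "reg s2 ''n'' = n" "reg s2 ''r'' = r" "reg s2 ''j'' = j"
      using inp2 bj unfolding inp_def s2_def r_def by auto
    define \<nu> where "\<nu> = psem rand s2"
    define \<mu> where "\<mu> = map_pmf (sem post) \<nu>"
    have mu: "psem (PSeq rand post) s2 = \<mu>"
    proof -
      have "psem post = (\<lambda>s. return_pmf (sem post s))" by (rule ext) (simp add: psem_flipless)
      then show ?thesis unfolding \<mu>_def \<nu>_def map_pmf_def by (simp only: psem.simps(6))
    qed
    have "runs (compile num_colours) s1 (poly (pcost num_colours) ?N) (return_pmf s2)"
      unfolding s2_def using runs_compile[of num_colours s1 ?N] psem_flipless[of num_colours s1] m_N by (simp add: s1)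
    moreover have "runs (compile (PSeq rand post)) s2 (poly (pcost (PSeq rand post)) ?N) \<mu>"
      unfolding mu[symmetric]
    proof (rule runs_compile)
      show "reg s2 l \<le> ?N" if "l \<in> limits (PSeq rand post)" for l
        using that reg2 sz bj(6) r2 unfolding length_encode by auto
    qed auto
    ultimately have "runs (Seq (compile num_colours) (compile (PSeq rand post))) s1
      (Suc (poly (pcost num_colours) ?N + poly (pcost (PSeq rand post)) ?N)) (bind_pmf (return_pmf s2) (\<lambda>_. \<mu>))"
      by (intro runs_Seq) auto
    then have "runs ?rest s1
      (Suc (Suc (poly (pcost num_colours) ?N + poly (pcost (PSeq rand post)) ?N))) \<mu>"
      using n2 by (intro runs_If) (simp add: s1 bind_return_pmf)
    then have R: "runs ?rest s1
       (poly (pcost num_colours + pcost (PSeq rand post) + [:3:]) ?N) \<mu>"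
      by (rule runs_le) simp
    have S: "inp s \<and> reg s ''r'' = r" if "s \<in> set_pmf \<nu>" for s
    proof -
      have fr: "frame {''x'', ''i'', ''g'', ''e''} {0} s2 s" using psem_frame[of rand s s2] that unfolding \<nu>_def by simp
      have "inp s" by (rule inp_frame[OF inp2 fr]) auto
      then show ?thesis using frame_reg[OF fr] reg2 by simp
    qed
    have rk: "real r \<ge> 1 / 600 * (real k / ln (real n))"
    proof -
      have "real k \<le> 200 * real b * real r" using bj(8) unfolding r_def by (metis less_imp_le of_nat_le_iff of_nat_mult of_nat_numeral)
      also have "\<dots> \<le> 200 * (3 * ln (real n)) * real r" using bit_length_le[OF n2 bj(1,3)] by (intro mult_right_mono) auto
      finally show ?thesis using \<open>2 / 3 \<le> ln (real n)\<close> by (simp add: field_simps)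
    qed
    have det: "disjoint_spanning_trees ?G (output_of s) \<and> real (length (output_of s)) \<ge> 1 / 600 * (real k / ln (real n))"
      if s: "s \<in> set_pmf \<mu>" for s
    proof -
      obtain s' where "s' \<in> set_pmf \<nu>" "s = sem post s'" using s unfolding \<mu>_def by auto
      then show ?thesis using good_output(1,2)[of s' r k] S[of s'] r2 kc npos rk by simp
    qed
    let ?Z = "{s. \<forall>T\<in>set (output_of s). graph_diameter (with_edges ?G (set T)) \<le> enat (3 * k ^ (D * (D + 1) div 2))}"
    obtain lev par D' where L: "leveled lev par" "lev 0 = 0" "\<And>v. v < n \<Longrightarrow> lev v = 0 \<Longrightarrow> v = 0"
      "\<And>v. v < n \<Longrightarrow> lev v \<le> D'" "D' \<le> n" "D' \<le> D" "1 \<le> D"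
      using levels_exist[OF n2] A by blast
    have "measure_pmf.prob \<nu> (sem post -` ?Z) \<ge> 1 - 1 / real n"
    proof (cases "n \<le> k")
      case True
      have "s \<in> sem post -` ?Z" if s: "s \<in> set_pmf \<nu>" for s
      proof -
        have "graph_diameter (with_edges ?G (set T)) \<le> enat (3 * k ^ (D * (D + 1) div 2))" if T: "T \<in> set (output_of (sem post s))" for T
        proof -
          have "graph_diameter (with_edges ?G (set T)) \<le> enat (2 * (n - 1))"
            using good_output(3)[OF _ _ r2(3) kc r2(1) npos T] S[OF s] by simp
          \<comment> \<open>As \<open>D\<close> is at least 1, the exponent is at least 1 and the
            power at least \<open>k\<close>, hence at least \<open>n\<close>.\<close>
          moreover have "2 * (n - 1) \<le> 3 * k ^ (D * (D + 1) div 2)"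
          proof -
            have "1 * 2 div 2 \<le> D * (D + 1) div 2" using L(7) by (intro div_le_mono mult_le_mono) auto
            then have "k ^ 1 \<le> k ^ (D * (D + 1) div 2)" using kpos by (intro power_increasing) auto
            then show ?thesis using True by simp
          qed
          ultimately show ?thesis by (meson enat_ord_simps(1) order_trans)
        qed
        then show ?thesis by simp
      qed
      then have "measure_pmf.prob \<nu> (sem post -` ?Z) = 1" by (subst measure_pmf.prob_eq_1) (auto simp: AE_measure_pmf_iff)
      then show ?thesis by simp
    next
      case False
      let ?W = "{\<omega>. \<forall>c<r. conn_on (colc \<omega> c) \<and> (\<forall>u\<in>vertices ?G. rch (colc \<omega> c) (desc k D') u 0)}"
      have "1 - 1 / real (card (vertices ?G)) \<le> measure_pmf.prob (colouring r) ?W"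
      proof (rule random_colouring[OF kc L(1)])
        show "(1 - 1 / real r) ^ (k div 2) \<le> 1 / real (card (vertices ?G)) ^ 10"
          using avoid_bound[OF n2 bj(2,1) r0] bj(7) unfolding r_def by simp
      qed (use L npos r0 r2 k600 False in auto)
      also have "colouring r = map_pmf (cols m) \<nu>"
        using rand_uniform[of s2] reg2 unfolding \<nu>_def r_def by simp
      also have "measure_pmf.prob (map_pmf (cols m) \<nu>) ?W = measure_pmf.prob \<nu> (cols m -` ?W)" by (rule measure_map_pmf)
      also have "\<dots> \<le> measure_pmf.prob \<nu> (sem post -` ?Z)"
      proof (rule measure_pmf.finite_measure_mono_AE)
        show "AE s in \<nu>. s \<in> cols m -` ?W \<longrightarrow> s \<in> sem post -` ?Z"
          unfolding AE_measure_pmf_iff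
        proof (intro ballI impI)
          fix s assume s: "s \<in> set_pmf \<nu>" "s \<in> cols m -` ?W"
          have cc: "colc (cols m s) c = colc (arr s 0) c" for c unfolding colc_def cols_def by auto
          have W: "conn_on (colc (arr s 0) c)" "\<And>u. u < n \<Longrightarrow> rch (colc (arr s 0) c) (desc k D') u 0" if "c < r" for c
            using s(2) that cc[of c] by (auto simp del: rch.simps)
          have "graph_diameter (with_edges ?G (set T)) \<le> enat (3 * k ^ (D * (D + 1) div 2))" if T: "T \<in> set (output_of (sem post s))" for T
          proof -
            have "graph_diameter (with_edges ?G (set T)) \<le> enat (2 * desc k D')"
            proof (rule good_output(4)[OF _ _ r2(3) kc r2(1) npos _ _ T])
              show "all_conn r (arr s 0)" unfolding all_conn_def using W by blast
            qed (use S[OF s(1)] W in auto)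
            moreover have "2 * desc k D' \<le> 3 * k ^ (D * (D + 1) div 2)"
            proof -
              have "2 * desc k D' + 1 \<le> (2 * k + 1) ^ D'" by (rule desc_bound[OF kpos])
              also have "\<dots> \<le> (3 * k) ^ D'" using kpos by (intro power_mono) auto
              also have "\<dots> \<le> (3 * k) ^ D" using L(6) kpos by (intro power_increasing) auto
              also have "\<dots> \<le> 3 * k ^ (D * (D + 1) div 2)" using num_levels_bound[OF L(7)] k600 by simp
              finally show ?thesis by simp
            qed
            ultimately show ?thesis by (meson enat_ord_simps(1) order_trans)
          qed
          then show "s \<in> sem post -` ?Z" by simp
        qed
      qed auto
      finally show ?thesis by simp
    qed
    then have "measure_pmf.prob \<mu> ?Z \<ge> 1 - 1 / real n ^ 1" unfolding \<mu>_def by (simp add: measure_map_pmf)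
    then show ?thesis using R det by blast
  qed
  then obtain \<mu> where M: "runs ?rest s1
       (poly (pcost num_colours + pcost (PSeq rand post) + [:3:]) ?N) \<mu>"
     "\<forall>s\<in>set_pmf \<mu>. disjoint_spanning_trees ?G (output_of s) \<and>
        real (length (output_of s)) \<ge> 1 / 600 * (real k / ln (real n))"
     "measure_pmf.prob \<mu> {s. \<forall>T\<in>set (output_of s). graph_diameter (with_edges ?G (set T))
        \<le> enat (3 * k ^ (D * (D + 1) div 2))} \<ge> 1 - 1 / real n ^ 1" by blast
  have "runs main ?s0 (Suc (poly (pcost read_input) ?N + poly (pcost num_colours + pcost (PSeq rand post) + [:3:]) ?N))
    (bind_pmf (return_pmf s1) (\<lambda>_. \<mu>))"
    unfolding main_def by (rule runs_Seq[OF run1]) (use M(1) in simp)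
  then have "runs main ?s0 ?t \<mu>" unfolding bind_return_pmf by (rule runs_le) (simp add: main_cost_def)
  note H = runs_halts[OF this] runs_output[OF this]
  show "let G = graph_of n es; x = encode n k es; t = poly main_cost (length x) in
          halts_within main x t \<and>
          (\<forall>Ts\<in>set_pmf (output_pmf main x t).
             disjoint_spanning_trees G Ts \<and> real (length Ts) \<ge> 1 / 600 * (real k / ln (real n))) \<and>
          measure_pmf.prob (output_pmf main x t)
            {Ts. \<forall>T\<in>set Ts. graph_diameter (with_edges G (set T)) \<le> enat (3 * k ^ (D * (D + 1) div 2))}
            \<ge> 1 - 1 / real n ^ 1"
    unfolding Let_def H(2) using H(1) M(2,3) by (simp add: measure_map_pmf vimage_def)
qed

end
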